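(* Let $d\ge 1$, $1<r<\infty$, $s\ge 0$ with $\frac 1r+\frac sd=\frac 12$. Then there exists a constant $C>0$, depending only on $d,r,s$, such that for all $f\in\dot H^s_x(\mathbf{R}^d)$, $$\|f\|_{L^r_x(\mathbf{R}^d)}\le C\,\|D^sf\|_{L^2_x(\mathbf{R}^d)}^{1-2s/d}\;\|D^sf\|_{\dot B^0_{2,\infty}}^{2s/d}.$$
   Context: $\hat f(\xi)=\int_{\mathbf{R}^d}e^{-ix\cdot\xi}f(x)\,dx$. $D^s$ is the Fourier multiplier operator $\widehat{D^sf}(\xi)=|\xi|^s\hat f(\xi)$, and $\dot H^s_x(\mathbf{R}^d)$ is the homogeneous Sobolev space of $f$ with $\|f\|_{\dot H^s_x}:=\|D^sf\|_{L^2_x}<\infty$. The Besov norm is $$\|g\|_{\dot B^0_{2,\infty}}:=\sup_{k\in\mathbf{Z}}\|g_k\|_{L^2_x},$$ where $g_k$ is the $k$-th Littlewood–Paley piece defined by $\hat g_k:=\hat g\,1_{2^k\le|\xi|\le 2^{k+1}}$. When $s=0$ the factor with exponent $0$ is read as $1$. *)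

theory Defs
  imports "HOL-Analysis.Analysis"
begin

section \<open>Schwartz functions and tempered distributions\<close>

text \<open>Mixed partial derivatives are indexed by lists of basis vectors. Since \<^const>\<open>frechet_derivative\<close>
  is a choice outside the differentiable case, they are only meaningful together with
  \<open>smooth\<close>.\<close>

fun partial_deriv :: "'a::euclidean_space list \<Rightarrow> ('a \<Rightarrow> complex) \<Rightarrow> 'a \<Rightarrow> complex" where
  "partial_deriv [] f = f"
| "partial_deriv (b # bs) f = (\<lambda>x. frechet_derivative (partial_deriv bs f) (at x) b)"

definition smooth :: "('a::euclidean_space \<Rightarrow> complex) \<Rightarrow> bool" where
  "smooth f \<longleftrightarrow> (\<forall>bs x. set bs \<subseteq> Basis \<longrightarrow> partial_deriv bs f differentiable (at x))"

definition schwartz :: "('a::euclidean_space \<Rightarrow> complex) set" where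
  "schwartz = {f. smooth f \<and>
     (\<forall>bs N. set bs \<subseteq> Basis \<longrightarrow> bounded (range (\<lambda>x. (1 + norm x) ^ N *\<^sub>R partial_deriv bs f x)))}"

definition schwartz_seminorm :: "nat \<Rightarrow> ('a::euclidean_space \<Rightarrow> complex) \<Rightarrow> real" where
  "schwartz_seminorm N f =
     (\<Sum>bs | set bs \<subseteq> Basis \<and> length bs \<le> N. SUP x. (1 + norm x) ^ N * norm (partial_deriv bs f x))"

text \<open>A distribution is a functional on all functions, of which only the values on
  \<^const>\<open>schwartz\<close> are ever used; its values elsewhere carry no meaning.\<close>

type_synonym 'a dist = "('a \<Rightarrow> complex) \<Rightarrow> complex"

definition tempered_distribution :: "'a::euclidean_space dist \<Rightarrow> bool" where
  "tempered_distribution u \<longleftrightarrow>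
     (\<forall>\<phi>\<in>schwartz. \<forall>\<psi>\<in>schwartz. u (\<lambda>x. \<phi> x + \<psi> x) = u \<phi> + u \<psi>) \<and>
     (\<forall>c. \<forall>\<phi>\<in>schwartz. u (\<lambda>x. c * \<phi> x) = c * u \<phi>) \<and>
     (\<exists>C N. \<forall>\<phi>\<in>schwartz. norm (u \<phi>) \<le> C * schwartz_seminorm N \<phi>)"

definition dist_of_fun :: "('a::euclidean_space \<Rightarrow> complex) \<Rightarrow> 'a dist" where
  "dist_of_fun h = (\<lambda>\<phi>. \<integral>x. h x * \<phi> x \<partial>lborel)"

text \<open>The integrability condition makes \<open>h\<close> locally integrable (test against a Gaussian) and gives
  a meaning to \<open>dist_of_fun h\<close>. It holds for every \<open>h\<close> in \<open>L\<^sup>p\<close>.\<close>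

definition represents :: "('a::euclidean_space \<Rightarrow> complex) \<Rightarrow> 'a dist \<Rightarrow> bool" where
  "represents h u \<longleftrightarrow> h \<in> borel_measurable borel \<and>
     (\<forall>\<phi>\<in>schwartz. integrable lborel (\<lambda>x. h x * \<phi> x) \<and> u \<phi> = dist_of_fun h \<phi>)"

section \<open>Fourier transform and Fourier multipliers\<close>

definition fourier :: "('a::euclidean_space \<Rightarrow> complex) \<Rightarrow> 'a \<Rightarrow> complex" where
  "fourier f \<xi> = (\<integral>x. exp (- \<i> * complex_of_real (x \<bullet> \<xi>)) * f x \<partial>lborel)"

definition inv_fourier :: "('a::euclidean_space \<Rightarrow> complex) \<Rightarrow> 'a \<Rightarrow> complex" where
  "inv_fourier f x =
     complex_of_real (1 / (2 * pi) ^ DIM('a)) *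
     (\<integral>\<xi>. exp (\<i> * complex_of_real (x \<bullet> \<xi>)) * f \<xi> \<partial>lborel)"

definition fourier_dist :: "'a::euclidean_space dist \<Rightarrow> 'a dist" where
  "fourier_dist u = (\<lambda>\<phi>. u (fourier \<phi>))"

definition inv_fourier_dist :: "'a::euclidean_space dist \<Rightarrow> 'a dist" where
  "inv_fourier_dist u = (\<lambda>\<phi>. u (inv_fourier \<phi>))"

text \<open>The multipliers below, \<open>|\<xi>|\<^sup>s\<close> and indicators of annuli, are not smooth, so they act only on
  distributions whose Fourier transform is a function. This function is unique up to null sets.\<close>

definition fourier_fun :: "'a::euclidean_space dist \<Rightarrow> 'a \<Rightarrow> complex" where
  "fourier_fun u = (SOME h. represents h (fourier_dist u))"

definition fourier_multiplier :: "('a::euclidean_space \<Rightarrow> real) \<Rightarrow> 'a dist \<Rightarrow> 'a dist" where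
  "fourier_multiplier m u =
     inv_fourier_dist (dist_of_fun (\<lambda>\<xi>. complex_of_real (m \<xi>) * fourier_fun u \<xi>))"

definition D :: "real \<Rightarrow> 'a::euclidean_space dist \<Rightarrow> 'a dist" where
  "D s = fourier_multiplier (\<lambda>\<xi>. norm \<xi> powr s)"

definition LP_piece :: "int \<Rightarrow> 'a::euclidean_space dist \<Rightarrow> 'a dist" where
  "LP_piece k = fourier_multiplier (indicator {\<xi>. 2 powi k \<le> norm \<xi> \<and> norm \<xi> \<le> 2 powi (k + 1)})"

section \<open>Norms\<close>

text \<open>Powers with exponent \<open>a \<ge> 0\<close>, with \<open>x\<^sup>0 = 1\<close> also for \<open>x = 0\<close>, unlike \<open>0 powr 0 = 0\<close>.\<close>

definition ennreal_pow :: "ennreal \<Rightarrow> real \<Rightarrow> ennreal" where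
  "ennreal_pow x a =
     (if a = 0 then 1 else if x = \<infinity> then \<infinity> else ennreal (enn2real x powr a))"

definition Lp_norm :: "real \<Rightarrow> ('a::euclidean_space \<Rightarrow> complex) \<Rightarrow> ennreal" where
  "Lp_norm p h = ennreal_pow (\<integral>\<^sup>+x. ennreal (norm (h x) powr p) \<partial>lborel) (1 / p)"

text \<open>The \<open>L\<^sup>p\<close> norm of a distribution is that of the function representing it, and \<open>\<infinity>\<close> if there is
  none. Two representing functions agree almost everywhere, so the infimum is over at most one
  value.\<close>

definition Lp_norm_dist :: "real \<Rightarrow> 'a::euclidean_space dist \<Rightarrow> ennreal" where
  "Lp_norm_dist p u = (INF h\<in>{h. represents h u}. Lp_norm p h)"

definition besov_norm :: "'a::euclidean_space dist \<Rightarrow> ennreal" where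
  "besov_norm g = (SUP k. Lp_norm_dist 2 (LP_piece k g))"

text \<open>The requirement that the Fourier transform be a function excludes the nonzero polynomials,
  for which \<open>|\<xi>|\<^sup>s\<close> times the Fourier transform has no meaning or vanishes.\<close>

definition homogeneous_sobolev :: "real \<Rightarrow> 'a::euclidean_space dist set" where
  "homogeneous_sobolev s =
     {u. tempered_distribution u \<and> (\<exists>h. represents h (fourier_dist u)) \<and>
         Lp_norm_dist 2 (D s u) < \<infinity>}"

end

theory Submission
  imports Defs "HOL-Probability.Probability"
begin

text \<open>Write \<open>h\<close> for the Fourier transform of \<open>f\<close>, and put \<open>\<theta> = d/2 - s = d/r\<close>. By Cauchy-Schwarz on each
  dyadic annulus, the part of \<open>f\<close> with frequencies below \<open>2\<^sup>K\<close> is bounded by a multiple of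
  \<open>B 2\<^bsup>K\<theta>\<^esup>\<close>, where \<open>B\<close> is the Besov norm of \<open>D\<^sup>s f\<close>. For each level \<open>\<lambda>\<close> choose \<open>K\<close> such that this bound
  is about \<open>\<lambda>/2\<close>. Then \<open>{|f| \<ge> \<lambda>}\<close> only sees the high frequencies, and Chebyshev and Plancherel
  bound its measure by a multiple of \<open>\<lambda>\<close> to the power \<open>-2\<close> times the integral of \<open>|h|\<^sup>2\<close> over
  \<open>{\<lambda> \<le> c B |\<xi>|\<^sup>\<theta>}\<close>. Integrating against \<open>r \<lambda>\<^bsup>r-1\<^esup>\<close> produces the weight \<open>(B |\<xi>|\<^sup>\<theta>)\<^bsup>r-2\<^esup> = B\<^bsup>r-2\<^esup> |\<xi>|\<^bsup>2s\<^esup>\<close>.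
  This is done for truncations of \<open>h\<close> to bounded sets, which converge in \<open>L\<^sup>r\<close> by the same estimate
  applied to their differences.\<close>

section \<open>Schwartz functions\<close>

text \<open>The exponents decide the route: 1/r > 0 means \<theta> > 0, so the annuli below 2^K form
  a convergent geometric series, and s > 0 means r > 2, so the power \<lambda>^(r-3) left after
  Chebyshev is integrable at 0. For s = 0 the latter fails, and the claim is instead a comparison of
  f with its image under \<open>D 0\<close>. The main obstacle is that f and D^s f are functionals:
  their norms are infima over representing functions, and every multiplier acts through a chosen
  Fourier transform that is fixed only almost everywhere. So each norm on the right is first bounded
  below by an integral of |h|^2 on the frequency side. This takes only the inequality in
  Plancherel's theorem together with uniqueness of representing functions. One extension principle,
  from bounded frequency sets to the whole function, serves twice: with exponent 2 in this
  Plancherel step, and with exponent r to produce the function that represents f. Since the supremum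
  of the dyadic pieces may be 0, the estimate is proved for every larger B > 0, and B then decreases
  to it.\<close>

definition rapidly_decreasing :: "('a::euclidean_space \<Rightarrow> complex) \<Rightarrow> bool" where
  "rapidly_decreasing f \<longleftrightarrow> (\<forall>N. \<exists>C. \<forall>x. (1 + norm x) ^ N * norm (f x) \<le> C)"

lemma rapidly_decreasingD:
  assumes "rapidly_decreasing f"
  obtains C where "C \<ge> 0" "\<And>x. (1 + norm x) ^ N * norm (f x) \<le> C"
proof -
  from assms obtain C where C: "\<And>x. (1 + norm x) ^ N * norm (f x) \<le> C"
    unfolding rapidly_decreasing_def by blast
  have "0 \<le> (1 + norm (0::'a)) ^ N * norm (f 0)" by simp
  also have "\<dots> \<le> C" by (rule C)
  finally show ?thesis using C that by blast
qed

lemma rapidly_decreasing_iff_bounded: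
  "rapidly_decreasing f \<longleftrightarrow> (\<forall>N. bounded (range (\<lambda>x. (1 + norm x) ^ N *\<^sub>R f x)))"
  by (simp add: rapidly_decreasing_def bounded_iff abs_of_nonneg)

lemma rapidly_decreasing_add:
  assumes "rapidly_decreasing f" "rapidly_decreasing g"
  shows "rapidly_decreasing (\<lambda>x. f x + g x)"
  unfolding rapidly_decreasing_def
proof
  fix N
  obtain A where A: "\<And>x. (1 + norm x) ^ N * norm (f x) \<le> A"
    using assms(1) unfolding rapidly_decreasing_def by blast
  obtain B where B: "\<And>x. (1 + norm x) ^ N * norm (g x) \<le> B"
    using assms(2) unfolding rapidly_decreasing_def by blast
  have "(1 + norm x) ^ N * norm (f x + g x) \<le> A + B" for x
  proof -
    have "(1 + norm x) ^ N * norm (f x + g x) \<le> (1 + norm x) ^ N * (norm (f x) + norm (g x))"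
      by (intro mult_left_mono norm_triangle_ineq) auto
    with A[of x] B[of x] show ?thesis by (simp add: distrib_left)
  qed
  then show "\<exists>C. \<forall>x. (1 + norm x) ^ N * norm (f x + g x) \<le> C" by blast
qed

lemma rapidly_decreasing_cmult:
  assumes "rapidly_decreasing f"
  shows "rapidly_decreasing (\<lambda>x. c * f x)"
  unfolding rapidly_decreasing_def
proof
  fix N
  obtain A where A: "\<And>x. (1 + norm x) ^ N * norm (f x) \<le> A"
    using assms(1) unfolding rapidly_decreasing_def by blast
  have "(1 + norm x) ^ N * norm (c * f x) \<le> norm c * A" for x
    using mult_left_mono[OF A[of x], of "norm c"] by (simp add: norm_mult mult_ac)
  then show "\<exists>C. \<forall>x. (1 + norm x) ^ N * norm (c * f x) \<le> C" by blast
qed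

lemma rapidly_decreasing_coord_mult:
  assumes "rapidly_decreasing f" "norm b = 1"
  shows "rapidly_decreasing (\<lambda>x. complex_of_real (x \<bullet> b) * f x)"
  unfolding rapidly_decreasing_def
proof
  fix N
  obtain A where A: "\<And>x. (1 + norm x) ^ (Suc N) * norm (f x) \<le> A"
    using assms(1) unfolding rapidly_decreasing_def by blast
  have "(1 + norm x) ^ N * norm (complex_of_real (x \<bullet> b) * f x) \<le> A" for x
  proof -
    have "\<bar>x \<bullet> b\<bar> \<le> 1 + norm x"
      using Cauchy_Schwarz_ineq2[of x b] assms(2) by simp
    then have "(1 + norm x) ^ N * norm (f x) * \<bar>x \<bullet> b\<bar> \<le> (1 + norm x) ^ N * norm (f x) * (1 + norm x)"
      by (intro mult_left_mono) auto
    also have "\<dots> \<le> A" using A[of x] by (simp add: mult_ac)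
    finally show ?thesis by (simp add: norm_mult mult_ac)
  qed
  then show "\<exists>C. \<forall>x. (1 + norm x) ^ N * norm (complex_of_real (x \<bullet> b) * f x) \<le> C" by blast
qed

lemma partial_deriv_append: "partial_deriv (bs @ cs) f = partial_deriv bs (partial_deriv cs f)"
  by (induction bs) auto

lemma has_derivative_exp_complex:
  fixes g :: "'a::real_normed_vector \<Rightarrow> complex"
  assumes "(g has_derivative g') (at x)"
  shows "((\<lambda>x. exp (g x)) has_derivative (\<lambda>v. g' v * exp (g x))) (at x)"
  using has_derivative_compose[OF assms DERIV_exp[THEN has_field_derivative_imp_has_derivative]]
  by (simp add: mult.commute)

text \<open>All iterated partial derivatives of \<open>f\<close> stay in a class \<open>T\<close>
  closed under differentiation along basis vectors, so regularity and decay need to be checked only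
  for the members of \<open>T\<close> themselves. Closure properties of the Schwartz space are
  proved below by exhibiting such a class.\<close>

lemma schwartz_coinduct:
  assumes "f \<in> T"
    and diff: "\<And>g x. g \<in> T \<Longrightarrow> g differentiable at x"
    and rap: "\<And>g. g \<in> T \<Longrightarrow> rapidly_decreasing g"
    and der: "\<And>g b. g \<in> T \<Longrightarrow> b \<in> Basis \<Longrightarrow> (\<lambda>x. frechet_derivative g (at x) b) \<in> T"
  shows "f \<in> schwartz"
proof -
  have "set bs \<subseteq> Basis \<Longrightarrow> partial_deriv bs f \<in> T" for bs
    by (induction bs) (auto simp: assms)
  then show ?thesis
    unfolding schwartz_def smooth_def
    using diff rap[unfolded rapidly_decreasing_iff_bounded] by blast
qed

lemma schwartz_differentiable: "f \<in> schwartz \<Longrightarrow> f differentiable at x"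
  unfolding schwartz_def smooth_def by (auto dest: spec[of _ "[]"])

lemma schwartz_rapidly_decreasing: "f \<in> schwartz \<Longrightarrow> rapidly_decreasing f"
  unfolding schwartz_def rapidly_decreasing_iff_bounded by (auto dest: spec[of _ "[]"])

lemma schwartz_deriv:
  assumes "f \<in> schwartz" "b \<in> Basis"
  shows "(\<lambda>x. frechet_derivative f (at x) b) \<in> schwartz"
proof -
  let ?g = "\<lambda>x. frechet_derivative f (at x) b"
  have eq: "partial_deriv bs ?g = partial_deriv (bs @ [b]) f" for bs
    by (simp add: partial_deriv_append)
  have "set bs \<subseteq> Basis \<Longrightarrow> set (bs @ [b]) \<subseteq> Basis" for bs
    using assms by simp
  then show ?thesis
    using assms(1) unfolding schwartz_def smooth_def mem_Collect_eq eq by blast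
qed

lemma schwartz_has_derivative:
  "f \<in> schwartz \<Longrightarrow> (f has_derivative frechet_derivative f (at x)) (at x)"
  using schwartz_differentiable frechet_derivative_works by blast

lemma schwartz_continuous_on: "f \<in> schwartz \<Longrightarrow> continuous_on A f"
  by (meson continuous_at_imp_continuous_on differentiable_imp_continuous_within schwartz_differentiable)

lemma schwartz_measurable: "f \<in> schwartz \<Longrightarrow> f \<in> borel_measurable borel"
  by (intro borel_measurable_continuous_onI schwartz_continuous_on)

lemma schwartz_lincomb:
  fixes f g :: "'a::euclidean_space \<Rightarrow> complex"
  assumes "f \<in> schwartz" "g \<in> schwartz"
  shows "(\<lambda>x. a * f x + g x) \<in> schwartz"
proof (rule schwartz_coinduct)
  let ?U = "{h :: 'a \<Rightarrow> complex. \<exists>f g. f \<in> schwartz \<and> g \<in> schwartz \<and> h = (\<lambda>x. a * f x + g x)}"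
  have hd: "((\<lambda>x. a * f x + g x) has_derivative
      (\<lambda>v. a * frechet_derivative f (at x) v + frechet_derivative g (at x) v)) (at x)"
    if "f \<in> schwartz" "g \<in> schwartz" for f g :: "'a \<Rightarrow> complex" and x
    by (intro has_derivative_add has_derivative_mult_right schwartz_has_derivative that)
  show "(\<lambda>x. a * f x + g x) \<in> ?U"
    using assms by blast
  fix h assume "h \<in> ?U"
  then obtain f g where fg: "f \<in> schwartz" "g \<in> schwartz" and h: "h = (\<lambda>x. a * f x + g x)"
    by blast
  show "h differentiable at x" for x
    unfolding h differentiable_def using hd[OF fg] by blast
  show "rapidly_decreasing h"
    unfolding h by (intro rapidly_decreasing_add rapidly_decreasing_cmult schwartz_rapidly_decreasing fg)
  show "(\<lambda>x. frechet_derivative h (at x) b) \<in> ?U" if "b \<in> Basis" for b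
    unfolding h by (subst frechet_derivative_at[OF hd[OF fg], symmetric])
      (use fg schwartz_deriv that in blast)
qed

lemma schwartz_zero: "(\<lambda>x. 0) \<in> schwartz"
proof (rule schwartz_coinduct[where T = "{\<lambda>x. 0}"])
  show "rapidly_decreasing g" if "g \<in> {\<lambda>x::'a. 0}" for g
    using that by (auto simp: rapidly_decreasing_def)
qed (auto simp: frechet_derivative_const)

lemma schwartz_add: "f \<in> schwartz \<Longrightarrow> g \<in> schwartz \<Longrightarrow> (\<lambda>x. f x + g x) \<in> schwartz"
  using schwartz_lincomb[of f g 1] by simp

lemma schwartz_cmult: "f \<in> schwartz \<Longrightarrow> (\<lambda>x. a * f x) \<in> schwartz"
  using schwartz_lincomb[OF _ schwartz_zero, of f a] by simp

lemma schwartz_sum: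
  "finite I \<Longrightarrow> (\<And>i. i \<in> I \<Longrightarrow> f i \<in> schwartz) \<Longrightarrow> (\<lambda>x. \<Sum>i\<in>I. f i x) \<in> schwartz"
  by (induction I rule: finite_induct) (auto intro: schwartz_zero schwartz_add)

text \<open>The product rule produces the extra term \<open>(b \<bullet> c) * f x\<close>. Hence the
  class closed under derivatives consists of sums of a coordinate multiple of \<open>f\<close> and a
  second Schwartz function \<open>g\<close> that absorbs such terms.\<close>

lemma schwartz_coord_mult:
  fixes f :: "'a::euclidean_space \<Rightarrow> complex"
  assumes "f \<in> schwartz" "c \<in> Basis"
  shows "(\<lambda>x. complex_of_real (x \<bullet> c) * f x) \<in> schwartz"
proof (rule schwartz_coinduct)
  let ?T = "{h :: 'a \<Rightarrow> complex. \<exists>f g. f \<in> schwartz \<and> g \<in> schwartz \<and>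
    h = (\<lambda>x. complex_of_real (x \<bullet> c) * f x + g x)}"
  have hd: "((\<lambda>x. complex_of_real (x \<bullet> c) * f x + g x) has_derivative
      (\<lambda>v. (complex_of_real (x \<bullet> c) * frechet_derivative f (at x) v + complex_of_real (v \<bullet> c) * f x)
         + frechet_derivative g (at x) v)) (at x)"
    if "f \<in> schwartz" "g \<in> schwartz" for f g x
    by (intro has_derivative_add has_derivative_mult schwartz_has_derivative that
        has_derivative_of_real has_derivative_inner_left has_derivative_ident)
  have "\<exists>g \<in> schwartz. (\<lambda>x. complex_of_real (x \<bullet> c) * f x) = (\<lambda>x. complex_of_real (x \<bullet> c) * f x + g x)"
    by (rule bexI[OF _ schwartz_zero]) simp
  then show "(\<lambda>x. complex_of_real (x \<bullet> c) * f x) \<in> ?T" using assms by blast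
  fix h assume "h \<in> ?T"
  then obtain f g where fg: "f \<in> schwartz" "g \<in> schwartz"
    and h: "h = (\<lambda>x. complex_of_real (x \<bullet> c) * f x + g x)" by blast
  show "h differentiable at x" for x
    unfolding h differentiable_def using hd[OF fg] by blast
  show "rapidly_decreasing h"
    unfolding h using assms
    by (intro rapidly_decreasing_add rapidly_decreasing_coord_mult schwartz_rapidly_decreasing fg) auto
  show "(\<lambda>x. frechet_derivative h (at x) b) \<in> ?T" if b: "b \<in> Basis" for b
  proof -
    have eq: "(\<lambda>x. frechet_derivative h (at x) b) =
      (\<lambda>x. complex_of_real (x \<bullet> c) * frechet_derivative f (at x) b
         + (complex_of_real (b \<bullet> c) * f x + frechet_derivative g (at x) b))"
      unfolding h by (subst frechet_derivative_at[OF hd[OF fg], symmetric]) (simp add: add_ac)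
    show ?thesis
      unfolding eq using fg b schwartz_deriv schwartz_lincomb by blast
  qed
qed

text \<open>This is the weight against which the growth of |\<xi>|^s is measured later. It is built
  from the squared norm because that is a sum of products of coordinates, so coordinate
  multiplication generates it.\<close>

lemma schwartz_one_plus_norm_sq_mult:
  assumes "f \<in> schwartz"
  shows "(\<lambda>x. complex_of_real ((1 + (norm x)\<^sup>2) ^ m) * f x) \<in> schwartz"
proof (induction m)
  case (Suc m)
  let ?g = "\<lambda>x. complex_of_real ((1 + (norm x)\<^sup>2) ^ m) * f x"
  have "(\<lambda>x. ?g x + (\<Sum>b\<in>Basis. complex_of_real (x \<bullet> b) * (complex_of_real (x \<bullet> b) * ?g x))) \<in> schwartz"
    by (intro schwartz_add schwartz_sum schwartz_coord_mult Suc.IH) auto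
  also have "(\<lambda>x. ?g x + (\<Sum>b\<in>Basis. complex_of_real (x \<bullet> b) * (complex_of_real (x \<bullet> b) * ?g x))) =
      (\<lambda>x. complex_of_real ((1 + (norm x)\<^sup>2) ^ Suc m) * f x)"
  proof
    fix x :: 'a
    have "complex_of_real ((norm x)\<^sup>2) = (\<Sum>b\<in>Basis. complex_of_real (x \<bullet> b) * complex_of_real (x \<bullet> b))"
      by (subst power2_norm_eq_inner, subst euclidean_inner) simp
    then have "(\<Sum>b\<in>Basis. complex_of_real (x \<bullet> b) * (complex_of_real (x \<bullet> b) * ?g x)) =
        complex_of_real ((norm x)\<^sup>2) * ?g x"
      by (simp only: sum_distrib_right mult.assoc)
    then show "?g x + (\<Sum>b\<in>Basis. complex_of_real (x \<bullet> b) * (complex_of_real (x \<bullet> b) * ?g x)) =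
      complex_of_real ((1 + (norm x)\<^sup>2) ^ Suc m) * f x"
      by (simp add: algebra_simps)
  qed
  finally show ?case .
qed (use assms in simp)

section \<open>Gaussians and modulated Gaussians as test functions\<close>

definition gauss :: "'a::euclidean_space \<Rightarrow> real" where
  "gauss x = exp (- (norm x)\<^sup>2 / 2)"

text \<open>As a test function, \<open>mod_gauss \<xi>\<close> evaluates at \<xi> the Fourier
  transform of a function damped by a Gaussian. Writing it as one exponential makes its derivative a
  single chain rule.\<close>

definition mod_gauss :: "'a::euclidean_space \<Rightarrow> 'a \<Rightarrow> complex" where
  "mod_gauss \<xi> x = exp (complex_of_real (- (x \<bullet> x) / 2) + \<i> * complex_of_real (x \<bullet> \<xi>))"

lemma mod_gauss_eq: "mod_gauss \<xi> x = complex_of_real (gauss x) * exp (\<i> * complex_of_real (x \<bullet> \<xi>))"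
  unfolding mod_gauss_def gauss_def exp_add exp_of_real power2_norm_eq_inner ..

text \<open>One term of the exponential series gives (1+t)^N <= N! e^(1+t), and 1 + t - t^2/2 <= 3/2
  by completing the square.\<close>

lemma rapidly_decreasing_gauss: "rapidly_decreasing (\<lambda>x::'a::euclidean_space. complex_of_real (gauss x))"
  unfolding rapidly_decreasing_def
proof
  fix N
  have "(1 + norm x) ^ N * norm (complex_of_real (gauss x)) \<le> fact N * exp (3/2)" for x :: 'a
  proof -
    define t where "t = norm x"
    have t: "t \<ge> 0" by (simp add: t_def)
    have "(1 + t) ^ N / fact N \<le> exp (1 + t)"
      using sum_le_suminf[OF summable_exp_generic[of "1 + t"], of "{N}"] t
      by (simp add: exp_def divide_inverse_commute mult.commute)
    then have *: "(1 + t) ^ N * gauss x \<le> fact N * exp (1 + t) * gauss x"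
      by (intro mult_right_mono) (auto simp: gauss_def field_simps)
    have "exp (1 + t) * gauss x \<le> exp (3 / 2)"
      using zero_le_power2[of "t - 1"]
      by (simp add: gauss_def power2_diff flip: exp_add t_def)
    then have "fact N * (exp (1 + t) * gauss x) \<le> fact N * exp (3 / 2)"
      by (rule mult_left_mono) simp
    with * have "(1 + t) ^ N * gauss x \<le> fact N * exp (3 / 2)"
      unfolding mult.assoc by (rule order_trans)
    then show ?thesis by (simp add: t_def gauss_def)
  qed
  then show "\<exists>C. \<forall>x::'a. (1 + norm x) ^ N * norm (complex_of_real (gauss x)) \<le> C" by blast
qed

lemma rapidly_decreasing_norm_eq:
  "rapidly_decreasing f \<Longrightarrow> (\<And>x. norm (g x) = norm (f x)) \<Longrightarrow> rapidly_decreasing g"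
  by (simp add: rapidly_decreasing_def)

text \<open>Polynomial multiples of a modulated Gaussian, generated by closure rules so that membership
  of the derivative follows by rule induction.\<close>

inductive_set gauss_poly :: "'a::euclidean_space \<Rightarrow> ('a \<Rightarrow> complex) set" for \<xi> where
  "mod_gauss \<xi> \<in> gauss_poly \<xi>"
| "f \<in> gauss_poly \<xi> \<Longrightarrow> c \<in> Basis \<Longrightarrow> (\<lambda>x. complex_of_real (x \<bullet> c) * f x) \<in> gauss_poly \<xi>"
| "f \<in> gauss_poly \<xi> \<Longrightarrow> g \<in> gauss_poly \<xi> \<Longrightarrow> (\<lambda>x. a * f x + g x) \<in> gauss_poly \<xi>"

lemma gauss_poly_props:
  assumes "f \<in> gauss_poly \<xi>"
  shows "rapidly_decreasing f \<and> (\<forall>x. f differentiable at x) \<and>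
    (\<forall>b\<in>Basis. (\<lambda>x. frechet_derivative f (at x) b) \<in> gauss_poly \<xi>)"
  using assms
proof (induction rule: gauss_poly.induct)
  case 1
  have hd: "(mod_gauss \<xi> has_derivative
     (\<lambda>v. (- complex_of_real (x \<bullet> v) + \<i> * complex_of_real (v \<bullet> \<xi>)) * mod_gauss \<xi> x)) (at x)" for x
  proof -
    have "((\<lambda>x. complex_of_real (- (x \<bullet> x) / 2) + \<i> * complex_of_real (x \<bullet> \<xi>)) has_derivative
        (\<lambda>v. complex_of_real (- (x \<bullet> v + v \<bullet> x) / 2) + \<i> * complex_of_real (v \<bullet> \<xi>))) (at x)"
      by (auto intro!: derivative_eq_intros simp: fun_eq_iff field_simps)
    from has_derivative_exp_complex[OF this] show ?thesis
      unfolding mod_gauss_def by (simp add: inner_commute)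
  qed
  have "rapidly_decreasing (mod_gauss \<xi>)"
    by (rule rapidly_decreasing_norm_eq[OF rapidly_decreasing_gauss]) (simp add: mod_gauss_eq norm_mult)
  moreover have "(\<lambda>x. frechet_derivative (mod_gauss \<xi>) (at x) b) \<in> gauss_poly \<xi>"
    if b: "b \<in> Basis" for b
  proof -
    \<comment> \<open>The derivative is (-x_b + i \<xi>_b) m with m the modulated Gaussian. The
      closure rule only builds a f + g, so the second term is split as (i \<xi>_b - 1) m +
      m.\<close>
    have "(\<lambda>x. (-1) * (complex_of_real (x \<bullet> b) * mod_gauss \<xi> x) +
        ((\<i> * complex_of_real (b \<bullet> \<xi>) - 1) * mod_gauss \<xi> x + mod_gauss \<xi> x)) \<in> gauss_poly \<xi>"
      by (intro gauss_poly.intros b)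
    then show ?thesis
      by (simp add: frechet_derivative_at[OF hd, symmetric] algebra_simps)
  qed
  ultimately show ?case using hd unfolding differentiable_def by blast
next
  case (2 f c)
  then have f: "(f has_derivative frechet_derivative f (at x)) (at x)" for x
    using frechet_derivative_works by blast
  have hd: "((\<lambda>x. complex_of_real (x \<bullet> c) * f x) has_derivative
      (\<lambda>v. complex_of_real (x \<bullet> c) * frechet_derivative f (at x) v + complex_of_real (v \<bullet> c) * f x)) (at x)" for x
    by (intro has_derivative_mult f has_derivative_of_real has_derivative_inner_left has_derivative_ident)
  have "(\<lambda>x. frechet_derivative (\<lambda>x. complex_of_real (x \<bullet> c) * f x) (at x) b) \<in> gauss_poly \<xi>"
    if b: "b \<in> Basis" for b
  proof -
    have "(\<lambda>x. complex_of_real (b \<bullet> c) * f x + complex_of_real (x \<bullet> c) * frechet_derivative f (at x) b)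
        \<in> gauss_poly \<xi>"
      using 2 b by (intro gauss_poly.intros) auto
    then show ?thesis
      by (simp add: frechet_derivative_at[OF hd, symmetric] add.commute)
  qed
  with 2 hd show ?case
    unfolding differentiable_def by (auto intro!: rapidly_decreasing_coord_mult)
next
  case (3 f g a)
  then have fg: "(f has_derivative frechet_derivative f (at x)) (at x)"
    "(g has_derivative frechet_derivative g (at x)) (at x)" for x
    using frechet_derivative_works by blast+
  have hd: "((\<lambda>x. a * f x + g x) has_derivative
      (\<lambda>v. a * frechet_derivative f (at x) v + frechet_derivative g (at x) v)) (at x)" for x
    by (intro has_derivative_add has_derivative_mult_right fg)
  have "(\<lambda>x. frechet_derivative (\<lambda>x. a * f x + g x) (at x) b) \<in> gauss_poly \<xi>"
    if b: "b \<in> Basis" for b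
    unfolding frechet_derivative_at[OF hd, symmetric]
    using 3 b by (intro gauss_poly.intros) auto
  with 3 hd show ?case
    unfolding differentiable_def
    by (auto intro!: rapidly_decreasing_add rapidly_decreasing_cmult)
qed

lemma mod_gauss_schwartz: "mod_gauss \<xi> \<in> schwartz"
  by (rule schwartz_coinduct[OF gauss_poly.intros(1)]) (use gauss_poly_props in blast)+

section \<open>The Fourier transform on Schwartz functions\<close>

lemma
  fixes f :: "'a::euclidean_space \<Rightarrow> real \<Rightarrow> 'b::{real_normed_field,banach,second_countable_topology}"
  assumes int: "\<And>b. b \<in> Basis \<Longrightarrow> integrable lborel (f b)"
  shows integrable_lborel_prod_Basis: "integrable lborel (\<lambda>x. \<Prod>b\<in>Basis. f b (x \<bullet> b))"
    and integral_lborel_prod_Basis: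
      "(\<integral>x. (\<Prod>b\<in>Basis. f b (x \<bullet> b)) \<partial>lborel) = (\<Prod>b\<in>Basis. integral\<^sup>L lborel (f b))"
proof -
  interpret product_sigma_finite "\<lambda>_::'a. lborel :: real measure" ..
  \<comment> \<open>Lebesgue measure is the image of the product of one-dimensional Lebesgue
    measures under the coordinate map \<open>?g\<close>, so both claims reduce to the product
    measure.\<close>
  let ?P = "\<Pi>\<^sub>M b\<in>(Basis :: 'a set). (lborel :: real measure)"
  let ?g = "\<lambda>y. \<Sum>b\<in>(Basis :: 'a set). y b *\<^sub>R b"
  have g [measurable]: "?g \<in> measurable ?P borel" by measurable
  have f [measurable]: "(\<lambda>x. \<Prod>b\<in>Basis. f b (x \<bullet> b)) \<in> borel_measurable borel"
  proof (rule borel_measurable_prod)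
    fix b :: 'a assume "b \<in> Basis"
    then have [measurable]: "f b \<in> borel_measurable borel" using int by auto
    show "(\<lambda>x. f b (x \<bullet> b)) \<in> borel_measurable borel" by measurable
  qed
  have eq: "(\<Prod>b\<in>Basis. f b (?g y \<bullet> b)) = (\<Prod>b\<in>Basis. f b (y b))" for y
    by (intro prod.cong) (auto simp: inner_sum_left inner_Basis if_distrib cong: if_cong)
  have "integrable (distr ?P borel ?g) (\<lambda>x. \<Prod>b\<in>Basis. f b (x \<bullet> b)) \<longleftrightarrow>
      integrable ?P (\<lambda>y. \<Prod>b\<in>Basis. f b (y b))"
    by (subst integrable_distr_eq[OF g f]) (simp only: eq)
  then show "integrable lborel (\<lambda>x. \<Prod>b\<in>Basis. f b (x \<bullet> b))"
    using product_integrable_prod[OF finite_Basis int] by (simp add: lborel_eq[where 'a='a])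
  have "(\<integral>x. (\<Prod>b\<in>Basis. f b (x \<bullet> b)) \<partial>(distr ?P borel ?g)) =
      (\<integral>y. (\<Prod>b\<in>Basis. f b (y b)) \<partial>?P)"
    by (subst integral_distr[OF g f]) (simp only: eq)
  then show "(\<integral>x. (\<Prod>b\<in>Basis. f b (x \<bullet> b)) \<partial>lborel) = (\<Prod>b\<in>Basis. integral\<^sup>L lborel (f b))"
    using product_integral_prod[OF finite_Basis int] by (simp add: lborel_eq[where 'a='a])
qed

lemma nn_integral_lborel_affine:
  fixes t :: "'a::euclidean_space"
  assumes [measurable]: "f \<in> borel_measurable borel" and "c \<noteq> 0"
  shows "(\<integral>\<^sup>+x. f x \<partial>lborel) = ennreal (\<bar>c\<bar> ^ DIM('a)) * (\<integral>\<^sup>+x. f (t + c *\<^sub>R x) \<partial>lborel)"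
  by (subst lborel_affine[OF assms(2), of t])
     (simp add: nn_integral_density nn_integral_distr nn_integral_cmult)

lemma integrable_lborel_affine:
  fixes t :: "'a::euclidean_space" and f :: "'a \<Rightarrow> 'b::{banach, second_countable_topology}"
  assumes "integrable lborel f" and c: "c \<noteq> 0"
  shows "integrable lborel (\<lambda>x. f (t + c *\<^sub>R x))"
proof -
  have [measurable]: "f \<in> borel_measurable borel" using assms by auto
  have "(\<integral>\<^sup>+x. norm (f x) \<partial>lborel) = ennreal (\<bar>c\<bar> ^ DIM('a)) * (\<integral>\<^sup>+x. norm (f (t + c *\<^sub>R x)) \<partial>lborel)"
    by (rule nn_integral_lborel_affine) (use c in auto)
  moreover have "(\<integral>\<^sup>+x. norm (f x) \<partial>lborel) < \<infinity>"
    using assms by (simp add: integrable_iff_bounded)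
  moreover have "0 < \<bar>c\<bar> ^ DIM('a)" using c by simp
  ultimately show ?thesis
    by (auto simp: integrable_iff_bounded ennreal_mult_less_top ennreal_eq_0_iff simp del: zero_less_power_eq zero_less_power_abs_iff)
qed

lemma integral_lborel_affine:
  fixes t :: "'a::euclidean_space" and f :: "'a \<Rightarrow> 'b::{banach, second_countable_topology}"
  assumes [measurable]: "f \<in> borel_measurable borel" and "c \<noteq> 0"
  shows "(\<integral>x. f x \<partial>lborel) = \<bar>c\<bar> ^ DIM('a) *\<^sub>R (\<integral>x. f (t + c *\<^sub>R x) \<partial>lborel)"
  by (subst lborel_affine[OF assms(2), of t])
     (simp add: integral_density integral_distr)

lemma integral_lborel_translate:
  fixes a :: "'a::euclidean_space" and f :: "'a \<Rightarrow> 'b::{banach, second_countable_topology}"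
  assumes "f \<in> borel_measurable borel"
  shows "(\<integral>x. f (a + x) \<partial>lborel) = (\<integral>x. f x \<partial>lborel)"
  using integral_lborel_affine[OF assms, of 1 a] by simp

text \<open>Every factor 1 + x_b^2 is at most (1 + |x|)^2, so the weight lies below a product of
  integrable functions of one variable. This is the origin of the exponent 2d in the decay
  hypotheses that follow.\<close>

lemma integrable_inverse_one_plus_norm_power:
  "integrable lborel (\<lambda>x::'a::euclidean_space. inverse ((1 + norm x) ^ (2 * DIM('a))))"
proof (rule Bochner_Integration.integrable_bound)
  have "integrable lborel (\<lambda>x::real. inverse (1 + x\<^sup>2))"
    using integrable_inverse_1_plus_square by (simp add: set_integrable_def)
  then show "integrable lborel (\<lambda>x::'a. \<Prod>b\<in>Basis. inverse (1 + (x \<bullet> b)\<^sup>2))"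
    by (rule integrable_lborel_prod_Basis)
  have le: "inverse ((1 + norm x) ^ (2 * DIM('a))) \<le> (\<Prod>b\<in>Basis. inverse (1 + (x \<bullet> b)\<^sup>2))" for x :: 'a
  proof -
    have "1 + (x \<bullet> b)\<^sup>2 \<le> (1 + norm x)\<^sup>2" if "b \<in> Basis" for b
    proof -
      have "(x \<bullet> b)\<^sup>2 \<le> (norm x)\<^sup>2"
        using Basis_le_norm[OF that, of x] by (simp add: abs_le_square_iff[symmetric])
      then show ?thesis using norm_ge_zero[of x] by (simp add: power2_sum del: norm_ge_zero)
    qed
    then have "(\<Prod>b\<in>(Basis :: 'a set). 1 + (x \<bullet> b)\<^sup>2) \<le> (\<Prod>b\<in>(Basis :: 'a set). (1 + norm x)\<^sup>2)"
      by (intro prod_mono) auto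
    moreover have "0 < (\<Prod>b\<in>(Basis :: 'a set). 1 + (x \<bullet> b)\<^sup>2)"
      by (intro prod_pos) (auto intro: add_pos_nonneg)
    ultimately have "inverse (\<Prod>b\<in>(Basis :: 'a set). (1 + norm x)\<^sup>2) \<le> inverse (\<Prod>b\<in>(Basis :: 'a set). 1 + (x \<bullet> b)\<^sup>2)"
      by (rule le_imp_inverse_le)
    then show ?thesis
      unfolding prod_inversef[symmetric] by (simp add: o_def power_mult power_inverse)
  qed
  have "norm a \<le> norm b" if "a \<le> b" "0 \<le> a" for a b :: real
    using that by simp
  from this[OF le] show "AE x::'a in lborel. norm (inverse ((1 + norm x) ^ (2 * DIM('a)))) \<le>
      norm (\<Prod>b\<in>Basis. inverse (1 + (x \<bullet> b)\<^sup>2))"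
    by (intro AE_I2) (simp only: inverse_nonnegative_iff_nonnegative zero_le_power add_nonneg_nonneg zero_le_one norm_ge_zero)
qed (measurable)

lemma integrable_decay:
  fixes f :: "'a::euclidean_space \<Rightarrow> complex"
  assumes [measurable]: "f \<in> borel_measurable borel"
    and C: "\<And>x. (1 + norm x) ^ (2 * DIM('a)) * norm (f x) \<le> C"
  shows "integrable lborel f"
proof (rule Bochner_Integration.integrable_bound)
  show "integrable lborel (\<lambda>x::'a. C * inverse ((1 + norm x) ^ (2 * DIM('a))))"
    by (intro integrable_mult_right integrable_inverse_one_plus_norm_power)
  have "norm (f x) \<le> C * inverse ((1 + norm x) ^ (2 * DIM('a)))" for x
    using C[of x] by (simp add: field_simps add_pos_nonneg)
  then show "AE x in lborel. norm (f x) \<le> norm (C * inverse ((1 + norm x) ^ (2 * DIM('a))))"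
    by (intro AE_I2) (metis abs_ge_self order_trans real_norm_def)
qed simp

lemma integrable_norm_power_mult:
  assumes [measurable]: "f \<in> borel_measurable borel" and "rapidly_decreasing f"
  shows "integrable lborel (\<lambda>x. (1 + norm x) ^ k * norm (f x))"
proof -
  obtain C where C: "\<And>x. (1 + norm x) ^ (2 * DIM('a) + k) * norm (f x) \<le> C"
    using assms(2) unfolding rapidly_decreasing_def by blast
  have norm_w: "norm (complex_of_real ((1 + norm x) ^ k)) = (1 + norm x) ^ k" for x :: 'a
    by (subst norm_of_real, rule abs_of_nonneg) simp
  have "integrable lborel (\<lambda>x. complex_of_real ((1 + norm x) ^ k) * f x)"
  proof (rule integrable_decay)
    show "(1 + norm x) ^ (2 * DIM('a)) * norm (complex_of_real ((1 + norm x) ^ k) * f x) \<le> C" for x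
      using C[of x] by (simp only: norm_mult norm_w power_add mult.assoc)
  qed measurable
  from integrable_norm[OF this] show ?thesis
    by (simp only: norm_mult norm_w)
qed

lemma schwartz_integrable:
  assumes "f \<in> schwartz"
  shows "integrable lborel f"
proof -
  have "integrable lborel (\<lambda>x. norm (f x))"
    using integrable_norm_power_mult[OF schwartz_measurable[OF assms] schwartz_rapidly_decreasing[OF assms], of 0]
    by simp
  then show ?thesis
    using schwartz_measurable[OF assms] by (subst (asm) integrable_norm_iff) auto
qed

lemma schwartz_bounded:
  assumes "f \<in> schwartz"
  obtains C where "C \<ge> 0" "\<And>x. norm (f x) \<le> C"
  using rapidly_decreasingD[OF schwartz_rapidly_decreasing[OF assms], of 0] by auto

text \<open>Difference quotients integrate to zero by translation invariance and converge to the
  derivative. The decay of the derivative gives an integrable majorant through the mean value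
  inequality, so neither slicing along lines nor boundary terms occur.\<close>

lemma integral_directional_derivative_zero:
  fixes f :: "'a::euclidean_space \<Rightarrow> complex"
  assumes int: "integrable lborel f"
    and der: "\<And>x. (f has_derivative f' x) (at x)"
    and b: "norm b = 1"
    and C: "\<And>x. (1 + norm x) ^ (2 * DIM('a)) * norm (f' x b) \<le> C"
  shows "(\<integral>x. f' x b \<partial>lborel) = 0"
proof -
  define t where "t n = 1 / real (Suc n)" for n
  have t: "0 < t n" "t n \<le> 1" for n by (auto simp: t_def)
  have t0: "t \<longlonglongrightarrow> 0" unfolding t_def using LIMSEQ_inverse_real_of_nat by (simp add: inverse_eq_divide)
  define q where "q n x = (f (t n *\<^sub>R b + x) - f x) /\<^sub>R t n" for n x
  have f [measurable]: "f \<in> borel_measurable borel" using int by auto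
  have q [measurable]: "q n \<in> borel_measurable lborel" for n
    unfolding q_def by measurable
  have line: "((\<lambda>\<tau>. f (\<tau> *\<^sub>R b + x)) has_derivative (\<lambda>h. h *\<^sub>R f' (\<tau> *\<^sub>R b + x) b)) (at \<tau> within S)"
    for \<tau> x S
  proof -
    have "((\<lambda>\<tau>. \<tau> *\<^sub>R b + x) has_derivative (\<lambda>h. h *\<^sub>R b)) (at \<tau> within S)"
      by (auto intro!: derivative_eq_intros)
    from has_derivative_compose[OF this der]
    have "((\<lambda>\<tau>. f (\<tau> *\<^sub>R b + x)) has_derivative (\<lambda>h. f' (\<tau> *\<^sub>R b + x) (h *\<^sub>R b))) (at \<tau> within S)"
      by simp
    then show ?thesis
      using linear_scale[OF has_derivative_linear[OF der]] by simp
  qed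
  have lim: "(\<lambda>n. q n x) \<longlonglongrightarrow> f' x b" for x
  proof -
    have "(\<lambda>h. norm (f ((0 + h) *\<^sub>R b + x) - f (0 *\<^sub>R b + x) - h *\<^sub>R f' (0 *\<^sub>R b + x) b) / norm h) \<midarrow>0\<rightarrow> 0"
      using line[where \<tau> = 0 and S = UNIV and x = x] unfolding has_derivative_at by blast
    moreover have "\<forall>\<^sub>F h in at 0. norm (f ((0 + h) *\<^sub>R b + x) - f (0 *\<^sub>R b + x) - h *\<^sub>R f' (0 *\<^sub>R b + x) b) / norm h
        = norm ((f (h *\<^sub>R b + x) - f x) /\<^sub>R h - f' x b)"
    proof (rule eventually_at_filter[THEN iffD2, OF always_eventually], intro allI impI)
      fix h :: real assume "h \<noteq> 0"
      then have "(f (h *\<^sub>R b + x) - f x) /\<^sub>R h - f' x b = (f (h *\<^sub>R b + x) - f x - h *\<^sub>R f' x b) /\<^sub>R h"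
        by (simp add: scaleR_diff_right)
      then show "norm (f ((0 + h) *\<^sub>R b + x) - f (0 *\<^sub>R b + x) - h *\<^sub>R f' (0 *\<^sub>R b + x) b) / norm h
        = norm ((f (h *\<^sub>R b + x) - f x) /\<^sub>R h - f' x b)"
        by (simp add: divide_inverse_commute)
    qed
    ultimately have "(\<lambda>h. norm ((f (h *\<^sub>R b + x) - f x) /\<^sub>R h - f' x b)) \<midarrow>0\<rightarrow> 0"
      by (rule Lim_transform_eventually)
    then have "((\<lambda>h. (f (h *\<^sub>R b + x) - f x) /\<^sub>R h) \<longlongrightarrow> f' x b) (at 0)"
      by (rule LIM_zero_cancel[OF tendsto_norm_zero_cancel])
    then show ?thesis
      unfolding q_def by (rule filterlim_compose)
        (use t t0 in \<open>auto simp: filterlim_at intro!: eventuallyI less_imp_neq[symmetric]\<close>)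
  qed
  \<comment> \<open>The increments \<open>t n\<close> are at most 1, and moving a point by at most 1
    changes 1 + |x| by a factor of at most 2. This costs 2^(2d) in the majorant.\<close>
  let ?w = "\<lambda>x::'a. C * 2 ^ (2 * DIM('a)) * inverse ((1 + norm x) ^ (2 * DIM('a)))"
  have bound: "norm (q n x) \<le> ?w x" for n x
  proof -
    have "norm (f (t n *\<^sub>R b + x) - f (0 *\<^sub>R b + x)) \<le> ?w x * norm (t n - 0)"
    proof (rule differentiable_bound[where S = "{0..1}", OF _ line])
      fix \<tau> :: real assume \<tau>: "\<tau> \<in> {0..1}"
      have "norm (f' (\<tau> *\<^sub>R b + x) b) \<le> ?w x"
      proof -
        let ?y = "\<tau> *\<^sub>R b + x"
        have "norm x - norm (\<tau> *\<^sub>R b) \<le> norm ?y"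
          using norm_triangle_ineq4[of ?y "\<tau> *\<^sub>R b"] by simp
        then have "norm x - 1 \<le> norm ?y" using \<tau> b by simp
        then have "(1 + norm x) \<le> 2 * (1 + norm ?y)"
        proof -
          have "1 + u \<le> 2 * (1 + v)" if "u - 1 \<le> v" "0 \<le> v" for u v :: real
            using that by simp
          from this[OF \<open>norm x - 1 \<le> norm ?y\<close> norm_ge_zero] show ?thesis .
        qed
        then have "(1 + norm x) ^ (2 * DIM('a)) \<le> (2 * (1 + norm ?y)) ^ (2 * DIM('a))"
          by (intro power_mono) auto
        then have "(1 + norm x) ^ (2 * DIM('a)) * norm (f' ?y b) \<le>
            2 ^ (2 * DIM('a)) * ((1 + norm ?y) ^ (2 * DIM('a)) * norm (f' ?y b))"
          unfolding power_mult_distrib mult.assoc[symmetric] by (rule mult_right_mono) simp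
        also have "\<dots> \<le> 2 ^ (2 * DIM('a)) * C"
          by (intro mult_left_mono C) auto
        finally show ?thesis by (simp add: field_simps add_pos_nonneg)
      qed
      then show "onorm (\<lambda>h. h *\<^sub>R f' (\<tau> *\<^sub>R b + x) b) \<le> ?w x"
        unfolding norm_scaleR real_norm_def
        by (intro onorm_le) (simp only: norm_scaleR real_norm_def mult.commute[of _ "\<bar>_\<bar>"] mult_left_mono abs_ge_zero)
    qed (use t[of n] less_imp_le[OF t(1)[of n]] in auto)
    then have "norm (f (t n *\<^sub>R b + x) - f x) / t n \<le> ?w x"
      using t(1)[of n] by (simp only: pos_divide_le_eq) simp
    then show ?thesis
      unfolding q_def using t(1)[of n] by (simp add: divide_inverse_commute)
  qed
  have w: "integrable lborel ?w"
    by (intro integrable_mult_right integrable_inverse_one_plus_norm_power)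
  have "(\<lambda>n. \<integral>x. q n x \<partial>lborel) \<longlonglongrightarrow> (\<integral>x. f' x b \<partial>lborel)"
  proof (rule integral_dominated_convergence[OF _ q w])
    show "(\<lambda>x. f' x b) \<in> borel_measurable lborel"
      by (rule borel_measurable_LIMSEQ_metric[OF q lim])
  qed (intro AE_I2 lim bound)+
  moreover have "(\<integral>x. q n x \<partial>lborel) = 0" for n
  proof -
    have "integrable lborel (\<lambda>x. f (t n *\<^sub>R b + x))"
      using integrable_lborel_affine[OF int, of 1 "t n *\<^sub>R b"] by simp
    then show ?thesis
      unfolding q_def using int by (simp add: integral_lborel_translate[OF f])
  qed
  ultimately show ?thesis by (simp add: LIMSEQ_const_iff)
qed

text \<open>The sign \<sigma> covers the transform (-1) and the unnormalised inverse (+1) at once.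
  Leaving out the factor (2 pi)^(-d) lets both obey the same lemmas.\<close>

definition FT :: "real \<Rightarrow> ('a::euclidean_space \<Rightarrow> complex) \<Rightarrow> 'a \<Rightarrow> complex" where
  "FT \<sigma> f \<xi> = (\<integral>x. exp (\<i> * complex_of_real (\<sigma> * (x \<bullet> \<xi>))) * f x \<partial>lborel)"

lemma fourier_eq_FT: "fourier f = FT (-1) f"
  by (rule ext) (simp add: fourier_def FT_def)

lemma inv_fourier_eq_FT:
  "inv_fourier f = (\<lambda>x::'a::euclidean_space. complex_of_real (1 / (2 * pi) ^ DIM('a)) * FT 1 f x)"
  by (rule ext) (simp add: inv_fourier_def FT_def inner_commute)

section \<open>The transform of integrable and of Schwartz functions\<close>

lemma integrable_char_mult:
  assumes "integrable lborel f"
  shows "integrable lborel (\<lambda>x. exp (\<i> * complex_of_real (\<sigma> * (x \<bullet> \<xi>))) * f x)"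
proof (rule Bochner_Integration.integrable_bound[OF assms])
  have [measurable]: "f \<in> borel_measurable borel" using assms by auto
  show "(\<lambda>x. exp (\<i> * complex_of_real (\<sigma> * (x \<bullet> \<xi>))) * f x) \<in> borel_measurable lborel"
    by measurable
qed (simp add: norm_mult)

lemma norm_FT_le: "norm (FT \<sigma> f \<xi>) \<le> (\<integral>x. norm (f x) \<partial>lborel)"
  unfolding FT_def by (rule order_trans[OF integral_norm_bound]) (simp add: norm_mult)

lemma FT_add:
  assumes "integrable lborel f" "integrable lborel g"
  shows "FT \<sigma> (\<lambda>x. f x + g x) \<xi> = FT \<sigma> f \<xi> + FT \<sigma> g \<xi>"
  unfolding FT_def
  using integrable_char_mult[OF assms(1)] integrable_char_mult[OF assms(2)]
  by (simp add: distrib_left)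

lemma FT_cmult: "FT \<sigma> (\<lambda>x. c * f x) \<xi> = c * FT \<sigma> f \<xi>"
  unfolding FT_def by (simp add: mult.left_commute)

lemma FT_diff:
  assumes "integrable lborel f" "integrable lborel g"
  shows "FT \<sigma> (\<lambda>x. f x - g x) \<xi> = FT \<sigma> f \<xi> - FT \<sigma> g \<xi>"
  unfolding FT_def
  using integrable_char_mult[OF assms(1)] integrable_char_mult[OF assms(2)]
  by (simp add: right_diff_distrib)

text \<open>The remainder of the first-order expansion of e^(iu) is at most u^2/2, and the second
  moment of \<open>f\<close> is finite. So the remainder of the transform is quadratic in the
  increment, which gives the total derivative at once.\<close>

lemma FT_has_derivative:
  fixes f :: "'a::euclidean_space \<Rightarrow> complex"
  assumes f: "f \<in> schwartz"
  shows "(FT \<sigma> f has_derivative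
    (\<lambda>v. FT \<sigma> (\<lambda>x. \<i> * complex_of_real (\<sigma> * (x \<bullet> v)) * f x) \<xi>)) (at \<xi>)"
proof -
  note [measurable] = schwartz_measurable[OF f]
  note pw = integrable_norm_power_mult[OF schwartz_measurable[OF f] schwartz_rapidly_decreasing[OF f]]
  have int: "integrable lborel f" using f by (rule schwartz_integrable)
  have int1: "integrable lborel (\<lambda>x. norm x * norm (f x))"
    by (rule Bochner_Integration.integrable_bound[OF pw[of 1]]) (auto simp: algebra_simps)
  have int2: "integrable lborel (\<lambda>x. (norm x)\<^sup>2 * norm (f x))"
    by (rule Bochner_Integration.integrable_bound[OF pw[of 2]])
       (auto intro!: AE_I2 mult_right_mono power_mono)
  let ?g = "\<lambda>v x. \<i> * complex_of_real (\<sigma> * (x \<bullet> v)) * f x"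
  have g_le: "norm (?g v x) \<le> \<bar>\<sigma>\<bar> * norm v * (norm x * norm (f x))" for v x
  proof -
    have "norm (?g v x) = \<bar>\<sigma>\<bar> * \<bar>x \<bullet> v\<bar> * norm (f x)" by (simp add: norm_mult abs_mult)
    also have "\<dots> \<le> \<bar>\<sigma>\<bar> * (norm x * norm v) * norm (f x)"
      by (intro mult_right_mono mult_left_mono Cauchy_Schwarz_ineq2) auto
    finally show ?thesis by (simp add: mult_ac)
  qed
  have g: "integrable lborel (?g v)" for v
  proof (rule Bochner_Integration.integrable_bound)
    show "integrable lborel (\<lambda>x. \<bar>\<sigma>\<bar> * norm v * (norm x * norm (f x)))"
      by (intro integrable_mult_right int1)
    show "AE x in lborel. norm (?g v x) \<le> norm (\<bar>\<sigma>\<bar> * norm v * (norm x * norm (f x)))"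
      unfolding real_norm_def by (intro AE_I2 order_trans[OF g_le abs_ge_self])
  qed measurable
  have bl: "bounded_linear (\<lambda>v. FT \<sigma> (?g v) \<xi>)"
  proof (rule bounded_linear_intro)
    fix v w
    show "FT \<sigma> (?g (v + w)) \<xi> = FT \<sigma> (?g v) \<xi> + FT \<sigma> (?g w) \<xi>"
      by (subst FT_add[OF g g, symmetric]) (simp add: inner_add_right algebra_simps)
  next
    fix r v
    show "FT \<sigma> (?g (r *\<^sub>R v)) \<xi> = r *\<^sub>R FT \<sigma> (?g v) \<xi>"
      unfolding scaleR_conv_of_real by (subst FT_cmult[symmetric]) (simp add: mult_ac)
  next
    fix v
    have "norm (FT \<sigma> (?g v) \<xi>) \<le> (\<integral>x. norm (?g v x) \<partial>lborel)" by (rule norm_FT_le)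
    also have "\<dots> \<le> (\<integral>x. \<bar>\<sigma>\<bar> * norm v * (norm x * norm (f x)) \<partial>lborel)"
      by (intro integral_mono g_le integrable_norm g integrable_mult_right int1)
    also have "\<dots> = \<bar>\<sigma>\<bar> * norm v * (\<integral>x. norm x * norm (f x) \<partial>lborel)"
      by (rule integral_mult_right_zero)
    finally show "norm (FT \<sigma> (?g v) \<xi>) \<le> norm v * (\<bar>\<sigma>\<bar> * (\<integral>x. norm x * norm (f x) \<partial>lborel))"
      by (simp only: mult_ac)
  qed
  let ?K = "\<sigma>\<^sup>2 / 2 * (\<integral>x. (norm x)\<^sup>2 * norm (f x) \<partial>lborel)"
  show ?thesis
  proof (rule has_derivativeI_sandwich[of 1])
    show "((\<lambda>\<eta>. ?K * norm (\<eta> - \<xi>)) \<longlongrightarrow> 0) (at \<xi>)"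
      by (intro tendsto_eq_intros) auto
    fix \<eta> assume "\<eta> \<noteq> \<xi>"
    let ?e = "\<lambda>\<xi> x. exp (\<i> * complex_of_real (\<sigma> * (x \<bullet> \<xi>)))"
    let ?h = "\<lambda>x. ?e \<eta> x * f x - ?e \<xi> x * f x - ?e \<xi> x * ?g (\<eta> - \<xi>) x"
    have inth: "integrable lborel ?h"
      by (intro Bochner_Integration.integrable_diff integrable_char_mult int g)
    have h_le: "norm (?h x) \<le> \<sigma>\<^sup>2 / 2 * (norm (\<eta> - \<xi>))\<^sup>2 * ((norm x)\<^sup>2 * norm (f x))" for x
    proof -
      let ?s = "\<sigma> * (x \<bullet> (\<eta> - \<xi>))"
      have ee: "?e \<eta> x = ?e \<xi> x * exp (\<i> * complex_of_real ?s)"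
        by (subst exp_add[symmetric]) (simp add: algebra_simps)
      have "?h x = ?e \<xi> x * (exp (\<i> * complex_of_real ?s) - (1 + \<i> * complex_of_real ?s)) * f x"
        unfolding ee by (simp add: algebra_simps)
      then have "norm (?h x) = norm (exp (\<i> * complex_of_real ?s) - (1 + \<i> * complex_of_real ?s)) * norm (f x)"
        by (simp add: norm_mult)
      also have "\<dots> \<le> (\<bar>?s\<bar>\<^sup>2 / 2) * norm (f x)"
        using iexp_approx1[of ?s 1] by (intro mult_right_mono) (auto simp: power2_eq_square)
      also have "\<dots> \<le> (\<bar>\<sigma>\<bar> * (norm x * norm (\<eta> - \<xi>)))\<^sup>2 / 2 * norm (f x)"
        by (intro mult_right_mono divide_right_mono power_mono)
           (auto simp: abs_mult intro!: mult_left_mono Cauchy_Schwarz_ineq2)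
      finally show ?thesis by (simp add: power_mult_distrib mult_ac)
    qed
    have "FT \<sigma> f \<eta> - FT \<sigma> f \<xi> - FT \<sigma> (?g (\<eta> - \<xi>)) \<xi> = (\<integral>x. ?h x \<partial>lborel)"
      unfolding FT_def using integrable_char_mult[OF int] integrable_char_mult[OF g] by simp
    then have "norm (FT \<sigma> f \<eta> - FT \<sigma> f \<xi> - FT \<sigma> (?g (\<eta> - \<xi>)) \<xi>) \<le> (\<integral>x. norm (?h x) \<partial>lborel)"
      by (simp only: integral_norm_bound)
    also have "\<dots> \<le> (\<integral>x. \<sigma>\<^sup>2 / 2 * (norm (\<eta> - \<xi>))\<^sup>2 * ((norm x)\<^sup>2 * norm (f x)) \<partial>lborel)"
      by (intro integral_mono h_le integrable_norm inth integrable_mult_right int2)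
    also have "\<dots> = ?K * norm (\<eta> - \<xi>) * norm (\<eta> - \<xi>)"
      unfolding integral_mult_right_zero by (simp add: power2_eq_square mult_ac)
    finally show "norm (FT \<sigma> f \<eta> - FT \<sigma> f \<xi> - FT \<sigma> (?g (\<eta> - \<xi>)) \<xi>) / norm (\<eta> - \<xi>) \<le>
        ?K * norm (\<eta> - \<xi>)"
      using \<open>\<eta> \<noteq> \<xi>\<close> by (simp add: divide_le_eq)
  qed (use bl in auto)
qed

text \<open>Integration by parts: the derivative along \<open>b\<close> of the character times
  \<open>f\<close> has integral zero.\<close>

lemma FT_deriv:
  fixes f :: "'a::euclidean_space \<Rightarrow> complex"
  assumes f: "f \<in> schwartz" and b: "b \<in> Basis"
  shows "\<i> * complex_of_real (\<sigma> * (b \<bullet> \<xi>)) * FT \<sigma> f \<xi> = - FT \<sigma> (\<lambda>x. frechet_derivative f (at x) b) \<xi>"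
proof -
  let ?e = "\<lambda>x. exp (\<i> * complex_of_real (\<sigma> * (x \<bullet> \<xi>)))"
  let ?f' = "\<lambda>x. frechet_derivative f (at x) b"
  have f': "?f' \<in> schwartz" by (rule schwartz_deriv[OF f b])
  have e: "(?e has_derivative (\<lambda>v. (\<i> * complex_of_real (\<sigma> * (v \<bullet> \<xi>))) * ?e x)) (at x)" for x
  proof -
    have "((\<lambda>x. \<i> * complex_of_real (\<sigma> * (x \<bullet> \<xi>))) has_derivative
        (\<lambda>v. \<i> * complex_of_real (\<sigma> * (v \<bullet> \<xi>)))) (at x)"
      by (intro has_derivative_mult_right has_derivative_of_real has_derivative_inner_left has_derivative_ident)
    from has_derivative_exp_complex[OF this] show ?thesis .
  qed
  obtain A where A: "\<And>x. (1 + norm x) ^ (2 * DIM('a)) * norm (?f' x) \<le> A"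
    using schwartz_rapidly_decreasing[OF f'] unfolding rapidly_decreasing_def by blast
  obtain B where B: "\<And>x. (1 + norm x) ^ (2 * DIM('a)) * norm (f x) \<le> B"
    using schwartz_rapidly_decreasing[OF f] unfolding rapidly_decreasing_def by blast
  have "(\<integral>x. ?e x * ?f' x + (\<i> * complex_of_real (\<sigma> * (b \<bullet> \<xi>))) * ?e x * f x \<partial>lborel) = 0"
  proof (rule integral_directional_derivative_zero[where f = "\<lambda>x. ?e x * f x" and f' =
      "\<lambda>x v. ?e x * frechet_derivative f (at x) v + (\<i> * complex_of_real (\<sigma> * (v \<bullet> \<xi>))) * ?e x * f x"])
    show "integrable lborel (\<lambda>x. ?e x * f x)"
      by (intro integrable_char_mult schwartz_integrable f)
    show "((\<lambda>x. ?e x * f x) has_derivative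
        (\<lambda>v. ?e x * frechet_derivative f (at x) v + (\<i> * complex_of_real (\<sigma> * (v \<bullet> \<xi>))) * ?e x * f x)) (at x)" for x
      by (intro has_derivative_mult e schwartz_has_derivative f)
    show "(1 + norm x) ^ (2 * DIM('a)) *
        norm (?e x * ?f' x + (\<i> * complex_of_real (\<sigma> * (b \<bullet> \<xi>))) * ?e x * f x) \<le> A + \<bar>\<sigma> * (b \<bullet> \<xi>)\<bar> * B" for x
    proof -
      have "norm (?e x * ?f' x + (\<i> * complex_of_real (\<sigma> * (b \<bullet> \<xi>))) * ?e x * f x) \<le>
          norm (?f' x) + \<bar>\<sigma> * (b \<bullet> \<xi>)\<bar> * norm (f x)"
        by (rule order_trans[OF norm_triangle_ineq]) (simp add: norm_mult abs_mult)
      then have "(1 + norm x) ^ (2 * DIM('a)) *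
          norm (?e x * ?f' x + (\<i> * complex_of_real (\<sigma> * (b \<bullet> \<xi>))) * ?e x * f x) \<le>
          (1 + norm x) ^ (2 * DIM('a)) * (norm (?f' x) + \<bar>\<sigma> * (b \<bullet> \<xi>)\<bar> * norm (f x))"
        by (rule mult_left_mono) simp
      also have "\<dots> \<le> A + \<bar>\<sigma> * (b \<bullet> \<xi>)\<bar> * B"
        using A[of x] mult_left_mono[OF B[of x], of "\<bar>\<sigma> * (b \<bullet> \<xi>)\<bar>"] by (simp add: algebra_simps)
      finally show ?thesis .
    qed
  qed (use b in auto)
  moreover have "(\<integral>x. ?e x * ?f' x + (\<i> * complex_of_real (\<sigma> * (b \<bullet> \<xi>))) * ?e x * f x \<partial>lborel) =
      FT \<sigma> ?f' \<xi> + \<i> * complex_of_real (\<sigma> * (b \<bullet> \<xi>)) * FT \<sigma> f \<xi>"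
    unfolding FT_def mult.assoc
    using integrable_char_mult[OF schwartz_integrable[OF f], of \<sigma> \<xi>]
      integrable_char_mult[OF schwartz_integrable[OF f'], of \<sigma> \<xi>] by simp
  ultimately show ?thesis by (simp add: add_eq_0_iff)
qed

text \<open>As |\<xi>| is at most the sum of the |\<xi>_b|, one more power of |\<xi>| is traded for
  the first derivatives of \<open>f\<close>. These are Schwartz again, so the induction has to run
  over all \<open>f\<close>.\<close>

lemma rapidly_decreasing_FT:
  fixes f :: "'a::euclidean_space \<Rightarrow> complex"
  assumes "f \<in> schwartz" "\<bar>\<sigma>\<bar> = 1"
  shows "rapidly_decreasing (FT \<sigma> f)"
  unfolding rapidly_decreasing_def
proof
  fix N
  show "\<exists>C. \<forall>\<xi>. (1 + norm \<xi>) ^ N * norm (FT \<sigma> f \<xi>) \<le> C"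
    using assms(1)
  proof (induction N arbitrary: f)
    case 0
    then show ?case using norm_FT_le by auto
  next
    case (Suc N)
    let ?f' = "\<lambda>b x. frechet_derivative f (at x) b"
    obtain C where C: "\<And>\<xi>. (1 + norm \<xi>) ^ N * norm (FT \<sigma> f \<xi>) \<le> C"
      using Suc by blast
    have "\<forall>b\<in>Basis. \<exists>C. \<forall>\<xi>. (1 + norm \<xi>) ^ N * norm (FT \<sigma> (?f' b) \<xi>) \<le> C"
      using Suc schwartz_deriv by blast
    then obtain E where E: "\<And>b \<xi>. b \<in> Basis \<Longrightarrow> (1 + norm \<xi>) ^ N * norm (FT \<sigma> (?f' b) \<xi>) \<le> E b"
      by metis
    have "(1 + norm \<xi>) ^ Suc N * norm (FT \<sigma> f \<xi>) \<le> C + (\<Sum>b\<in>Basis. E b)" for \<xi>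
    proof -
      have eq: "\<bar>\<xi> \<bullet> b\<bar> * norm (FT \<sigma> f \<xi>) = norm (FT \<sigma> (?f' b) \<xi>)" if "b \<in> Basis" for b
        using arg_cong[OF FT_deriv[OF Suc.prems that, of \<sigma> \<xi>], of norm] assms(2)
        by (simp add: norm_mult abs_mult inner_commute)
      have "(1 + norm \<xi>) * norm (FT \<sigma> f \<xi>) \<le> (1 + (\<Sum>b\<in>Basis. \<bar>\<xi> \<bullet> b\<bar>)) * norm (FT \<sigma> f \<xi>)"
        by (intro mult_right_mono add_left_mono norm_le_l1) auto
      also have "\<dots> = norm (FT \<sigma> f \<xi>) + (\<Sum>b\<in>Basis. norm (FT \<sigma> (?f' b) \<xi>))"
        by (simp add: distrib_right sum_distrib_right eq)
      finally have "(1 + norm \<xi>) ^ N * ((1 + norm \<xi>) * norm (FT \<sigma> f \<xi>)) \<le>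
          (1 + norm \<xi>) ^ N * (norm (FT \<sigma> f \<xi>) + (\<Sum>b\<in>Basis. norm (FT \<sigma> (?f' b) \<xi>)))"
        by (rule mult_left_mono) simp
      also have "\<dots> \<le> C + (\<Sum>b\<in>Basis. E b)"
        unfolding distrib_left sum_distrib_left by (intro add_mono sum_mono C E)
      finally show ?thesis by (simp add: mult_ac)
    qed
    then show ?case by blast
  qed
qed

text \<open>Differentiating the transform multiplies \<open>f\<close> by a coordinate, so the image
  of the Schwartz space is itself a class closed under derivatives.\<close>

lemma FT_schwartz:
  fixes f :: "'a::euclidean_space \<Rightarrow> complex"
  assumes "f \<in> schwartz" "\<bar>\<sigma>\<bar> = 1"
  shows "FT \<sigma> f \<in> schwartz"
proof (rule schwartz_coinduct[of _ "FT \<sigma> ` schwartz"])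
  fix g :: "'a \<Rightarrow> complex" assume "g \<in> FT \<sigma> ` schwartz"
  then obtain f where f: "f \<in> schwartz" and g: "g = FT \<sigma> f" by blast
  show "g differentiable at x" for x
    unfolding g differentiable_def using FT_has_derivative[OF f] by blast
  show "rapidly_decreasing g"
    unfolding g by (rule rapidly_decreasing_FT[OF f assms(2)])
  show "(\<lambda>x. frechet_derivative g (at x) b) \<in> FT \<sigma> ` schwartz" if "b \<in> Basis" for b
  proof
    show "(\<lambda>x. frechet_derivative g (at x) b) = FT \<sigma> (\<lambda>x. \<i> * complex_of_real \<sigma> * (complex_of_real (x \<bullet> b) * f x))"
      unfolding g by (subst frechet_derivative_at[OF FT_has_derivative[OF f], symmetric]) (simp add: mult.assoc)
    show "(\<lambda>x. \<i> * complex_of_real \<sigma> * (complex_of_real (x \<bullet> b) * f x)) \<in> schwartz"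
      by (intro schwartz_cmult schwartz_coord_mult f that)
  qed
qed (use assms in blast)

section \<open>Inversion and uniqueness\<close>

lemma integrable_lborel_pair_mult:
  fixes f :: "'a::euclidean_space \<Rightarrow> complex" and g :: "'b::euclidean_space \<Rightarrow> complex"
  assumes f: "integrable lborel f" and g: "integrable lborel g"
  shows "integrable (lborel \<Otimes>\<^sub>M lborel) (\<lambda>(x, y). f x * g y)"
proof (rule lborel_pair.Fubini_integrable)
  have [measurable]: "f \<in> borel_measurable borel" "g \<in> borel_measurable borel"
    using f g by auto
  show "(\<lambda>(x, y). f x * g y) \<in> borel_measurable (lborel \<Otimes>\<^sub>M lborel)" by measurable
  show "integrable lborel (\<lambda>x. \<integral>y. norm (case (x, y) of (x, y) \<Rightarrow> f x * g y) \<partial>lborel)"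
    using f by (simp add: norm_mult)
  show "AE x in lborel. integrable lborel (\<lambda>y. case (x, y) of (x, y) \<Rightarrow> f x * g y)"
    using g by simp
qed

text \<open>The interchanges of Bochner integrals below all have this form: two integrable factors
  in separate variables, coupled by a character of modulus 1.\<close>

lemma Fubini_lborel_bounded:
  fixes f :: "'a::euclidean_space \<Rightarrow> complex" and g :: "'b::euclidean_space \<Rightarrow> complex"
  assumes f: "integrable lborel f" and g: "integrable lborel g"
    and e [measurable]: "(\<lambda>(x, y). e x y) \<in> borel_measurable (lborel \<Otimes>\<^sub>M lborel)"
    and le: "\<And>x y. norm (e x y) \<le> (1::real)"
  shows "(\<integral>x. (\<integral>y. f x * g y * e x y \<partial>lborel) \<partial>lborel) = (\<integral>y. (\<integral>x. f x * g y * e x y \<partial>lborel) \<partial>lborel)"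
proof -
  have [measurable]: "f \<in> borel_measurable borel" "g \<in> borel_measurable borel"
    using f g by auto
  have "integrable (lborel \<Otimes>\<^sub>M lborel) (\<lambda>(x, y). f x * g y * e x y)"
  proof (rule Bochner_Integration.integrable_bound[OF integrable_lborel_pair_mult[OF f g]])
    show "AE z in lborel \<Otimes>\<^sub>M lborel. norm (case z of (x, y) \<Rightarrow> f x * g y * e x y) \<le>
        norm (case z of (x, y) \<Rightarrow> f x * g y)"
      using le by (intro AE_I2) (auto simp: norm_mult split: prod.splits intro!: mult_left_le)
  qed measurable
  from lborel_pair.Fubini_integral[OF this] show ?thesis by simp
qed

section \<open>The Gaussian and its Fourier transform\<close>

lemma gauss_nonneg [simp]: "0 \<le> gauss x" and gauss_pos [simp]: "0 < gauss x"
  and gauss_le_1: "gauss x \<le> 1" and gauss_minus [simp]: "gauss (- x) = gauss x"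
  and gauss_0 [simp]: "gauss 0 = 1"
  by (auto simp: gauss_def)

lemma continuous_on_gauss: "continuous_on A gauss"
  unfolding gauss_def by (intro continuous_intros) auto

lemma measurable_gauss [measurable]: "gauss \<in> borel_measurable borel"
  by (intro borel_measurable_continuous_onI continuous_on_gauss)

lemma mod_gauss_0: "mod_gauss 0 = (\<lambda>x. complex_of_real (gauss x))"
  by (rule ext) (simp add: mod_gauss_eq)

lemma integrable_gauss_complex: "integrable lborel (\<lambda>x. complex_of_real (gauss x))"
  using schwartz_integrable[OF mod_gauss_schwartz[of 0]] by (simp add: mod_gauss_0)

lemma integrable_gauss: "integrable lborel gauss"
  using integrable_gauss_complex by (simp only: complex_of_real_integrable_eq)

lemma integral_iexp_exp_neg_half_square:
  "integrable lborel (\<lambda>x::real. exp (\<i> * complex_of_real (x * t)) * complex_of_real (exp (- x\<^sup>2 / 2)))"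
  "(\<integral>x. exp (\<i> * complex_of_real (x * t)) * complex_of_real (exp (- x\<^sup>2 / 2)) \<partial>lborel) =
     complex_of_real (sqrt (2 * pi) * exp (- t\<^sup>2 / 2))"
proof -
  have "integrable lborel (\<lambda>x::real. complex_of_real (exp (- x\<^sup>2 / 2)))"
    using integrable_gauss_complex[where 'a=real] by (simp add: gauss_def)
  from integrable_char_mult[OF this, of 1 t]
  show "integrable lborel (\<lambda>x::real. exp (\<i> * complex_of_real (x * t)) * complex_of_real (exp (- x\<^sup>2 / 2)))"
    by simp
  \<comment> \<open>The integral is sqrt(2 pi) times the characteristic function of the standard
    normal law.\<close>
  have "char std_normal_distribution t =
      (\<integral>x. std_normal_density x *\<^sub>R exp (\<i> * complex_of_real (t * x)) \<partial>lborel)"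
    unfolding char_def by (subst integral_density) auto
  also have "\<dots> = (\<integral>x. complex_of_real (1 / sqrt (2 * pi)) *
      (exp (\<i> * complex_of_real (x * t)) * complex_of_real (exp (- x\<^sup>2 / 2))) \<partial>lborel)"
    by (intro Bochner_Integration.integral_cong refl)
       (simp add: std_normal_density_def scaleR_conv_of_real mult_ac)
  also have "\<dots> = complex_of_real (1 / sqrt (2 * pi)) *
      (\<integral>x. exp (\<i> * complex_of_real (x * t)) * complex_of_real (exp (- x\<^sup>2 / 2)) \<partial>lborel)"
    by (rule integral_mult_right_zero)
  finally show "(\<integral>x. exp (\<i> * complex_of_real (x * t)) * complex_of_real (exp (- x\<^sup>2 / 2)) \<partial>lborel) =
     complex_of_real (sqrt (2 * pi) * exp (- t\<^sup>2 / 2))"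
    by (simp add: char_std_normal_distribution field_simps)
qed

lemma FT_gauss:
  fixes \<xi> :: "'a::euclidean_space"
  assumes "\<bar>\<sigma>\<bar> = 1"
  shows "FT \<sigma> (\<lambda>x. complex_of_real (gauss x)) \<xi> = complex_of_real (sqrt (2 * pi) ^ DIM('a) * gauss \<xi>)"
proof -
  have s2: "\<sigma>\<^sup>2 = 1" using assms by (simp add: abs_square_eq_1)
  let ?f = "\<lambda>b x. exp (\<i> * complex_of_real (x * (\<sigma> * (\<xi> \<bullet> b)))) * complex_of_real (exp (- x\<^sup>2 / 2))"
  have g: "gauss x = (\<Prod>b\<in>Basis. exp (- (x \<bullet> b)\<^sup>2 / 2))" for x :: 'a
  proof -
    have "(norm x)\<^sup>2 = (\<Sum>b\<in>Basis. (x \<bullet> b)\<^sup>2)"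
      by (subst power2_norm_eq_inner, subst euclidean_inner) (simp add: power2_eq_square)
    then show ?thesis
      unfolding gauss_def by (subst exp_sum[symmetric]) (auto simp: sum_negf sum_divide_distrib)
  qed
  have "exp (\<i> * complex_of_real (\<sigma> * (x \<bullet> \<xi>))) * complex_of_real (gauss x) = (\<Prod>b\<in>Basis. ?f b (x \<bullet> b))" for x
  proof -
    have "exp (\<i> * complex_of_real (\<sigma> * (x \<bullet> \<xi>))) = (\<Prod>b\<in>Basis. exp (\<i> * complex_of_real ((x \<bullet> b) * (\<sigma> * (\<xi> \<bullet> b)))))"
      by (subst exp_sum[symmetric], simp, subst euclidean_inner) (simp add: sum_distrib_left mult_ac)
    then show ?thesis by (simp add: g prod.distrib)
  qed
  then have "FT \<sigma> (\<lambda>x. complex_of_real (gauss x)) \<xi> = (\<integral>x. (\<Prod>b\<in>Basis. ?f b (x \<bullet> b)) \<partial>lborel)"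
    by (simp add: FT_def)
  also have "\<dots> = (\<Prod>b\<in>Basis. integral\<^sup>L lborel (?f b))"
    by (rule integral_lborel_prod_Basis) (rule integral_iexp_exp_neg_half_square)
  also have "\<dots> = (\<Prod>b\<in>(Basis :: 'a set). complex_of_real (sqrt (2 * pi) * exp (- (\<xi> \<bullet> b)\<^sup>2 / 2)))"
    by (intro prod.cong refl, subst integral_iexp_exp_neg_half_square(2)) (simp add: power_mult_distrib s2)
  also have "\<dots> = complex_of_real (sqrt (2 * pi) ^ DIM('a) * gauss \<xi>)"
    by (simp add: g prod.distrib flip: of_real_prod)
  finally show ?thesis .
qed

lemma integral_gauss: "(\<integral>x. gauss (x::'a::euclidean_space) \<partial>lborel) = sqrt (2 * pi) ^ DIM('a)"
proof -
  have "complex_of_real (\<integral>x. gauss (x::'a) \<partial>lborel) = complex_of_real (sqrt (2 * pi) ^ DIM('a))"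
    using FT_gauss[of 1 "0::'a"] by (simp add: FT_def)
  then show ?thesis by (simp only: of_real_eq_iff)
qed

lemma integrable_gauss_scale:
  assumes "t \<noteq> 0"
  shows "integrable lborel (\<lambda>x. complex_of_real (gauss (t *\<^sub>R x)))"
  using integrable_lborel_affine[OF integrable_gauss_complex assms, of 0] by simp

lemma FT_gauss_scale:
  fixes \<xi> :: "'a::euclidean_space"
  assumes "\<bar>\<sigma>\<bar> = 1" "t > 0"
  shows "FT \<sigma> (\<lambda>x. complex_of_real (gauss (t *\<^sub>R x))) \<xi> =
    complex_of_real (sqrt (2 * pi) ^ DIM('a) / t ^ DIM('a) * gauss (\<xi> /\<^sub>R t))"
proof -
  have "FT \<sigma> (\<lambda>x. complex_of_real (gauss (t *\<^sub>R x))) \<xi> =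
     \<bar>inverse t\<bar> ^ DIM('a) *\<^sub>R (\<integral>x. exp (\<i> * complex_of_real (\<sigma> * ((0 + inverse t *\<^sub>R x) \<bullet> \<xi>))) *
       complex_of_real (gauss (t *\<^sub>R (0 + inverse t *\<^sub>R x))) \<partial>lborel)"
    unfolding FT_def by (rule integral_lborel_affine) (use assms in auto)
  also have "\<dots> = \<bar>inverse t\<bar> ^ DIM('a) *\<^sub>R FT \<sigma> (\<lambda>x. complex_of_real (gauss x)) (\<xi> /\<^sub>R t)"
    using assms by (simp add: FT_def)
  also have "\<dots> = complex_of_real (sqrt (2 * pi) ^ DIM('a) / t ^ DIM('a) * gauss (\<xi> /\<^sub>R t))"
    using assms by (simp add: FT_gauss scaleR_conv_of_real field_simps)
  finally show ?thesis .
qed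

section \<open>Gaussian regularisation, inversion, uniqueness\<close>

lemma measurable_FT [measurable]:
  assumes [measurable]: "f \<in> borel_measurable borel"
  shows "FT \<sigma> f \<in> borel_measurable borel"
  unfolding FT_def by measurable

text \<open>Regularised inversion: inserting the definition of the transform and interchanging the
  integrals leaves the transform of a dilated Gaussian, an approximate identity of width t. It holds
  for every integrable \<open>f\<close>, even if the transform is not integrable. Inversion,
  uniqueness and Plancherel all start from it.\<close>

lemma integral_FT_gauss:
  fixes f :: "'a::euclidean_space \<Rightarrow> complex"
  assumes f: "integrable lborel f" and \<sigma>: "\<bar>\<sigma>\<bar> = 1" and t: "t > 0"
  shows "(\<integral>\<xi>. exp (\<i> * complex_of_real (- \<sigma> * (\<xi> \<bullet> x))) * (FT \<sigma> f \<xi> * complex_of_real (gauss (t *\<^sub>R \<xi>))) \<partial>lborel) =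
    complex_of_real (sqrt (2 * pi) ^ DIM('a)) * (\<integral>z. f (x + t *\<^sub>R z) * complex_of_real (gauss z) \<partial>lborel)"
proof -
  let ?G = "\<lambda>\<xi>::'a. complex_of_real (gauss (t *\<^sub>R \<xi>))"
  let ?c = "sqrt (2 * pi) ^ DIM('a)"
  have [measurable]: "f \<in> borel_measurable borel" using f by auto
  have "(\<integral>\<xi>. exp (\<i> * complex_of_real (- \<sigma> * (\<xi> \<bullet> x))) * (FT \<sigma> f \<xi> * ?G \<xi>) \<partial>lborel) =
      (\<integral>\<xi>. (\<integral>y. ?G \<xi> * f y * exp (\<i> * complex_of_real (\<sigma> * (\<xi> \<bullet> (y - x)))) \<partial>lborel) \<partial>lborel)"
  proof (intro Bochner_Integration.integral_cong refl)
    fix \<xi> :: 'a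
    have "exp (\<i> * complex_of_real (- \<sigma> * (\<xi> \<bullet> x))) * (FT \<sigma> f \<xi> * ?G \<xi>) =
      (exp (\<i> * complex_of_real (- \<sigma> * (\<xi> \<bullet> x))) * ?G \<xi>) * FT \<sigma> f \<xi>" by simp
    also have "\<dots> = (\<integral>y. (exp (\<i> * complex_of_real (- \<sigma> * (\<xi> \<bullet> x))) * ?G \<xi>) *
        (exp (\<i> * complex_of_real (\<sigma> * (y \<bullet> \<xi>))) * f y) \<partial>lborel)"
      unfolding FT_def by (rule integral_mult_right_zero[symmetric])
    also have "\<dots> = (\<integral>y. ?G \<xi> * f y * exp (\<i> * complex_of_real (\<sigma> * (\<xi> \<bullet> (y - x)))) \<partial>lborel)"
    proof (intro Bochner_Integration.integral_cong refl)
      fix y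
      have "exp (\<i> * complex_of_real (\<sigma> * (\<xi> \<bullet> (y - x)))) =
        exp (\<i> * complex_of_real (- \<sigma> * (\<xi> \<bullet> x))) * exp (\<i> * complex_of_real (\<sigma> * (y \<bullet> \<xi>)))"
        by (subst exp_add[symmetric]) (simp add: inner_diff_right inner_commute algebra_simps)
      then show "(exp (\<i> * complex_of_real (- \<sigma> * (\<xi> \<bullet> x))) * ?G \<xi>) *
        (exp (\<i> * complex_of_real (\<sigma> * (y \<bullet> \<xi>))) * f y) =
        ?G \<xi> * f y * exp (\<i> * complex_of_real (\<sigma> * (\<xi> \<bullet> (y - x))))"
        by (simp add: mult_ac)
    qed
    finally show "exp (\<i> * complex_of_real (- \<sigma> * (\<xi> \<bullet> x))) * (FT \<sigma> f \<xi> * ?G \<xi>) =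
      (\<integral>y. ?G \<xi> * f y * exp (\<i> * complex_of_real (\<sigma> * (\<xi> \<bullet> (y - x)))) \<partial>lborel)" .
  qed
  also have "\<dots> = (\<integral>y. (\<integral>\<xi>. ?G \<xi> * f y * exp (\<i> * complex_of_real (\<sigma> * (\<xi> \<bullet> (y - x)))) \<partial>lborel) \<partial>lborel)"
    by (rule Fubini_lborel_bounded) (use t f in \<open>auto intro!: integrable_gauss_scale\<close>)
  also have "\<dots> = (\<integral>y. f y * complex_of_real (?c / t ^ DIM('a) * gauss ((y - x) /\<^sub>R t)) \<partial>lborel)"
  proof (intro Bochner_Integration.integral_cong refl)
    fix y
    have "(\<integral>\<xi>. ?G \<xi> * f y * exp (\<i> * complex_of_real (\<sigma> * (\<xi> \<bullet> (y - x)))) \<partial>lborel) =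
        (\<integral>\<xi>. f y * (exp (\<i> * complex_of_real (\<sigma> * (\<xi> \<bullet> (y - x)))) * ?G \<xi>) \<partial>lborel)"
      by (simp add: mult_ac)
    also have "\<dots> = f y * FT \<sigma> ?G (y - x)"
      unfolding FT_def by (rule integral_mult_right_zero)
    finally show "(\<integral>\<xi>. ?G \<xi> * f y * exp (\<i> * complex_of_real (\<sigma> * (\<xi> \<bullet> (y - x)))) \<partial>lborel) =
      f y * complex_of_real (?c / t ^ DIM('a) * gauss ((y - x) /\<^sub>R t))"
      by (simp only: FT_gauss_scale[OF \<sigma> t])
  qed
  \<comment> \<open>Substitution y = x + t z; its Jacobian t^d cancels the factor 1/t^d of the
    narrow Gaussian.\<close>
  also have "\<dots> = \<bar>t\<bar> ^ DIM('a) *\<^sub>R (\<integral>z. f (x + t *\<^sub>R z) *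
      complex_of_real (?c / t ^ DIM('a) * gauss ((x + t *\<^sub>R z - x) /\<^sub>R t)) \<partial>lborel)"
    by (rule integral_lborel_affine) (use t in auto)
  also have "(\<lambda>z. f (x + t *\<^sub>R z) * complex_of_real (?c / t ^ DIM('a) * gauss ((x + t *\<^sub>R z - x) /\<^sub>R t))) =
      (\<lambda>z. complex_of_real (?c / t ^ DIM('a)) * (f (x + t *\<^sub>R z) * complex_of_real (gauss z)))"
    using t by (auto simp: mult_ac)
  also have "\<bar>t\<bar> ^ DIM('a) *\<^sub>R (\<integral>z. complex_of_real (?c / t ^ DIM('a)) * (f (x + t *\<^sub>R z) * complex_of_real (gauss z)) \<partial>lborel) =
      complex_of_real ?c * (\<integral>z. f (x + t *\<^sub>R z) * complex_of_real (gauss z) \<partial>lborel)"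
    unfolding integral_mult_right_zero using t by (simp add: scaleR_conv_of_real)
  finally show ?thesis .
qed

text \<open>Continuity is asked for only at the point \<open>x\<close>, because the limit is later
  taken for the indicator of a box away from its boundary.\<close>

lemma gauss_mollify_tendsto:
  fixes v :: "'a::euclidean_space \<Rightarrow> complex"
  assumes [measurable]: "v \<in> borel_measurable borel" and C: "\<And>x. norm (v x) \<le> C"
    and v: "isCont v x" and t: "t \<longlonglongrightarrow> 0"
  shows "(\<lambda>n. \<integral>z. v (x + t n *\<^sub>R z) * complex_of_real (gauss z) \<partial>lborel) \<longlonglongrightarrow>
    v x * complex_of_real (sqrt (2 * pi) ^ DIM('a))"
proof -
  have "(\<lambda>n. \<integral>z. v (x + t n *\<^sub>R z) * complex_of_real (gauss z) \<partial>lborel) \<longlonglongrightarrow>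
      (\<integral>z. v x * complex_of_real (gauss (z::'a)) \<partial>lborel)"
  proof (rule integral_dominated_convergence)
    show "integrable lborel (\<lambda>z::'a. C * gauss z)" by (intro integrable_mult_right integrable_gauss)
    show "AE z in lborel. (\<lambda>n. v (x + t n *\<^sub>R z) * complex_of_real (gauss z)) \<longlonglongrightarrow> v x * complex_of_real (gauss z)"
    proof (intro AE_I2 tendsto_mult_right)
      fix z
      have "(\<lambda>n. x + t n *\<^sub>R z) \<longlonglongrightarrow> x + 0 *\<^sub>R z" by (intro tendsto_intros t)
      then show "(\<lambda>n. v (x + t n *\<^sub>R z)) \<longlonglongrightarrow> v x"
        using isCont_tendsto_compose[OF v] by simp
    qed
    show "AE z in lborel. norm (v (x + t n *\<^sub>R z) * complex_of_real (gauss z)) \<le> C * gauss z" for n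
      using C by (intro AE_I2) (auto simp: norm_mult intro!: mult_right_mono)
  qed measurable
  moreover have "(\<integral>z. v x * complex_of_real (gauss (z::'a)) \<partial>lborel) = v x * complex_of_real (sqrt (2 * pi) ^ DIM('a))"
    unfolding integral_mult_right_zero integral_complex_of_real integral_gauss ..
  ultimately show ?thesis by (simp only:)
qed

lemma FT_inversion:
  fixes f :: "'a::euclidean_space \<Rightarrow> complex"
  assumes f: "f \<in> schwartz" and \<sigma>: "\<bar>\<sigma>\<bar> = 1"
  shows "FT (- \<sigma>) (FT \<sigma> f) x = complex_of_real ((2 * pi) ^ DIM('a)) * f x"
proof -
  define t where "t n = inverse (real (Suc n))" for n
  have t: "t n > 0" for n by (simp add: t_def)
  have t0: "t \<longlonglongrightarrow> 0" unfolding t_def by (rule LIMSEQ_inverse_real_of_nat)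
  let ?c = "complex_of_real (sqrt (2 * pi) ^ DIM('a))"
  note [measurable] = schwartz_measurable[OF f]
  have F: "integrable lborel (FT \<sigma> f)" by (rule schwartz_integrable[OF FT_schwartz[OF f \<sigma>]])
  obtain C where C: "\<And>x. norm (f x) \<le> C" using schwartz_bounded[OF f] by blast
  have "(\<lambda>n. ?c * (\<integral>z. f (x + t n *\<^sub>R z) * complex_of_real (gauss z) \<partial>lborel)) \<longlonglongrightarrow> ?c * (f x * ?c)"
    using schwartz_continuous_on[OF f, of UNIV]
    by (intro tendsto_mult_left gauss_mollify_tendsto[OF _ C _ t0]) (auto simp: continuous_on_eq_continuous_at)
  moreover have "(\<lambda>n. \<integral>\<xi>. exp (\<i> * complex_of_real (- \<sigma> * (\<xi> \<bullet> x))) *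
      (FT \<sigma> f \<xi> * complex_of_real (gauss (t n *\<^sub>R \<xi>))) \<partial>lborel) \<longlonglongrightarrow> FT (- \<sigma>) (FT \<sigma> f) x"
    unfolding FT_def[of "- \<sigma>"]
  proof (rule integral_dominated_convergence)
    show "integrable lborel (\<lambda>\<xi>. norm (FT \<sigma> f \<xi>))" by (intro integrable_norm F)
    show "AE \<xi> in lborel. (\<lambda>n. exp (\<i> * complex_of_real (- \<sigma> * (\<xi> \<bullet> x))) *
        (FT \<sigma> f \<xi> * complex_of_real (gauss (t n *\<^sub>R \<xi>)))) \<longlonglongrightarrow>
        exp (\<i> * complex_of_real (- \<sigma> * (\<xi> \<bullet> x))) * FT \<sigma> f \<xi>"
    proof (intro AE_I2 tendsto_mult_left)
      fix \<xi> :: 'a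
      have "(\<lambda>n. t n *\<^sub>R \<xi>) \<longlonglongrightarrow> 0 *\<^sub>R \<xi>" by (intro tendsto_intros t0)
      then have "(\<lambda>n. gauss (t n *\<^sub>R \<xi>)) \<longlonglongrightarrow> gauss 0"
        using isCont_tendsto_compose[of 0 gauss] continuous_on_gauss[of UNIV]
        by (auto simp: continuous_on_eq_continuous_at)
      then have "(\<lambda>n. FT \<sigma> f \<xi> * complex_of_real (gauss (t n *\<^sub>R \<xi>))) \<longlonglongrightarrow> FT \<sigma> f \<xi> * complex_of_real 1"
        by (intro tendsto_intros) auto
      then show "(\<lambda>n. FT \<sigma> f \<xi> * complex_of_real (gauss (t n *\<^sub>R \<xi>))) \<longlonglongrightarrow> FT \<sigma> f \<xi>" by simp
    qed
    show "AE \<xi> in lborel. norm (exp (\<i> * complex_of_real (- \<sigma> * (\<xi> \<bullet> x))) *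
        (FT \<sigma> f \<xi> * complex_of_real (gauss (t n *\<^sub>R \<xi>)))) \<le> norm (FT \<sigma> f \<xi>)" for n
      by (intro AE_I2) (simp add: norm_mult mult_left_le gauss_le_1 del: of_real_mult of_real_minus)
  qed measurable
  \<comment> \<open>One factor sqrt(2 pi)^d comes from the regularised formula, the other is the
    total mass of the Gaussian.\<close>
  ultimately have "FT (- \<sigma>) (FT \<sigma> f) x = ?c * (f x * ?c)"
    by (simp only: integral_FT_gauss[OF schwartz_integrable[OF f] \<sigma> t] LIMSEQ_unique)
  also have "\<dots> = complex_of_real ((sqrt (2 * pi) * sqrt (2 * pi)) ^ DIM('a)) * f x"
    by (simp only: power_mult_distrib of_real_mult mult_ac)
  finally show ?thesis by simp
qed

text \<open>By regularised inversion a mollified indicator of the box is a superposition of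
  characters with integrable weight, so its pairing with \<open>k\<close> is a weighted integral of
  \<open>FT 1 k\<close> and vanishes. As the width tends to 0 the mollified indicators converge off
  the boundary of the box, a null set.\<close>

lemma integral_box_eq_0_if_FT_eq_0:
  fixes k :: "'a::euclidean_space \<Rightarrow> complex"
  assumes k: "integrable lborel k" and FT0: "\<And>\<xi>. FT 1 k \<xi> = 0"
  shows "(\<integral>x. indicator (box a b) x *\<^sub>R k x \<partial>lborel) = 0"
proof -
  define t where "t n = inverse (real (Suc n))" for n
  have t: "t n > 0" for n by (simp add: t_def)
  have t0: "t \<longlonglongrightarrow> 0" unfolding t_def by (rule LIMSEQ_inverse_real_of_nat)
  let ?c = "complex_of_real (sqrt (2 * pi) ^ DIM('a))"
  let ?v = "\<lambda>x. complex_of_real (indicator (box a b) x)"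
  have [measurable]: "k \<in> borel_measurable borel" using k by auto
  have v: "integrable lborel ?v"
    unfolding complex_of_real_integrable_eq
    by (intro integrable_real_indicator) (auto intro: emeasure_lborel_box_finite[unfolded infinity_ennreal_def])
  let ?m = "\<lambda>n y. \<integral>z. ?v (y + t n *\<^sub>R z) * complex_of_real (gauss z) \<partial>lborel"
  have m0: "(\<integral>y. k y * ?m n y \<partial>lborel) = 0" for n
  proof -
    \<comment> \<open>With sign -1 the formula rebuilds the box from the characters
      \<open>exp (\<i> * (y \<bullet> \<xi>))\<close>, the very ones that occur in
      \<open>FT 1 k\<close>.\<close>
    let ?w = "\<lambda>\<xi>. FT (- 1) ?v \<xi> * complex_of_real (gauss (t n *\<^sub>R \<xi>))"
    have w: "integrable lborel ?w"
    proof (rule Bochner_Integration.integrable_bound)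
      let ?I = "\<integral>x. norm (?v x) \<partial>lborel"
      show "integrable lborel (\<lambda>\<xi>. complex_of_real ?I * complex_of_real (gauss (t n *\<^sub>R \<xi>)))"
        using t[of n] by (intro integrable_mult_right integrable_gauss_scale) auto
      show "AE \<xi> in lborel. norm (?w \<xi>) \<le> norm (complex_of_real ?I * complex_of_real (gauss (t n *\<^sub>R \<xi>)))"
        by (intro AE_I2, unfold norm_mult, intro mult_right_mono)
           (auto intro!: order_trans[OF norm_FT_le])
    qed measurable
    have "?c * (\<integral>y. k y * ?m n y \<partial>lborel) = (\<integral>y. k y * (?c * ?m n y) \<partial>lborel)"
      unfolding integral_mult_right_zero[symmetric] by (simp add: mult_ac)
    also have "\<dots> = (\<integral>y. k y * (\<integral>\<xi>. exp (\<i> * complex_of_real (- (- 1) * (\<xi> \<bullet> y))) * ?w \<xi> \<partial>lborel) \<partial>lborel)"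
      by (subst integral_FT_gauss[OF v _ t]) auto
    also have "\<dots> = (\<integral>y. (\<integral>\<xi>. k y * ?w \<xi> * exp (\<i> * complex_of_real (y \<bullet> \<xi>)) \<partial>lborel) \<partial>lborel)"
      unfolding integral_mult_right_zero[symmetric] by (simp add: mult_ac inner_commute)
    also have "\<dots> = (\<integral>\<xi>. (\<integral>y. k y * ?w \<xi> * exp (\<i> * complex_of_real (y \<bullet> \<xi>)) \<partial>lborel) \<partial>lborel)"
      by (rule Fubini_lborel_bounded[OF k w]) auto
    also have "\<dots> = (\<integral>\<xi>. ?w \<xi> * FT 1 k \<xi> \<partial>lborel)"
      unfolding FT_def[of 1] integral_mult_right_zero[symmetric] by (simp add: mult_ac)
    also have "\<dots> = 0" by (simp add: FT0)
    finally show ?thesis by simp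
  qed
  have null: "AE y in lborel. y \<notin> frontier (box a b)"
  proof -
    have "frontier (box a b) \<subseteq> cbox a b - box a b"
      by (metis Diff_mono closed_cbox box_subset_cbox closure_minimal frontier_def interior_open open_box order_refl)
    moreover have "emeasure lborel (cbox a b - box a b) = 0"
      by (subst emeasure_Diff)
         (auto simp: box_subset_cbox emeasure_lborel_box_eq emeasure_lborel_cbox_eq
           emeasure_lborel_box_finite[THEN less_imp_neq])
    ultimately show ?thesis
      by (intro AE_I[of _ _ "cbox a b - box a b"]) auto
  qed
  have "(\<lambda>n. \<integral>y. k y * ?m n y \<partial>lborel) \<longlonglongrightarrow> (\<integral>y. k y * (?v y * ?c) \<partial>lborel)"
  proof (rule integral_dominated_convergence)
    show "integrable lborel (\<lambda>y. norm (k y) * sqrt (2 * pi) ^ DIM('a))"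
      by (intro integrable_mult_left integrable_norm k)
    show "AE y in lborel. (\<lambda>n. k y * ?m n y) \<longlonglongrightarrow> k y * (?v y * ?c)"
      using null
    proof eventually_elim
      case (elim y)
      then have "isCont ?v y" by (intro isCont_of_real) (simp add: isCont_indicator)
      then show ?case
        by (intro tendsto_mult_left gauss_mollify_tendsto[OF _ _ _ t0, of _ 1]) (auto simp: indicator_def)
    qed
    show "AE y in lborel. norm (k y * ?m n y) \<le> norm (k y) * sqrt (2 * pi) ^ DIM('a)" for n
    proof (intro AE_I2, unfold norm_mult, intro mult_left_mono)
      fix y
      have "norm (?m n y) \<le> (\<integral>z. gauss (z::'a) \<partial>lborel)"
        by (rule Bochner_Integration.integral_norm_bound_integral)
           (auto simp: norm_mult indicator_def integrable_gauss intro!: Bochner_Integration.integrable_bound[OF integrable_gauss])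
      then show "norm (?m n y) \<le> sqrt (2 * pi) ^ DIM('a)" by (simp only: integral_gauss)
    qed simp
  qed measurable
  then have "(\<integral>y. k y * (?v y * ?c) \<partial>lborel) = 0" by (simp only: m0 LIMSEQ_const_iff)
  also have "(\<lambda>y. k y * (?v y * ?c)) = (\<lambda>y. ?c * (indicator (box a b) y *\<^sub>R k y))"
    by (auto simp: scaleR_conv_of_real)
  finally show ?thesis unfolding integral_mult_right_zero by simp
qed

text \<open>It suffices that \<open>k\<close> has integral zero over every Borel set. Boxes are
  stable under intersection and generate the Borel sets, so a Dynkin argument extends the case of
  boxes.\<close>

lemma AE_eq_0_if_FT_eq_0:
  fixes k :: "'a::euclidean_space \<Rightarrow> complex"
  assumes k: "integrable lborel k" and FT0: "\<And>\<xi>. FT 1 k \<xi> = 0"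
  shows "AE x in lborel. k x = 0"
proof (rule sigma_finite_measure.density_zero[OF lborel.sigma_finite_measure_axioms k])
  fix A :: "'a set" assume "A \<in> sets lborel"
  then have A: "A \<in> sigma_sets UNIV (range (\<lambda>(a, b). box a b))"
    by (simp add: borel_eq_box)
  have Int: "Int_stable (range (\<lambda>(a, b). box a (b :: 'a)))"
    by (auto simp: Int_stable_def box_Int_box)
  have sub: "range (\<lambda>(a, b). box a (b :: 'a)) \<subseteq> Pow UNIV" by simp
  have si: "set_integrable lborel B k" if "B \<in> sets lborel" for B
    unfolding set_integrable_def by (rule integrable_mult_indicator[OF that k])
  from Int sub A show "set_lebesgue_integral lborel A k = 0"
  proof (induction rule: sigma_sets_induct_disjoint)
    case (basic A)
    then show ?case
      using integral_box_eq_0_if_FT_eq_0[OF assms] by (auto simp: set_lebesgue_integral_def)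
  next
    case empty
    then show ?case by (simp add: set_lebesgue_integral_def)
  next
    case (compl A)
    then have A': "A \<in> sets lborel" by (simp add: borel_eq_box)
    \<comment> \<open>The integral over the whole space is the transform at frequency 0.\<close>
    have "set_lebesgue_integral lborel UNIV k = 0"
      using FT0[of 0] by (simp add: FT_def set_lebesgue_integral_def)
    moreover have "set_lebesgue_integral lborel UNIV k =
        set_lebesgue_integral lborel A k + set_lebesgue_integral lborel (UNIV - A) k"
    proof (subst set_integral_Un[symmetric])
      show "set_integrable lborel A k" "set_integrable lborel (UNIV - A) k"
        using A' by (auto intro!: si)
    qed auto
    ultimately show ?case using compl by simp
  next
    case (union A)
    then have A': "A i \<in> sets lborel" for i by (auto simp: borel_eq_box)
    have "set_lebesgue_integral lborel (\<Union>i. A i) k = (\<Sum>i. set_lebesgue_integral lborel (A i) k)"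
    proof (rule lebesgue_integral_countable_add)
      show "set_integrable lborel (\<Union>i. A i) k"
        using A' by (intro si) auto
    qed (use union A' in \<open>auto simp: disjoint_family_on_def\<close>)
    with union show ?case by simp
  qed
qed

text \<open>The difference of the two functions may fail to be integrable, but its product with the
  Gaussian is, and testing with \<open>mod_gauss \<xi>\<close> computes the transform of this
  product at \<xi>.\<close>

lemma represents_unique:
  fixes h :: "'a::euclidean_space \<Rightarrow> complex"
  assumes h: "represents h u" and h': "represents h' u"
  shows "AE x in lborel. h x = h' x"
proof -
  let ?k = "\<lambda>x. (h x - h' x) * mod_gauss 0 x"
  have int: "integrable lborel (\<lambda>x. h x * mod_gauss \<xi> x)" "integrable lborel (\<lambda>x. h' x * mod_gauss \<xi> x)"
    and eq: "(\<integral>x. h x * mod_gauss \<xi> x \<partial>lborel) = (\<integral>x. h' x * mod_gauss \<xi> x \<partial>lborel)" for \<xi>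
    using h h' mod_gauss_schwartz[of \<xi>] unfolding represents_def dist_of_fun_def by metis+
  have "AE x in lborel. ?k x = 0"
  proof (rule AE_eq_0_if_FT_eq_0)
    show "integrable lborel ?k"
      using int[of 0] by (simp add: left_diff_distrib)
    fix \<xi>
    have "FT 1 ?k \<xi> = (\<integral>x. h x * mod_gauss \<xi> x - h' x * mod_gauss \<xi> x \<partial>lborel)"
      unfolding FT_def by (simp add: mod_gauss_eq algebra_simps)
    then show "FT 1 ?k \<xi> = 0"
      using int[of \<xi>] eq[of \<xi>] by simp
  qed
  then show ?thesis
    by eventually_elim (simp add: mod_gauss_def)
qed

section \<open>The Plancherel inequality\<close>

text \<open>A Bochner integral that does not exist has the value 0, so the bound covers that case as
  well.\<close>

lemma norm_integral_le_nn_integral: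
  fixes f :: "'a \<Rightarrow> 'b::{banach, second_countable_topology}"
  shows "ennreal (norm (integral\<^sup>L M f)) \<le> (\<integral>\<^sup>+x. ennreal (norm (f x)) \<partial>M)"
  by (cases "integrable M f") (auto intro: integral_norm_bound_ennreal simp: not_integrable_integral_eq)

lemma cnj_FT: "cnj (FT \<sigma> f x) = FT (- \<sigma>) (\<lambda>y. cnj (f y)) x"
  unfolding FT_def by (subst Bochner_Integration.integral_cnj[symmetric]) (simp add: exp_cnj del: Bochner_Integration.integral_cnj)

text \<open>Writing one factor of the squared modulus as an integral and interchanging turns the
  left side into the pairing of \<open>f\<close> with its own Gaussian average. The constant is
  sqrt(2 pi)^d from the regularised formula times sqrt(2 pi)^d from the mass of the
  Gaussian.\<close>

lemma nn_integral_FT_gauss_le: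
  fixes f :: "'a::euclidean_space \<Rightarrow> complex"
  assumes f: "integrable lborel f" and \<sigma>: "\<bar>\<sigma>\<bar> = 1" and t: "t > 0"
  shows "(\<integral>\<^sup>+x. ennreal ((norm (FT \<sigma> f x))\<^sup>2 * gauss (t *\<^sub>R x)) \<partial>lborel) \<le>
    ennreal ((2 * pi) ^ DIM('a)) * (\<integral>\<^sup>+x. ennreal ((norm (f x))\<^sup>2) \<partial>lborel)"
proof -
  let ?c = "sqrt (2 * pi) ^ DIM('a)"
  let ?w = "\<lambda>x. FT \<sigma> f x * complex_of_real (gauss (t *\<^sub>R x))"
  let ?I = "\<integral>\<^sup>+x. ennreal ((norm (f x))\<^sup>2) \<partial>lborel"
  have [measurable]: "f \<in> borel_measurable borel" using f by auto
  have cf: "integrable lborel (\<lambda>y. cnj (f y))" using f by simp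
  let ?B = "\<integral>x. norm (f x) \<partial>lborel"
  have B: "0 \<le> ?B" by simp
  have w: "integrable lborel ?w"
  proof (rule Bochner_Integration.integrable_bound)
    show "integrable lborel (\<lambda>x. complex_of_real ?B * complex_of_real (gauss (t *\<^sub>R x)))"
      using t by (intro integrable_mult_right integrable_gauss_scale) auto
    show "AE x in lborel. norm (?w x) \<le> norm (complex_of_real ?B * complex_of_real (gauss (t *\<^sub>R x)))"
      using B by (intro AE_I2, unfold norm_mult, intro mult_right_mono) (auto intro: norm_FT_le)
  qed measurable
  have wi: "integrable lborel (\<lambda>x. (norm (FT \<sigma> f x))\<^sup>2 * gauss (t *\<^sub>R x))"
  proof (rule Bochner_Integration.integrable_bound)
    show "integrable lborel (\<lambda>x. ?B * norm (?w x))"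
      by (intro integrable_mult_right integrable_norm w)
    show "AE x in lborel. norm ((norm (FT \<sigma> f x))\<^sup>2 * gauss (t *\<^sub>R x)) \<le> norm (?B * norm (?w x))"
      using B by (intro AE_I2)
        (auto simp: norm_mult abs_mult power2_eq_square mult.assoc intro!: mult_right_mono norm_FT_le)
  qed measurable
  have "complex_of_real (\<integral>x. (norm (FT \<sigma> f x))\<^sup>2 * gauss (t *\<^sub>R x) \<partial>lborel) =
      (\<integral>x. ?w x * FT (- \<sigma>) (\<lambda>y. cnj (f y)) x \<partial>lborel)"
    unfolding integral_complex_of_real[symmetric] cnj_FT[symmetric]
    by (intro Bochner_Integration.integral_cong refl) (simp add: complex_norm_square mult_ac del: of_real_power)
  also have "\<dots> = (\<integral>x. (\<integral>y. ?w x * cnj (f y) * exp (\<i> * complex_of_real (- \<sigma> * (y \<bullet> x))) \<partial>lborel) \<partial>lborel)"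
    unfolding FT_def[of "- \<sigma>"] integral_mult_right_zero[symmetric] by (simp only: mult_ac)
  also have "\<dots> = (\<integral>y. (\<integral>x. ?w x * cnj (f y) * exp (\<i> * complex_of_real (- \<sigma> * (y \<bullet> x))) \<partial>lborel) \<partial>lborel)"
    by (rule Fubini_lborel_bounded[OF w cf]) auto
  also have "\<dots> = (\<integral>y. cnj (f y) * (\<integral>x. exp (\<i> * complex_of_real (- \<sigma> * (x \<bullet> y))) * ?w x \<partial>lborel) \<partial>lborel)"
    unfolding integral_mult_right_zero[symmetric] by (simp only: mult_ac inner_commute)
  also have "\<dots> = (\<integral>y. cnj (f y) * (complex_of_real ?c * (\<integral>z. f (y + t *\<^sub>R z) * complex_of_real (gauss z) \<partial>lborel)) \<partial>lborel)"
    by (simp only: integral_FT_gauss[OF f \<sigma> t])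
  finally have eq: "complex_of_real (\<integral>x. (norm (FT \<sigma> f x))\<^sup>2 * gauss (t *\<^sub>R x) \<partial>lborel) = \<dots>" .
  have "(\<integral>\<^sup>+x. ennreal ((norm (FT \<sigma> f x))\<^sup>2 * gauss (t *\<^sub>R x)) \<partial>lborel) =
      ennreal (\<integral>x. (norm (FT \<sigma> f x))\<^sup>2 * gauss (t *\<^sub>R x) \<partial>lborel)"
    by (rule nn_integral_eq_integral[OF wi]) auto
  also have "\<dots> = ennreal (norm (complex_of_real (\<integral>x. (norm (FT \<sigma> f x))\<^sup>2 * gauss (t *\<^sub>R x) \<partial>lborel)))"
    by (simp add: integral_nonneg_AE)
  also have "\<dots> \<le> (\<integral>\<^sup>+y. ennreal (norm (cnj (f y) * (complex_of_real ?c * (\<integral>z. f (y + t *\<^sub>R z) * complex_of_real (gauss z) \<partial>lborel)))) \<partial>lborel)"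
    unfolding eq by (rule norm_integral_le_nn_integral)
  \<comment> \<open>The inequality ab <= (a^2 + b^2)/2 takes the place of Cauchy-Schwarz: by
    translation invariance both squares have the same integral in y, and an infinite value does no
    harm.\<close>
  also have "\<dots> \<le> (\<integral>\<^sup>+y. ennreal ?c * (\<integral>\<^sup>+z. ennreal (((norm (f y))\<^sup>2 + (norm (f (y + t *\<^sub>R z)))\<^sup>2) / 2 * gauss z) \<partial>lborel) \<partial>lborel)"
  proof (intro nn_integral_mono)
    fix y
    have "ennreal (norm (cnj (f y) * (complex_of_real ?c * (\<integral>z. f (y + t *\<^sub>R z) * complex_of_real (gauss z) \<partial>lborel)))) =
        ennreal ?c * (ennreal (norm (f y)) * ennreal (norm (\<integral>z. f (y + t *\<^sub>R z) * complex_of_real (gauss z) \<partial>lborel)))"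
      by (simp add: norm_mult ennreal_mult'[symmetric] norm_power abs_of_nonneg mult_ac)
    also have "\<dots> \<le> ennreal ?c * (ennreal (norm (f y)) * (\<integral>\<^sup>+z. ennreal (norm (f (y + t *\<^sub>R z) * complex_of_real (gauss z))) \<partial>lborel))"
      by (intro mult_left_mono norm_integral_le_nn_integral) auto
    also have "\<dots> = ennreal ?c * (\<integral>\<^sup>+z. ennreal (norm (f y)) * ennreal (norm (f (y + t *\<^sub>R z) * complex_of_real (gauss z))) \<partial>lborel)"
      by (subst nn_integral_cmult) auto
    also have "\<dots> \<le> ennreal ?c * (\<integral>\<^sup>+z. ennreal (((norm (f y))\<^sup>2 + (norm (f (y + t *\<^sub>R z)))\<^sup>2) / 2 * gauss z) \<partial>lborel)"
    proof (intro mult_left_mono nn_integral_mono)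
      fix z
      have "norm (f y) * norm (f (y + t *\<^sub>R z)) \<le> ((norm (f y))\<^sup>2 + (norm (f (y + t *\<^sub>R z)))\<^sup>2) / 2"
        using sum_squares_bound[of "norm (f y)" "norm (f (y + t *\<^sub>R z))"] by simp
      from mult_right_mono[OF this gauss_nonneg[of z]]
      show "ennreal (norm (f y)) * ennreal (norm (f (y + t *\<^sub>R z) * complex_of_real (gauss z))) \<le>
        ennreal (((norm (f y))\<^sup>2 + (norm (f (y + t *\<^sub>R z)))\<^sup>2) / 2 * gauss z)"
        by (simp add: ennreal_mult'[symmetric] norm_mult mult.assoc)
    qed simp
    finally show "ennreal (norm (cnj (f y) * (complex_of_real ?c * (\<integral>z. f (y + t *\<^sub>R z) * complex_of_real (gauss z) \<partial>lborel)))) \<le>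
      ennreal ?c * (\<integral>\<^sup>+z. ennreal (((norm (f y))\<^sup>2 + (norm (f (y + t *\<^sub>R z)))\<^sup>2) / 2 * gauss z) \<partial>lborel)" .
  qed
  also have "\<dots> = ennreal ?c * (\<integral>\<^sup>+z. (\<integral>\<^sup>+y. ennreal (((norm (f y))\<^sup>2 + (norm (f (y + t *\<^sub>R z)))\<^sup>2) / 2 * gauss z) \<partial>lborel) \<partial>lborel)"
    by (subst nn_integral_cmult) (simp, subst lborel_pair.Fubini', auto)
  also have "\<dots> = ennreal ?c * (\<integral>\<^sup>+z. ennreal (gauss (z::'a)) * ?I \<partial>lborel)"
  proof -
    have "(\<integral>\<^sup>+y. ennreal (((norm (f y))\<^sup>2 + (norm (f (y + t *\<^sub>R z)))\<^sup>2) / 2 * gauss z) \<partial>lborel) =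
        ennreal (gauss z) * ?I" for z
    proof -
      have tr: "(\<integral>\<^sup>+y. ennreal ((norm (f (y + t *\<^sub>R z)))\<^sup>2) \<partial>lborel) = ?I"
        using nn_integral_lborel_affine[of "\<lambda>y. ennreal ((norm (f y))\<^sup>2)" 1 "t *\<^sub>R z"] by (simp add: add.commute)
      have "(\<integral>\<^sup>+y. ennreal (((norm (f y))\<^sup>2 + (norm (f (y + t *\<^sub>R z)))\<^sup>2) / 2 * gauss z) \<partial>lborel) =
          (\<integral>\<^sup>+y. ennreal (gauss z / 2) * (ennreal ((norm (f y))\<^sup>2) + ennreal ((norm (f (y + t *\<^sub>R z)))\<^sup>2)) \<partial>lborel)"
        by (intro nn_integral_cong) (simp add: ennreal_mult'[symmetric] ennreal_plus[symmetric] field_simps del: ennreal_plus)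
      also have "\<dots> = ennreal (gauss z / 2) * (?I + ?I)"
        by (subst nn_integral_cmult, simp, subst nn_integral_add) (simp_all add: tr)
      also have "\<dots> = ennreal (gauss z / 2) * (2 * ?I)" by (simp add: mult_2)
      also have "\<dots> = ennreal (gauss z / 2 * 2) * ?I"
        by (subst ennreal_mult') (auto simp: mult.assoc)
      finally show ?thesis by simp
    qed
    then show ?thesis by simp
  qed
  also have "\<dots> = ennreal ?c * (ennreal ?c * ?I)"
    by (subst nn_integral_multc) (simp_all add: nn_integral_eq_integral[OF integrable_gauss] integral_gauss)
  also have "\<dots> = ennreal (?c * ?c) * ?I"
    by (simp add: ennreal_mult mult.assoc)
  also have "?c * ?c = (2 * pi) ^ DIM('a)"
    by (subst power_mult_distrib[symmetric]) simp
  finally show ?thesis .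
qed

text \<open>Fatou's lemma removes the Gaussian factor as its width grows.\<close>

lemma nn_integral_FT_square_le:
  fixes f :: "'a::euclidean_space \<Rightarrow> complex"
  assumes f: "integrable lborel f" and \<sigma>: "\<bar>\<sigma>\<bar> = 1"
  shows "(\<integral>\<^sup>+x. ennreal ((norm (FT \<sigma> f x))\<^sup>2) \<partial>lborel) \<le>
    ennreal ((2 * pi) ^ DIM('a)) * (\<integral>\<^sup>+x. ennreal ((norm (f x))\<^sup>2) \<partial>lborel)"
proof -
  define t where "t n = inverse (real (Suc n))" for n
  have t: "t n > 0" for n by (simp add: t_def)
  have t0: "t \<longlonglongrightarrow> 0" unfolding t_def by (rule LIMSEQ_inverse_real_of_nat)
  have [measurable]: "f \<in> borel_measurable borel" using f by auto
  let ?g = "\<lambda>n x. ennreal ((norm (FT \<sigma> f x))\<^sup>2 * gauss (t n *\<^sub>R x))"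
  have "liminf (\<lambda>n. ?g n x) = ennreal ((norm (FT \<sigma> f x))\<^sup>2)" for x
  proof (rule lim_imp_Liminf)
    have "(\<lambda>n. t n *\<^sub>R x) \<longlonglongrightarrow> 0 *\<^sub>R x" by (intro tendsto_intros t0)
    then have "(\<lambda>n. gauss (t n *\<^sub>R x)) \<longlonglongrightarrow> gauss 0"
      using isCont_tendsto_compose[of 0 gauss] continuous_on_gauss[of UNIV]
      by (auto simp: continuous_on_eq_continuous_at)
    from tendsto_mult_left[OF this, of "(norm (FT \<sigma> f x))\<^sup>2"]
    show "(\<lambda>n. ?g n x) \<longlonglongrightarrow> ennreal ((norm (FT \<sigma> f x))\<^sup>2)" by (intro tendsto_ennrealI) simp
  qed simp
  then have "(\<integral>\<^sup>+x. ennreal ((norm (FT \<sigma> f x))\<^sup>2) \<partial>lborel) = (\<integral>\<^sup>+x. liminf (\<lambda>n. ?g n x) \<partial>lborel)"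
    by simp
  also have "\<dots> \<le> liminf (\<lambda>n. \<integral>\<^sup>+x. ?g n x \<partial>lborel)"
    by (rule nn_integral_liminf) measurable
  also have "\<dots> \<le> liminf (\<lambda>n::nat. ennreal ((2 * pi) ^ DIM('a)) * (\<integral>\<^sup>+x. ennreal ((norm (f x))\<^sup>2) \<partial>lborel))"
    by (intro Liminf_mono always_eventually allI nn_integral_FT_gauss_le f \<sigma> t)
  finally show ?thesis by (simp add: Liminf_const)
qed

text \<open>This is the duality that defines the transform of a distribution; it later identifies
  the limit of the truncated transforms.\<close>

lemma FT_multiplication_formula:
  fixes f g :: "'a::euclidean_space \<Rightarrow> complex"
  assumes f: "integrable lborel f" and g: "integrable lborel g"
  shows "(\<integral>x. FT \<sigma> f x * g x \<partial>lborel) = (\<integral>x. f x * FT \<sigma> g x \<partial>lborel)"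
proof -
  have "(\<integral>x. FT \<sigma> f x * g x \<partial>lborel) =
      (\<integral>x. (\<integral>y. g x * f y * exp (\<i> * complex_of_real (\<sigma> * (y \<bullet> x))) \<partial>lborel) \<partial>lborel)"
    unfolding FT_def integral_mult_left_zero[symmetric] by (simp only: mult_ac)
  also have "\<dots> = (\<integral>y. (\<integral>x. g x * f y * exp (\<i> * complex_of_real (\<sigma> * (y \<bullet> x))) \<partial>lborel) \<partial>lborel)"
    by (rule Fubini_lborel_bounded[OF g f]) auto
  also have "\<dots> = (\<integral>y. f y * FT \<sigma> g y \<partial>lborel)"
    unfolding FT_def integral_mult_right_zero[symmetric] by (simp only: mult_ac inner_commute)
  finally show ?thesis .
qed

text \<open>The limit is the pointwise limit of a fast subsequence, whose jumps are controlled by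
  Chebyshev and Borel-Cantelli. Fatou's lemma then hands the rate \<open>e\<close> on to the limit
  unchanged, with no triangle inequality for the integrals.\<close>

lemma Lp_Cauchy_limit:
  fixes F :: "nat \<Rightarrow> 'a \<Rightarrow> complex"
  assumes [measurable]: "\<And>n. F n \<in> borel_measurable M" and p: "p > 0"
    and e: "e \<longlonglongrightarrow> 0"
    and F: "\<And>n m. n \<le> m \<Longrightarrow> (\<integral>\<^sup>+x. ennreal (norm (F m x - F n x) powr p) \<partial>M) \<le> e n"
  shows "\<exists>G\<in>borel_measurable M. \<forall>n. (\<integral>\<^sup>+x. ennreal (norm (G x - F n x) powr p) \<partial>M) \<le> e n"
proof -
  define \<delta> where "\<delta> j = (1 / 2 :: real) ^ j" for j
  have \<delta>: "\<delta> j > 0" for j by (simp add: \<delta>_def)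
  \<comment> \<open>Chebyshev at level \<open>\<delta> j\<close> divides by
    \<open>\<delta> j powr p\<close>, so this threshold leaves the summable bound
    \<open>\<delta> j\<close> for the measure of the bad set.\<close>
  have "\<exists>n>k. e n \<le> ennreal (\<delta> j * \<delta> j powr p)" for j k
  proof -
    have "eventually (\<lambda>n. e n < ennreal (\<delta> j * \<delta> j powr p)) sequentially"
      using \<delta>[of j] by (intro order_tendstoD(2)[OF e]) (simp add: ennreal_less_zero_iff)
    then have "eventually (\<lambda>n. e n < ennreal (\<delta> j * \<delta> j powr p) \<and> n > k) sequentially"
      by (intro eventually_conj eventually_gt_at_top)
    then show ?thesis
      by (metis (mono_tags, lifting) eventually_sequentially less_imp_le order_refl)
  qed
  then have ex: "\<exists>n. n > k \<and> e n \<le> ennreal (\<delta> j * \<delta> j powr p)" for j k by blast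
  define s0 where "s0 j k = (SOME n. n > k \<and> e n \<le> ennreal (\<delta> j * \<delta> j powr p))" for j k
  have s0: "s0 j k > k" "e (s0 j k) \<le> ennreal (\<delta> j * \<delta> j powr p)" for j k
    using someI_ex[OF ex[of k j]] unfolding s0_def by blast+
  define s where "s = rec_nat (s0 0 0) (\<lambda>j k. s0 (Suc j) k)"
  have s_e: "e (s j) \<le> ennreal (\<delta> j * \<delta> j powr p)" for j
    by (cases j) (auto simp: s_def s0)
  have s_mono: "strict_mono s"
    by (rule strict_mono_Suc_iff[THEN iffD2]) (auto simp: s_def s0)
  let ?A = "\<lambda>j. {x \<in> space M. \<delta> j < norm (F (s (Suc j)) x - F (s j) x)}"
  have A: "emeasure M (?A j) \<le> ennreal (\<delta> j)" for j
  proof -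
    let ?u = "\<lambda>x. ennreal (norm (F (s (Suc j)) x - F (s j) x) powr p)"
    have "emeasure M (?A j) = (\<integral>\<^sup>+x. indicator (?A j) x \<partial>M)" by simp
    also have "\<dots> \<le> (\<integral>\<^sup>+x. ennreal (1 / \<delta> j powr p) * ?u x \<partial>M)"
    proof (intro nn_integral_mono)
      fix x assume "x \<in> space M"
      have "1 \<le> 1 / \<delta> j powr p * norm (F (s (Suc j)) x - F (s j) x) powr p" if "x \<in> ?A j"
        using that \<delta>[of j] p powr_mono2[of p "\<delta> j" "norm (F (s (Suc j)) x - F (s j) x)"] by simp
      then show "indicator (?A j) x \<le> ennreal (1 / \<delta> j powr p) * ?u x"
        by (auto simp: indicator_def ennreal_mult'[symmetric])
    qed
    also have "\<dots> = ennreal (1 / \<delta> j powr p) * (\<integral>\<^sup>+x. ?u x \<partial>M)"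
      by (rule nn_integral_cmult) measurable
    also have "\<dots> \<le> ennreal (1 / \<delta> j powr p) * ennreal (\<delta> j * \<delta> j powr p)"
      using s_mono by (intro mult_left_mono order_trans[OF F s_e]) (auto simp: strict_mono_Suc_iff less_imp_le)
    also have "\<dots> = ennreal (\<delta> j)"
      using \<delta>[of j] by (simp add: ennreal_mult'[symmetric])
    finally show ?thesis .
  qed
  have "AE x in M. eventually (\<lambda>j. x \<in> space M - ?A j) sequentially"
  proof (rule borel_cantelli_AE1)
    show "emeasure M (?A j) < \<infinity>" for j
      using A[of j] by (rule order.strict_trans1) simp
    have "summable \<delta>" unfolding \<delta>_def by (rule summable_geometric) simp
    then show "summable (\<lambda>j. measure M (?A j))"
    proof (rule summable_comparison_test')
      show "norm (measure M (?A j)) \<le> \<delta> j" for j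
        using A[of j] \<delta>[of j] by (simp add: measure_def enn2real_leI)
    qed
  qed measurable
  then have conv: "AE x in M. (\<lambda>j. F (s j) x) \<longlonglongrightarrow> lim (\<lambda>j. F (s j) x)"
  proof eventually_elim
    case (elim x)
    then have "eventually (\<lambda>j. norm (F (s (Suc j)) x - F (s j) x) \<le> \<delta> j) sequentially"
      by (rule eventually_mono) (auto simp: not_less)
    then have "summable (\<lambda>j. F (s (Suc j)) x - F (s j) x)"
      by (rule summable_comparison_test_ev) (simp add: \<delta>_def summable_geometric)
    then have "convergent (\<lambda>m. \<Sum>j<m. F (s (Suc j)) x - F (s j) x)"
      by (simp only: summable_iff_convergent)
    then have "convergent (\<lambda>m. F (s m) x - F (s 0) x)"
      by (simp only: sum_lessThan_telescope[of "\<lambda>j. F (s j) x"])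
    from convergent_add[OF this convergent_const[of "F (s 0) x"]]
    have "convergent (\<lambda>j. F (s j) x)" by simp
    then show ?case by (simp add: convergent_LIMSEQ_iff)
  qed
  show ?thesis
  proof (intro bexI allI)
    show "(\<lambda>x. lim (\<lambda>j. F (s j) x)) \<in> borel_measurable M" by measurable
    fix n
    have "(\<integral>\<^sup>+x. ennreal (norm (lim (\<lambda>j. F (s j) x) - F n x) powr p) \<partial>M) =
        (\<integral>\<^sup>+x. liminf (\<lambda>j. ennreal (norm (F (s j) x - F n x) powr p)) \<partial>M)"
    proof (rule nn_integral_cong_AE)
      show "AE x in M. ennreal (norm (lim (\<lambda>j. F (s j) x) - F n x) powr p) =
          liminf (\<lambda>j. ennreal (norm (F (s j) x - F n x) powr p))"
        using conv
      proof eventually_elim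
        case (elim x)
        have "(\<lambda>j. ennreal (norm (F (s j) x - F n x) powr p)) \<longlonglongrightarrow>
            ennreal (norm (lim (\<lambda>j. F (s j) x) - F n x) powr p)"
          using p by (intro tendsto_ennrealI tendsto_powr' tendsto_norm tendsto_diff elim tendsto_const) auto
        then show ?case by (intro lim_imp_Liminf[symmetric]) auto
      qed
    qed
    also have "\<dots> \<le> liminf (\<lambda>j. \<integral>\<^sup>+x. ennreal (norm (F (s j) x - F n x) powr p) \<partial>M)"
      by (rule nn_integral_liminf) measurable
    also have "\<dots> \<le> liminf (\<lambda>j::nat. e n)"
    proof (rule Liminf_mono)
      show "eventually (\<lambda>j. (\<integral>\<^sup>+x. ennreal (norm (F (s j) x - F n x) powr p) \<partial>M) \<le> e n) sequentially"
        using eventually_ge_at_top[of n]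
        by eventually_elim (use strict_mono_imp_increasing[OF s_mono] order_trans in \<open>blast intro: F\<close>)
    qed
    finally show "(\<integral>\<^sup>+x. ennreal (norm (lim (\<lambda>j. F (s j) x) - F n x) powr p) \<partial>M) \<le> e n"
      by (simp add: Liminf_const)
  qed
qed

section \<open>Limits of truncated Fourier integrals\<close>

text \<open>If a exceeds \<delta>, write a = a^(1-p) a^p and use that the exponent 1-p is not
  positive. This replaces Hoelder's inequality when an L^p function is paired with a test function
  that is both bounded and integrable.\<close>

lemma le_add_powr:
  fixes a \<delta> p :: real
  assumes "0 \<le> a" "0 < \<delta>" "1 \<le> p"
  shows "a \<le> \<delta> + \<delta> powr (1 - p) * a powr p"
proof (cases "a \<le> \<delta>")
  case True
  then show ?thesis using assms by (simp add: add_increasing2)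
next
  case False
  then have a: "a > \<delta>" by simp
  have "a = a powr (1 - p) * a powr p"
    using a assms by (simp flip: powr_add)
  also have "a powr (1 - p) \<le> \<delta> powr (1 - p)"
    using a assms by (intro powr_mono2') auto
  finally have "a \<le> \<delta> powr (1 - p) * a powr p"
    by (simp add: mult_right_mono)
  then show ?thesis using assms by simp
qed

text \<open>On a bounded set the Gaussian is bounded below, so integrability against it yields local
  integrability.\<close>

lemma integrable_bounded_indicator:
  fixes H :: "'a::euclidean_space \<Rightarrow> complex"
  assumes [measurable]: "H \<in> borel_measurable borel" "A \<in> sets borel"
    and int: "integrable lborel (\<lambda>x. H x * complex_of_real (gauss x))"
    and A: "bounded A"
  shows "integrable lborel (\<lambda>x. indicator A x *\<^sub>R H x)"
proof -
  obtain R where R: "\<And>x. x \<in> A \<Longrightarrow> norm x \<le> R"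
    using A by (auto simp: bounded_iff)
  show ?thesis
  proof (rule Bochner_Integration.integrable_bound)
    show "integrable lborel (\<lambda>x. exp (R\<^sup>2 / 2) * norm (H x * complex_of_real (gauss x)))"
      by (intro integrable_mult_right integrable_norm int)
    show "AE x in lborel. norm (indicator A x *\<^sub>R H x) \<le>
        norm (exp (R\<^sup>2 / 2) * norm (H x * complex_of_real (gauss x)))"
    proof (intro AE_I2)
      fix x
      have "norm (H x) \<le> exp (R\<^sup>2 / 2) * (norm (H x) * gauss x)" if "x \<in> A"
      proof -
        have "(norm x)\<^sup>2 \<le> R\<^sup>2" using R[OF that] by (intro power_mono) auto
        then have "1 \<le> exp (R\<^sup>2 / 2) * gauss x"
          by (simp add: gauss_def flip: exp_add)
        from mult_right_mono[OF this norm_ge_zero[of "H x"]] show ?thesis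
          by (simp add: mult_ac)
      qed
      then show "norm (indicator A x *\<^sub>R H x) \<le> norm (exp (R\<^sup>2 / 2) * norm (H x * complex_of_real (gauss x)))"
        by (auto simp: indicator_def norm_mult)
    qed
  qed measurable
qed

text \<open>The extension from truncations to all of \<open>H\<close>. Transforms of
  \<open>H\<close> cut off to balls differ by transforms of \<open>H\<close> on shells, which is why
  \<open>bound\<close> speaks of arbitrary bounded Borel sets; the tails of the integral of
  \<open>W\<close> then give the Cauchy rate. The multiplication formula passes to the limit and
  shows that \<open>F\<close> is the distributional transform.\<close>

lemma FT_dist_Lp:
  fixes H :: "'a::euclidean_space \<Rightarrow> complex" and W :: "'a \<Rightarrow> ennreal"
  assumes [measurable]: "H \<in> borel_measurable borel" "W \<in> borel_measurable borel"
    and H: "\<And>\<phi>. \<phi> \<in> schwartz \<Longrightarrow> integrable lborel (\<lambda>x. H x * \<phi> x)"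
    and \<sigma>: "\<bar>\<sigma>\<bar> = 1" and p: "1 \<le> p"
    and W: "(\<integral>\<^sup>+x. W x \<partial>lborel) < \<infinity>"
    and bound: "\<And>A. A \<in> sets borel \<Longrightarrow> bounded A \<Longrightarrow>
      (\<integral>\<^sup>+x. ennreal (norm (FT \<sigma> (\<lambda>\<xi>. indicator A \<xi> *\<^sub>R H \<xi>) x) powr p) \<partial>lborel) \<le>
      (\<integral>\<^sup>+\<xi>. indicator A \<xi> * W \<xi> \<partial>lborel)"
  obtains F where "F \<in> borel_measurable borel"
    "(\<integral>\<^sup>+x. ennreal (norm (F x) powr p) \<partial>lborel) \<le> (\<integral>\<^sup>+x. W x \<partial>lborel)"
    "\<And>\<phi>. \<phi> \<in> schwartz \<Longrightarrow> integrable lborel (\<lambda>x. F x * \<phi> x)"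
    "\<And>\<phi>. \<phi> \<in> schwartz \<Longrightarrow> (\<integral>x. F x * \<phi> x \<partial>lborel) = (\<integral>\<xi>. H \<xi> * FT \<sigma> \<phi> \<xi> \<partial>lborel)"
proof -
  have Hg: "integrable lborel (\<lambda>x. H x * complex_of_real (gauss x))"
    using H[OF mod_gauss_schwartz[of 0]] by (simp add: mod_gauss_0)
  let ?H = "\<lambda>n \<xi>. indicator (ball 0 (real n)) \<xi> *\<^sub>R H \<xi>"
  define F where "F n = FT \<sigma> (?H n)" for n
  define e where "e n = (\<integral>\<^sup>+\<xi>. indicator (- ball 0 (real n)) \<xi> * W \<xi> \<partial>lborel)" for n
  have Hn: "integrable lborel (?H n)" for n
    by (rule integrable_bounded_indicator[OF _ _ Hg]) auto
  have Fm [measurable]: "F n \<in> borel_measurable borel" for n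
    unfolding F_def using borel_measurable_integrable[OF Hn[of n]] by (intro measurable_FT) simp
  have F_le: "(\<integral>\<^sup>+x. ennreal (norm (F m x - F n x) powr p) \<partial>lborel) \<le> e n" if "n \<le> m" for n m
  proof -
    let ?A = "ball 0 (real m) - ball 0 (real n) :: 'a set"
    have "F m x - F n x = FT \<sigma> (\<lambda>\<xi>. indicator ?A \<xi> *\<^sub>R H \<xi>) x" for x
    proof -
      have "(\<lambda>\<xi>. indicator ?A \<xi> *\<^sub>R H \<xi>) = (\<lambda>\<xi>. ?H m \<xi> - ?H n \<xi>)"
        using that by (auto simp: indicator_def)
      then show ?thesis unfolding F_def by (simp only: FT_diff[OF Hn Hn])
    qed
    then have "(\<integral>\<^sup>+x. ennreal (norm (F m x - F n x) powr p) \<partial>lborel) =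
        (\<integral>\<^sup>+x. ennreal (norm (FT \<sigma> (\<lambda>\<xi>. indicator ?A \<xi> *\<^sub>R H \<xi>) x) powr p) \<partial>lborel)" by simp
    also have "\<dots> \<le> (\<integral>\<^sup>+\<xi>. indicator ?A \<xi> * W \<xi> \<partial>lborel)"
      by (rule bound) (auto intro: bounded_diff)
    also have "\<dots> \<le> e n"
      unfolding e_def by (intro nn_integral_mono mult_right_mono) (auto simp: indicator_def)
    finally show ?thesis .
  qed
  have e0: "e \<longlonglongrightarrow> 0"
  proof -
    have "e \<longlonglongrightarrow> (\<integral>\<^sup>+\<xi>. 0 \<partial>(lborel :: 'a measure))"
      unfolding e_def
    proof (rule nn_integral_dominated_convergence[where w = W])
      show "AE \<xi> in lborel. (\<lambda>n. indicator (- ball 0 (real n)) \<xi> * W \<xi>) \<longlonglongrightarrow> 0"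
      proof (intro AE_I2 tendsto_eventually)
        fix \<xi> :: 'a
        obtain N :: nat where "norm \<xi> < real N" using reals_Archimedean2 by blast
        then show "eventually (\<lambda>n. indicator (- ball 0 (real n)) \<xi> * W \<xi> = 0) sequentially"
          by (intro eventually_sequentiallyI[of N]) (auto simp: indicator_def)
      qed
    qed (use W in \<open>auto simp: indicator_def\<close>)
    then show ?thesis by simp
  qed
  obtain G where G [measurable]: "G \<in> borel_measurable lborel"
    and G_le: "\<And>n. (\<integral>\<^sup>+x. ennreal (norm (G x - F n x) powr p) \<partial>lborel) \<le> e n"
    using Lp_Cauchy_limit[of F lborel p e] p e0 F_le Fm by auto
  have e_fin: "e n < \<infinity>" for n
  proof -
    have "e n \<le> (\<integral>\<^sup>+x. W x \<partial>lborel)"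
      unfolding e_def by (intro nn_integral_mono) (auto simp: indicator_def)
    then show ?thesis using W by (rule order.strict_trans1)
  qed
  have G_powr: "integrable lborel (\<lambda>x. norm (G x - F n x) powr p)" for n
    using G_le[of n] e_fin[of n] by (intro integrableI_nonneg) (auto simp: order.strict_trans1)
  show thesis
  proof (rule that)
    show "G \<in> borel_measurable borel" using G by simp
    \<comment> \<open>The ball of radius 0 is empty, so the rate at n = 0 is already the norm bound
      for the limit.\<close>
    have "F 0 = (\<lambda>x. 0)" by (auto simp: F_def FT_def)
    then have "(\<integral>\<^sup>+x. ennreal (norm (G x) powr p) \<partial>lborel) \<le> e 0" using G_le[of 0] by simp
    also have "\<dots> = (\<integral>\<^sup>+x. W x \<partial>lborel)" by (simp add: e_def)
    finally show "(\<integral>\<^sup>+x. ennreal (norm (G x) powr p) \<partial>lborel) \<le> (\<integral>\<^sup>+x. W x \<partial>lborel)" .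
  next
    fix \<phi> :: "'a \<Rightarrow> complex" assume \<phi>: "\<phi> \<in> schwartz"
    note [measurable] = schwartz_measurable[OF \<phi>]
    have \<phi>i: "integrable lborel \<phi>" by (rule schwartz_integrable[OF \<phi>])
    obtain C where C: "C \<ge> 0" "\<And>x. norm (\<phi> x) \<le> C" using schwartz_bounded[OF \<phi>] by blast
    \<comment> \<open>The parameter \<delta> is fixed first, making the first term small in L^1; the
      second then tends to zero with n.\<close>
    have pw: "norm ((G x - F n x) * \<phi> x) \<le> \<delta> * norm (\<phi> x) + C * \<delta> powr (1 - p) * norm (G x - F n x) powr p"
      if "\<delta> > 0" for n x \<delta>
    proof -
      let ?a = "norm (G x - F n x)"
      have "?a * norm (\<phi> x) \<le> (\<delta> + \<delta> powr (1 - p) * ?a powr p) * norm (\<phi> x)"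
        by (intro mult_right_mono le_add_powr that p) auto
      also have "\<dots> = \<delta> * norm (\<phi> x) + \<delta> powr (1 - p) * ?a powr p * norm (\<phi> x)"
        by (simp add: distrib_right)
      also have "\<dots> \<le> \<delta> * norm (\<phi> x) + \<delta> powr (1 - p) * ?a powr p * C"
        by (intro add_left_mono mult_left_mono C) auto
      finally show ?thesis by (simp add: norm_mult mult_ac)
    qed
    have rhs_int: "integrable lborel (\<lambda>x. \<delta> * norm (\<phi> x) + C * \<delta> powr (1 - p) * norm (G x - F n x) powr p)" for n \<delta>
      by (intro Bochner_Integration.integrable_add integrable_mult_right integrable_norm \<phi>i G_powr)
    have diff_int: "integrable lborel (\<lambda>x. (G x - F n x) * \<phi> x)" for n
    proof (rule Bochner_Integration.integrable_bound[OF rhs_int[of 1 n]])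
      show "AE x in lborel. norm ((G x - F n x) * \<phi> x) \<le>
          norm (1 * norm (\<phi> x) + C * 1 powr (1 - p) * norm (G x - F n x) powr p)"
      proof (intro AE_I2)
        fix x
        let ?R = "1 * norm (\<phi> x) + C * 1 powr (1 - p) * norm (G x - F n x) powr p"
        have "norm ((G x - F n x) * \<phi> x) \<le> ?R" by (rule pw) simp
        also have "\<dots> \<le> norm ?R" unfolding real_norm_def by (rule abs_ge_self)
        finally show "norm ((G x - F n x) * \<phi> x) \<le> norm ?R" .
      qed
    qed measurable
    have F_int: "integrable lborel (\<lambda>x. F n x * \<phi> x)" for n
    proof (rule Bochner_Integration.integrable_bound)
      show "integrable lborel (\<lambda>x. complex_of_real (\<integral>x. norm (?H n x) \<partial>lborel) * \<phi> x)"
        by (intro integrable_mult_right \<phi>i)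
      show "AE x in lborel. norm (F n x * \<phi> x) \<le> norm (complex_of_real (\<integral>x. norm (?H n x) \<partial>lborel) * \<phi> x)"
        unfolding F_def norm_mult norm_of_real
        by (intro AE_I2 mult_right_mono order_trans[OF norm_FT_le abs_ge_self] norm_ge_zero)
    qed measurable
    show G_int: "integrable lborel (\<lambda>x. G x * \<phi> x)"
      using Bochner_Integration.integrable_add[OF diff_int[of 0] F_int[of 0]]
      by (simp add: algebra_simps)
    have lim1: "(\<lambda>n. \<integral>x. F n x * \<phi> x \<partial>lborel) \<longlonglongrightarrow> (\<integral>x. G x * \<phi> x \<partial>lborel)"
    proof (rule LIMSEQ_I)
      fix \<epsilon> :: real assume \<epsilon>: "0 < \<epsilon>"
      let ?J = "\<integral>x. norm (\<phi> x) \<partial>lborel"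
      have J: "0 \<le> ?J" by simp
      \<comment> \<open>The summand 1 avoids a division by zero when \<phi> vanishes almost
        everywhere.\<close>
      define \<delta> where "\<delta> = \<epsilon> / (2 * (?J + 1))"
      have aux: "0 < \<epsilon> / (2 * (j + 1))" "\<epsilon> / (2 * (j + 1)) * j < \<epsilon> / 2" if "0 \<le> j" for j
        using \<epsilon> that by (auto simp: field_simps)
      have \<delta>: "\<delta> > 0" unfolding \<delta>_def by (rule aux(1)[OF J])
      have \<delta>J: "\<delta> * ?J < \<epsilon> / 2"
        unfolding \<delta>_def by (rule aux(2)[OF J])
      define K where "K = C * \<delta> powr (1 - p)"
      have K: "K \<ge> 0" using C(1) by (simp add: K_def)
      have "(\<lambda>n. ennreal K * e n) \<longlonglongrightarrow> ennreal K * 0"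
        by (intro ennreal_tendsto_cmult e0) simp
      then have "eventually (\<lambda>n. ennreal K * e n < ennreal (\<epsilon> / 2)) sequentially"
        using \<epsilon> by (intro order_tendstoD(2)[where y = 0]) auto
      then obtain N where N: "\<And>n. n \<ge> N \<Longrightarrow> ennreal K * e n < ennreal (\<epsilon> / 2)"
        by (auto simp: eventually_sequentially)
      show "\<exists>no. \<forall>n\<ge>no. norm ((\<integral>x. F n x * \<phi> x \<partial>lborel) - (\<integral>x. G x * \<phi> x \<partial>lborel)) < \<epsilon>"
      proof (intro exI allI impI)
        fix n assume n: "n \<ge> N"
        have "ennreal (K * (\<integral>x. norm (G x - F n x) powr p \<partial>lborel)) =
            ennreal K * (\<integral>\<^sup>+x. ennreal (norm (G x - F n x) powr p) \<partial>lborel)"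
          by (subst nn_integral_eq_integral[OF G_powr]) (auto simp: ennreal_mult K)
        also have "\<dots> \<le> ennreal K * e n" by (intro mult_left_mono G_le) simp
        also have "\<dots> < ennreal (\<epsilon> / 2)" by (rule N[OF n])
        finally have Kn: "K * (\<integral>x. norm (G x - F n x) powr p \<partial>lborel) < \<epsilon> / 2"
          using \<epsilon> by (simp add: ennreal_less_iff K)
        have "norm ((\<integral>x. F n x * \<phi> x \<partial>lborel) - (\<integral>x. G x * \<phi> x \<partial>lborel)) =
            norm (\<integral>x. (G x - F n x) * \<phi> x \<partial>lborel)"
          by (subst norm_minus_commute) (simp add: left_diff_distrib G_int F_int)
        also have "\<dots> \<le> (\<integral>x. norm ((G x - F n x) * \<phi> x) \<partial>lborel)" by (rule integral_norm_bound)
        also have "\<dots> \<le> (\<integral>x. \<delta> * norm (\<phi> x) + C * \<delta> powr (1 - p) * norm (G x - F n x) powr p \<partial>lborel)"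
          by (intro integral_mono integrable_norm diff_int rhs_int pw \<delta>)
        also have "\<dots> = \<delta> * ?J + K * (\<integral>x. norm (G x - F n x) powr p \<partial>lborel)"
          unfolding K_def
          by (subst Bochner_Integration.integral_add)
             (auto intro!: integrable_mult_right integrable_norm \<phi>i G_powr)
        also have "\<dots> < \<epsilon>" using \<delta>J Kn by simp
        finally show "norm ((\<integral>x. F n x * \<phi> x \<partial>lborel) - (\<integral>x. G x * \<phi> x \<partial>lborel)) < \<epsilon>" .
      qed
    qed
    have FTs: "FT \<sigma> \<phi> \<in> schwartz" by (rule FT_schwartz[OF \<phi> \<sigma>])
    note [measurable] = schwartz_measurable[OF FTs]
    have lim2: "(\<lambda>n. \<integral>\<xi>. ?H n \<xi> * FT \<sigma> \<phi> \<xi> \<partial>lborel) \<longlonglongrightarrow> (\<integral>\<xi>. H \<xi> * FT \<sigma> \<phi> \<xi> \<partial>lborel)"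
    proof (rule integral_dominated_convergence)
      show "integrable lborel (\<lambda>\<xi>. norm (H \<xi> * FT \<sigma> \<phi> \<xi>))" by (intro integrable_norm H FTs)
      show "AE \<xi> in lborel. (\<lambda>n. ?H n \<xi> * FT \<sigma> \<phi> \<xi>) \<longlonglongrightarrow> H \<xi> * FT \<sigma> \<phi> \<xi>"
      proof (intro AE_I2 tendsto_eventually)
        fix \<xi> :: 'a
        obtain N :: nat where "norm \<xi> < real N" using reals_Archimedean2 by blast
        then show "eventually (\<lambda>n. ?H n \<xi> * FT \<sigma> \<phi> \<xi> = H \<xi> * FT \<sigma> \<phi> \<xi>) sequentially"
          by (intro eventually_sequentiallyI[of N]) (auto simp: indicator_def)
      qed
      show "AE \<xi> in lborel. norm (?H n \<xi> * FT \<sigma> \<phi> \<xi>) \<le> norm (H \<xi> * FT \<sigma> \<phi> \<xi>)" for n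
        by (intro AE_I2) (auto simp: indicator_def)
      show "(\<lambda>\<xi>. H \<xi> * FT \<sigma> \<phi> \<xi>) \<in> borel_measurable lborel" by simp
      show "(\<lambda>\<xi>. ?H n \<xi> * FT \<sigma> \<phi> \<xi>) \<in> borel_measurable lborel" for n
        by (intro borel_measurable_times borel_measurable_integrable[OF Hn]) simp
    qed
    have "(\<integral>x. F n x * \<phi> x \<partial>lborel) = (\<integral>\<xi>. ?H n \<xi> * FT \<sigma> \<phi> \<xi> \<partial>lborel)" for n
      unfolding F_def by (rule FT_multiplication_formula[OF Hn \<phi>i])
    then show "(\<integral>x. G x * \<phi> x \<partial>lborel) = (\<integral>\<xi>. H \<xi> * FT \<sigma> \<phi> \<xi> \<partial>lborel)"
      using lim1 lim2 LIMSEQ_unique by simp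
  qed
qed

section \<open>The level set estimate\<close>

text \<open>A surrounding cube of side 2R is enough, as only the order R^d matters for the
  estimate.\<close>

lemma emeasure_lborel_cball_le:
  assumes "0 \<le> R"
  shows "emeasure lborel (cball (0::'a::euclidean_space) R) \<le> ennreal ((2 * R) ^ DIM('a))"
proof -
  have "cball (0::'a) R \<subseteq> cbox (- R *\<^sub>R One) (R *\<^sub>R One)"
  proof
    fix x :: 'a assume "x \<in> cball 0 R"
    then have "\<bar>x \<bullet> b\<bar> \<le> R" if "b \<in> Basis" for b
      using Basis_le_norm[OF that, of x] by simp
    then show "x \<in> cbox (- R *\<^sub>R One) (R *\<^sub>R One)"
      by (auto simp: mem_box abs_le_iff minus_le_iff)
  qed
  then have "emeasure lborel (cball (0::'a) R) \<le> emeasure lborel (cbox (- R *\<^sub>R One) (R *\<^sub>R One :: 'a))"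
    by (rule emeasure_mono) simp
  also have "\<dots> = ennreal (\<Prod>b\<in>(Basis :: 'a set). (R *\<^sub>R One - - R *\<^sub>R One) \<bullet> b)"
    by (rule emeasure_lborel_cbox) (use assms in simp)
  also have "(\<Prod>b\<in>(Basis :: 'a set). (R *\<^sub>R One - - R *\<^sub>R One) \<bullet> b) = (2 * R) ^ DIM('a)"
  proof -
    have "(R *\<^sub>R One - - R *\<^sub>R One) \<bullet> b = 2 * R" if "b \<in> Basis" for b :: 'a
      using that by (simp add: inner_diff_left inner_add_left)
    then show ?thesis by simp
  qed
  finally show ?thesis .
qed

text \<open>The inner integral of the layer-cake formula; q > 0 makes the power integrable at
  0.\<close>

lemma nn_integral_powr_Icc:
  assumes "0 < q" "0 \<le> y"
  shows "(\<integral>\<^sup>+lam. ennreal (indicator {0..y} lam * lam powr (q - 1)) \<partial>lborel) = ennreal (y powr q / q)"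
proof -
  have "((\<lambda>x. x powr (q - 1)) has_integral (y powr (q - 1 + 1) / (q - 1 + 1))) {0..y}"
    using assms by (intro has_integral_powr_from_0) auto
  from nn_integral_has_integral_lebesgue[OF _ this] show ?thesis by simp
qed

text \<open>Provides joint measurability in the level and the point, for interchanging the two
  integrals of the layer-cake formula.\<close>

lemma measurable_indicator_Icc [measurable]:
  fixes f g :: "'a \<Rightarrow> real"
  assumes [measurable]: "f \<in> borel_measurable M" "g \<in> borel_measurable M"
  shows "(\<lambda>z. indicator {0..f z} (g z) :: real) \<in> borel_measurable M"
proof -
  have "(\<lambda>z. indicator {0..f z} (g z) :: real) = (\<lambda>z. if 0 \<le> g z \<and> g z \<le> f z then 1 else 0)"
    by (auto simp: indicator_def)
  then show ?thesis by simp
qed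

lemma powr_square: "(x powr a)\<^sup>2 = x powr (2 * a)" for x a :: real
  by (simp only: power2_eq_square powr_add[symmetric] mult_2)

definition annulus :: "int \<Rightarrow> 'a::euclidean_space set" where
  "annulus k = {\<xi>. 2 powi k \<le> norm \<xi> \<and> norm \<xi> \<le> 2 powi (k + 1)}"

lemma measurable_annulus [measurable]: "annulus k \<in> sets borel"
proof -
  have "annulus k = cball 0 (2 powi (k + 1)) - (ball 0 (2 powi k) :: 'a set)"
    by (auto simp: annulus_def)
  then show ?thesis by simp
qed

lemma powi_2_eq_powr: "2 powi k = (2::real) powr real_of_int k"
  by (simp add: powr_real_of_int')

section \<open>Low frequencies in L^1 and the measure of a level set\<close>

context
  fixes s \<theta> B :: real and H :: "'a::euclidean_space \<Rightarrow> complex"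
  assumes s: "0 < s" "2 * s < real DIM('a)" and \<theta>_def: "\<theta> = real DIM('a) / 2 - s" and B: "0 < B"
    and H [measurable]: "H \<in> borel_measurable borel"
    and dyadic: "\<And>k. (\<integral>\<^sup>+\<xi>. indicator (annulus k) \<xi> * ennreal ((norm \<xi> powr s * norm (H \<xi>))\<^sup>2) \<partial>lborel) \<le> ennreal (B\<^sup>2)"
begin

text \<open>Cauchy-Schwarz in additive form: n <= t/2 + n^2/(2t) with t constant on the annulus. The
  annulus lies in a cube of side 4q, hence the 4^d in the constant.\<close>

lemma annulus_L1_le:
  "(\<integral>\<^sup>+\<xi>. indicator (annulus k) \<xi> * ennreal (norm (H \<xi>)) \<partial>lborel) \<le>
    ennreal ((4 ^ DIM('a) + 1) / 2 * B * 2 powr (real_of_int k * \<theta>))"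
proof -
  define q where "q = (2::real) powr real_of_int k"
  have q: "q > 0" by (simp add: q_def)
  \<comment> \<open>This choice balances the two terms: t q^d and B^2 q^(-2s)/t both become B
    q^\<theta>.\<close>
  define t where "t = B * q powr (- s - DIM('a) / 2)"
  have t: "t > 0" using B q by (simp add: t_def)
  have norm_ge: "q \<le> norm \<xi>" and norm_le: "norm \<xi> \<le> 2 * q" if "\<xi> \<in> annulus k" for \<xi> :: 'a
    using that by (auto simp: annulus_def powi_2_eq_powr q_def powr_add)
  have pw: "indicator (annulus k) \<xi> * ennreal (norm (H \<xi>)) \<le>
      ennreal (t / 2) * indicator (annulus k) \<xi> +
      ennreal (q powr (- 2 * s) / (2 * t)) * (indicator (annulus k) \<xi> * ennreal ((norm \<xi> powr s * norm (H \<xi>))\<^sup>2))" for \<xi>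
  proof (cases "\<xi> \<in> annulus k")
    case True
    let ?n = "norm (H \<xi>)"
    have "2 * t * ?n \<le> t\<^sup>2 + ?n\<^sup>2"
      using sum_squares_bound[of t ?n] by simp
    then have 1: "?n \<le> t / 2 + ?n\<^sup>2 / (2 * t)"
      using t by (simp add: field_simps power2_eq_square)
    have "q powr (2 * s) \<le> norm \<xi> powr (2 * s)"
      using norm_ge[OF True] q s by (intro powr_mono2) auto
    then have "1 \<le> q powr (- 2 * s) * norm \<xi> powr (2 * s)"
      using q by (simp add: powr_minus field_simps)
    from mult_right_mono[OF this, of "?n\<^sup>2 / (2 * t)"]
    have "?n\<^sup>2 / (2 * t) \<le> q powr (- 2 * s) / (2 * t) * (norm \<xi> powr s * ?n)\<^sup>2"
      using t by (simp add: power_mult_distrib powr_square mult_ac)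
    with 1 have "?n \<le> t / 2 + q powr (- 2 * s) / (2 * t) * (norm \<xi> powr s * ?n)\<^sup>2"
      by linarith
    then have "ennreal ?n \<le> ennreal (t / 2 + q powr (- 2 * s) / (2 * t) * (norm \<xi> powr s * ?n)\<^sup>2)"
      by (rule ennreal_leI)
    also have "\<dots> = ennreal (t / 2) + ennreal (q powr (- 2 * s) / (2 * t) * (norm \<xi> powr s * ?n)\<^sup>2)"
      using t by (intro ennreal_plus) auto
    also have "ennreal (q powr (- 2 * s) / (2 * t) * (norm \<xi> powr s * ?n)\<^sup>2) =
        ennreal (q powr (- 2 * s) / (2 * t)) * ennreal ((norm \<xi> powr s * ?n)\<^sup>2)"
      using t by (intro ennreal_mult) auto
    finally show ?thesis using True by simp
  qed simp
  have "emeasure lborel (annulus k :: 'a set) \<le> emeasure lborel (cball (0::'a) (2 * q))"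
    by (intro emeasure_mono) (auto dest: norm_le)
  also have "\<dots> \<le> ennreal ((2 * (2 * q)) ^ DIM('a))"
    using q by (intro emeasure_lborel_cball_le) simp
  finally have vol: "emeasure lborel (annulus k :: 'a set) \<le> ennreal ((4 * q) ^ DIM('a))" by simp
  have "(\<integral>\<^sup>+\<xi>. indicator (annulus k) \<xi> * ennreal (norm (H \<xi>)) \<partial>lborel) \<le>
      (\<integral>\<^sup>+\<xi>. ennreal (t / 2) * indicator (annulus k) \<xi> +
      ennreal (q powr (- 2 * s) / (2 * t)) * (indicator (annulus k) \<xi> * ennreal ((norm \<xi> powr s * norm (H \<xi>))\<^sup>2)) \<partial>lborel)"
    by (intro nn_integral_mono pw)
  also have "\<dots> = ennreal (t / 2) * emeasure lborel (annulus k :: 'a set) +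
      ennreal (q powr (- 2 * s) / (2 * t)) *
        (\<integral>\<^sup>+\<xi>. indicator (annulus k) \<xi> * ennreal ((norm \<xi> powr s * norm (H \<xi>))\<^sup>2) \<partial>lborel)"
    by (subst nn_integral_add) (auto simp: nn_integral_cmult)
  also have "\<dots> \<le> ennreal (t / 2) * ennreal ((4 * q) ^ DIM('a)) + ennreal (q powr (- 2 * s) / (2 * t)) * ennreal (B\<^sup>2)"
    by (intro add_mono mult_left_mono vol dyadic) auto
  also have "\<dots> = ennreal (t / 2 * (4 * q) ^ DIM('a) + q powr (- 2 * s) / (2 * t) * B\<^sup>2)"
  proof -
    have 1: "ennreal (t / 2) * ennreal ((4 * q) ^ DIM('a)) = ennreal (t / 2 * (4 * q) ^ DIM('a))"
      using t q by (intro ennreal_mult[symmetric]) auto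
    have 2: "ennreal (q powr (- 2 * s) / (2 * t)) * ennreal (B\<^sup>2) = ennreal (q powr (- 2 * s) / (2 * t) * B\<^sup>2)"
      using t by (intro ennreal_mult[symmetric]) auto
    show ?thesis
      unfolding 1 2 using t q by (intro ennreal_plus[symmetric]) auto
  qed
  also have "t / 2 * (4 * q) ^ DIM('a) + q powr (- 2 * s) / (2 * t) * B\<^sup>2 = (4 ^ DIM('a) + 1) / 2 * B * q powr \<theta>"
  proof -
    have "q ^ DIM('a) = q powr DIM('a)" using q by (simp add: powr_realpow)
    then have "t / 2 * (4 * q) ^ DIM('a) = 4 ^ DIM('a) / 2 * B * (q powr (- s - DIM('a) / 2) * q powr DIM('a))"
      by (simp add: t_def power_mult_distrib)
    also have "q powr (- s - DIM('a) / 2) * q powr DIM('a) = q powr \<theta>"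
      by (simp flip: powr_add add: algebra_simps \<theta>_def)
    finally have 1: "t / 2 * (4 * q) ^ DIM('a) = 4 ^ DIM('a) / 2 * B * q powr \<theta>" .
    have "q powr (- 2 * s) / (2 * t) * B\<^sup>2 = 1 / 2 * B * (q powr (- 2 * s) / q powr (- s - DIM('a) / 2))"
      using B q by (simp add: t_def power2_eq_square)
    also have "q powr (- 2 * s) / q powr (- s - DIM('a) / 2) = q powr \<theta>"
      by (simp flip: powr_diff add: \<theta>_def)
    finally have 2: "q powr (- 2 * s) / (2 * t) * B\<^sup>2 = 1 / 2 * B * q powr \<theta>" .
    show ?thesis unfolding 1 2 by (simp add: algebra_simps add_divide_distrib)
  qed
  finally show ?thesis by (simp add: q_def powr_powr)
qed

text \<open>The annuli below 2^K give a geometric series of ratio 2^(-\<theta>), which converges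
  because 2s < d. Neighbouring annuli share a sphere, which is harmless for an upper bound.\<close>

lemma ball_L1_le:
  "(\<integral>\<^sup>+\<xi>. indicator {\<xi>. norm \<xi> < 2 powr real_of_int K} \<xi> * ennreal (norm (H \<xi>)) \<partial>lborel) \<le>
    ennreal ((4 ^ DIM('a) + 1) / 2 / (2 powr \<theta> - 1) * B * 2 powr (real_of_int K * \<theta>))"
proof -
  have \<theta>: "\<theta> > 0" using s by (simp add: \<theta>_def)
  then have p1: "2 powr \<theta> > 1" using powr_less_mono[of 0 \<theta> 2] by simp
  let ?c = "(4 ^ DIM('a) + 1) / 2 * B"
  let ?A = "\<lambda>j::nat. annulus (K - 1 - int j) :: 'a set"
  have "(\<integral>\<^sup>+\<xi>. indicator {\<xi>. norm \<xi> < 2 powr real_of_int K} \<xi> * ennreal (norm (H \<xi>)) \<partial>lborel) \<le>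
      (\<integral>\<^sup>+\<xi>. (\<Sum>j. indicator (?A j) \<xi> * ennreal (norm (H \<xi>))) \<partial>lborel)"
  \<comment> \<open>The origin lies in no annulus and is discarded as a null set.\<close>
  proof (rule nn_integral_mono_AE, rule AE_mp[OF AE_lborel_singleton[of 0]], intro AE_I2 impI)
    fix \<xi> :: 'a assume \<xi>0: "\<xi> \<noteq> 0"
    show "indicator {\<xi>. norm \<xi> < 2 powr real_of_int K} \<xi> * ennreal (norm (H \<xi>)) \<le>
        (\<Sum>j. indicator (?A j) \<xi> * ennreal (norm (H \<xi>)))"
    proof (cases "norm \<xi> < 2 powr real_of_int K")
      case True
      define k where "k = \<lfloor>log 2 (norm \<xi>)\<rfloor>"
      have k: "real_of_int k \<le> log 2 (norm \<xi>)" "log 2 (norm \<xi>) < real_of_int k + 1"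
        unfolding k_def by linarith+
      have n: "norm \<xi> = 2 powr (log 2 (norm \<xi>))" using \<xi>0 by simp
      have "log 2 (norm \<xi>) < real_of_int K"
        using True \<xi>0 by (simp add: log_less_iff)
      then have "k < K" using k by linarith
      then have kj: "K - 1 - int (nat (K - 1 - k)) = k" by simp
      have "2 powr real_of_int k \<le> norm \<xi>" "norm \<xi> \<le> 2 powr (real_of_int k + 1)"
        using k by (subst n, simp)+
      then have "\<xi> \<in> ?A (nat (K - 1 - k))"
        unfolding kj annulus_def powi_2_eq_powr by simp
      then have "indicator {\<xi>. norm \<xi> < 2 powr real_of_int K} \<xi> * ennreal (norm (H \<xi>)) =
          (\<Sum>j\<in>{nat (K - 1 - k)}. indicator (?A j) \<xi> * ennreal (norm (H \<xi>)))"
        using True by simp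
      also have "\<dots> \<le> (\<Sum>j. indicator (?A j) \<xi> * ennreal (norm (H \<xi>)))"
        by (intro sum_le_suminf) auto
      finally show ?thesis .
    qed simp
  qed
  also have "\<dots> = (\<Sum>j. \<integral>\<^sup>+\<xi>. indicator (?A j) \<xi> * ennreal (norm (H \<xi>)) \<partial>lborel)"
    by (rule nn_integral_suminf) measurable
  also have "\<dots> \<le> (\<Sum>j. ennreal (?c * 2 powr (real_of_int (K - 1 - int j) * \<theta>)))"
    by (intro suminf_le annulus_L1_le summableI)
  also have "\<dots> = ennreal (?c * 2 powr (real_of_int K * \<theta>) / (2 powr \<theta> - 1))"
  proof (rule suminf_ennreal_eq)
    have 1: "(\<lambda>j. (?c * 2 powr (real_of_int (K - 1) * \<theta>)) * (2 powr (- \<theta>)) ^ j) sums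
        ((?c * 2 powr (real_of_int (K - 1) * \<theta>)) * (1 / (1 - 2 powr (- \<theta>))))"
      using \<theta> powr_less_mono[of "- \<theta>" 0 2] by (intro sums_mult geometric_sums) simp
    have 2: "(?c * 2 powr (real_of_int (K - 1) * \<theta>)) * (2 powr (- \<theta>)) ^ j =
        ?c * 2 powr (real_of_int (K - 1 - int j) * \<theta>)" for j
    proof -
      have "2 powr (real_of_int (K - 1) * \<theta>) * (2 powr (- \<theta>)) ^ j = 2 powr (real_of_int (K - 1 - int j) * \<theta>)"
        by (simp only: powr_power powr_add[symmetric]) (simp add: algebra_simps)
      then show ?thesis by simp
    qed
    have 3: "(?c * 2 powr (real_of_int (K - 1) * \<theta>)) * (1 / (1 - 2 powr (- \<theta>))) =
        ?c * 2 powr (real_of_int K * \<theta>) / (2 powr \<theta> - 1)"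
    proof -
      have "2 powr (real_of_int (K - 1) * \<theta>) = 2 powr (real_of_int K * \<theta>) / 2 powr \<theta>"
        by (simp only: powr_diff[symmetric]) (simp add: algebra_simps)
      moreover have "2 powr \<theta> * (1 - 2 powr (- \<theta>)) = 2 powr \<theta> - 1"
        by (simp add: powr_minus field_simps)
      ultimately show ?thesis by (simp add: divide_divide_eq_left mult_ac)
    qed
    from 1 show "(\<lambda>j. ?c * 2 powr (real_of_int (K - 1 - int j) * \<theta>)) sums
        (?c * 2 powr (real_of_int K * \<theta>) / (2 powr \<theta> - 1))"
      unfolding 2 3 .
  qed (use B in auto)
  finally show ?thesis by (simp add: mult_ac)
qed

lemma FT_level_set_le:
  assumes Hi: "integrable lborel H" and \<sigma>: "\<bar>\<sigma>\<bar> = 1" and lam: "0 < lam"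
  defines "M \<equiv> (4 ^ DIM('a) + 1) / 2 / (2 powr \<theta> - 1)"
  shows "emeasure lborel {x. lam \<le> norm (FT \<sigma> H x)} \<le>
    ennreal (4 * (2 * pi) ^ DIM('a) / lam\<^sup>2) *
      (\<integral>\<^sup>+\<xi>. indicator {\<xi>. lam \<le> 2 * 2 powr \<theta> * M * B * norm \<xi> powr \<theta>} \<xi> * ennreal ((norm (H \<xi>))\<^sup>2) \<partial>lborel)"
proof -
  have \<theta>: "\<theta> > 0" using s by (simp add: \<theta>_def)
  then have p1: "2 powr \<theta> > 1" using powr_less_mono[of 0 \<theta> 2] by simp
  then have M: "M > 0" unfolding M_def by (intro divide_pos_pos) (auto intro: add_pos_pos)
  \<comment> \<open>\<open>K\<close> is the largest integer with M B 2^(K \<theta>) <= lam/2, so the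
    low-frequency part never exceeds lam/2. Maximality gives the opposite bound at K + 1, and this
    rounding is the source of the factor 2^\<theta> in the set over which |H|^2 is
    integrated.\<close>
  define K where "K = \<lfloor>log 2 (lam / (2 * M * B)) / \<theta>\<rfloor>"
  have K: "real_of_int K * \<theta> \<le> log 2 (lam / (2 * M * B))" "log 2 (lam / (2 * M * B)) < (real_of_int K + 1) * \<theta>"
  proof -
    have "real_of_int K \<le> log 2 (lam / (2 * M * B)) / \<theta>" "log 2 (lam / (2 * M * B)) / \<theta> < real_of_int K + 1"
      unfolding K_def by linarith+
    then show "real_of_int K * \<theta> \<le> log 2 (lam / (2 * M * B))" "log 2 (lam / (2 * M * B)) < (real_of_int K + 1) * \<theta>"
      by (simp_all only: pos_le_divide_eq[OF \<theta>] pos_divide_less_eq[OF \<theta>])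
  qed
  have pos: "lam / (2 * M * B) > 0" using M B lam by simp
  then have "2 powr (real_of_int K * \<theta>) \<le> lam / (2 * M * B)" "lam / (2 * M * B) < 2 powr ((real_of_int K + 1) * \<theta>)"
    using K by (simp_all add: le_log_iff log_less_iff)
  then have K': "M * B * 2 powr (real_of_int K * \<theta>) \<le> lam / 2" "lam < 2 * M * B * 2 powr ((real_of_int K + 1) * \<theta>)"
    using M B by (simp_all add: field_simps)
  let ?S = "{\<xi>::'a. norm \<xi> < 2 powr real_of_int K}"
  let ?l = "\<lambda>\<xi>. indicator ?S \<xi> *\<^sub>R H \<xi>" and ?h = "\<lambda>\<xi>. indicator (- ?S) \<xi> *\<^sub>R H \<xi>"
  have S [measurable]: "?S \<in> sets borel" by measurable
  have li: "integrable lborel ?l" and hi: "integrable lborel ?h"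
    using S by (auto intro!: integrable_mult_indicator Hi)
  have sum: "FT \<sigma> H x = FT \<sigma> ?l x + FT \<sigma> ?h x" for x
  proof -
    have eq: "(\<lambda>\<xi>. ?l \<xi> + ?h \<xi>) = H" by (auto simp: indicator_def)
    show ?thesis using FT_add[OF li hi, of \<sigma> x] unfolding eq .
  qed
  have l: "norm (FT \<sigma> ?l x) \<le> lam / 2" for x
  proof -
    have "ennreal (norm (FT \<sigma> ?l x)) \<le> (\<integral>\<^sup>+\<xi>. ennreal (norm (?l \<xi>)) \<partial>lborel)"
      unfolding FT_def by (rule order_trans[OF norm_integral_le_nn_integral]) (simp add: norm_mult)
    also have "\<dots> = (\<integral>\<^sup>+\<xi>. indicator ?S \<xi> * ennreal (norm (H \<xi>)) \<partial>lborel)"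
      by (intro nn_integral_cong) (simp add: indicator_def)
    also have "\<dots> \<le> ennreal (M * B * 2 powr (real_of_int K * \<theta>))"
      unfolding M_def by (rule ball_L1_le)
    also have "\<dots> \<le> ennreal (lam / 2)" using K' by (intro ennreal_leI)
    finally show ?thesis using lam by simp
  qed
  have [measurable]: "FT \<sigma> ?h \<in> borel_measurable borel"
    using hi by (intro measurable_FT) auto
  have "emeasure lborel {x. lam \<le> norm (FT \<sigma> H x)} \<le> emeasure lborel {x. lam / 2 \<le> norm (FT \<sigma> ?h x)}"
  proof (intro emeasure_mono subsetI CollectI)
    fix x assume "x \<in> {x. lam \<le> norm (FT \<sigma> H x)}"
    then have "lam \<le> norm (FT \<sigma> ?l x) + norm (FT \<sigma> ?h x)"
      unfolding sum using norm_triangle_ineq order_trans by blast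
    with l[of x] show "lam / 2 \<le> norm (FT \<sigma> ?h x)" by linarith
  qed simp
  also have "\<dots> = (\<integral>\<^sup>+x. indicator {x. lam / 2 \<le> norm (FT \<sigma> ?h x)} x \<partial>lborel)" by simp
  also have "\<dots> \<le> (\<integral>\<^sup>+x. ennreal (4 / lam\<^sup>2) * ennreal ((norm (FT \<sigma> ?h x))\<^sup>2) \<partial>lborel)"
  proof (intro nn_integral_mono)
    fix x
    have "1 \<le> 4 / lam\<^sup>2 * (norm (FT \<sigma> ?h x))\<^sup>2" if "lam / 2 \<le> norm (FT \<sigma> ?h x)"
    proof -
      have "(lam / 2)\<^sup>2 \<le> (norm (FT \<sigma> ?h x))\<^sup>2" using that lam by (intro power_mono) auto
      then show ?thesis using lam by (simp add: field_simps power2_eq_square)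
    qed
    then show "indicator {x. lam / 2 \<le> norm (FT \<sigma> ?h x)} x \<le> ennreal (4 / lam\<^sup>2) * ennreal ((norm (FT \<sigma> ?h x))\<^sup>2)"
      by (auto simp: indicator_def ennreal_mult'[symmetric])
  qed
  also have "\<dots> = ennreal (4 / lam\<^sup>2) * (\<integral>\<^sup>+x. ennreal ((norm (FT \<sigma> ?h x))\<^sup>2) \<partial>lborel)"
    by (rule nn_integral_cmult) simp
  also have "\<dots> \<le> ennreal (4 / lam\<^sup>2) * (ennreal ((2 * pi) ^ DIM('a)) * (\<integral>\<^sup>+\<xi>. ennreal ((norm (?h \<xi>))\<^sup>2) \<partial>lborel))"
    by (intro mult_left_mono nn_integral_FT_square_le hi \<sigma>) simp
  also have "\<dots> = ennreal (4 * (2 * pi) ^ DIM('a) / lam\<^sup>2) * (\<integral>\<^sup>+\<xi>. ennreal ((norm (?h \<xi>))\<^sup>2) \<partial>lborel)"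
    by (simp add: mult.assoc[symmetric] ennreal_mult'[symmetric])
  also have "\<dots> \<le> ennreal (4 * (2 * pi) ^ DIM('a) / lam\<^sup>2) *
      (\<integral>\<^sup>+\<xi>. indicator {\<xi>. lam \<le> 2 * 2 powr \<theta> * M * B * norm \<xi> powr \<theta>} \<xi> * ennreal ((norm (H \<xi>))\<^sup>2) \<partial>lborel)"
  proof (intro mult_left_mono nn_integral_mono)
    fix \<xi>
    have "lam \<le> 2 * 2 powr \<theta> * M * B * norm \<xi> powr \<theta>" if "\<xi> \<notin> ?S"
    proof -
      have "(2 powr real_of_int K) powr \<theta> \<le> norm \<xi> powr \<theta>"
        using that \<theta> by (intro powr_mono2) auto
      then have "2 * 2 powr \<theta> * M * B * 2 powr (real_of_int K * \<theta>) \<le> 2 * 2 powr \<theta> * M * B * norm \<xi> powr \<theta>"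
        using M B by (intro mult_left_mono) (auto simp: powr_powr)
      moreover have "2 powr ((real_of_int K + 1) * \<theta>) = 2 powr (real_of_int K * \<theta>) * 2 powr \<theta>"
        by (simp only: powr_add[symmetric] distrib_right mult_1)
      ultimately show ?thesis using K'(2) by (simp add: mult_ac)
    qed
    then show "ennreal ((norm (?h \<xi>))\<^sup>2) \<le>
      indicator {\<xi>. lam \<le> 2 * 2 powr \<theta> * M * B * norm \<xi> powr \<theta>} \<xi> * ennreal ((norm (H \<xi>))\<^sup>2)"
      by (auto simp: indicator_def)
  qed simp
  finally show ?thesis .
qed

end

text \<open>The constant is chosen before \<open>B\<close>, the sign and \<open>H\<close>, so that
  all truncations of one function obey the estimate with the same \<open>B\<close>.\<close>

lemma nn_integral_FT_powr_le:
  fixes s r :: real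
  assumes s: "0 < s" "1 < r" "1 / r + s / real DIM('a::euclidean_space) = 1 / 2"
  shows "\<exists>C>0. \<forall>B>0. \<forall>\<sigma>. \<forall>H :: 'a \<Rightarrow> complex. \<bar>\<sigma>\<bar> = 1 \<longrightarrow> integrable lborel H \<longrightarrow>
    (\<forall>k. (\<integral>\<^sup>+\<xi>. indicator (annulus k) \<xi> * ennreal ((norm \<xi> powr s * norm (H \<xi>))\<^sup>2) \<partial>lborel) \<le> ennreal (B\<^sup>2)) \<longrightarrow>
    (\<integral>\<^sup>+x. ennreal (norm (FT \<sigma> H x) powr r) \<partial>lborel) \<le>
      ennreal (C * B powr (r - 2)) * (\<integral>\<^sup>+\<xi>. ennreal ((norm \<xi> powr s * norm (H \<xi>))\<^sup>2) \<partial>lborel)"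
proof -
  define \<theta> where "\<theta> = real DIM('a) / 2 - s"
  define M where "M = (4 ^ DIM('a) + 1) / 2 / (2 powr \<theta> - 1)"
  define c where "c = 2 * 2 powr \<theta> * M"
  have d: "real DIM('a) > 0" by simp
  have \<theta>r: "\<theta> = real DIM('a) / r"
  proof -
    have "1 / r = 1 / 2 - s / real DIM('a)" using s(3) by linarith
    then have "real DIM('a) * (1 / r) = real DIM('a) * (1 / 2 - s / real DIM('a))" by (simp only:)
    then show ?thesis using d by (simp add: \<theta>_def right_diff_distrib)
  qed
  have \<theta>: "\<theta> > 0" unfolding \<theta>r using s by simp
  \<comment> \<open>Here s > 0 is decisive: after division by lam^2 the remaining power lam^(r-3)
    has to be integrable at 0.\<close>
  have r: "r > 2"
  proof -
    have "s / real DIM('a) > 0" using s by simp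
    then have "1 / r < 1 / 2" using s(3) by linarith
    then show ?thesis using s(2) by (simp add: field_simps)
  qed
  \<comment> \<open>This identity turns the weight |\<xi>|^(\<theta>(r-2)) into the square of
    |\<xi>|^s.\<close>
  have \<theta>2: "\<theta> * (r - 2) = 2 * s"
  proof -
    have "\<theta> * (r - 2) = real DIM('a) - 2 * \<theta>" using s(2) unfolding \<theta>r by (simp add: field_simps)
    then show ?thesis by (simp add: \<theta>_def)
  qed
  have s2: "2 * s < real DIM('a)" using \<theta> by (simp add: \<theta>_def)
  have "2 powr \<theta> > 1" using \<theta> powr_less_mono[of 0 \<theta> 2] by simp
  then have "M > 0" unfolding M_def by (intro divide_pos_pos) (auto intro: add_pos_pos)
  then have c: "c > 0" by (simp add: c_def)
  \<comment> \<open>The factor r comes from the layer-cake formula, 4 (2 pi)^d from the level set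
    estimate, and c^(r-2)/(r-2) from integrating lam^(r-3) up to c B |\<xi>|^\<theta>.\<close>
  define C where "C = r * (4 * (2 * pi) ^ DIM('a)) / (r - 2) * c powr (r - 2)"
  have C: "C > 0" using r c by (simp add: C_def)
  show ?thesis
  proof (rule exI[of _ C], intro conjI C allI impI)
    fix B \<sigma> :: real and H :: "'a \<Rightarrow> complex"
    assume B: "B > 0" and \<sigma>: "\<bar>\<sigma>\<bar> = 1" and Hi: "integrable lborel H"
      and dy: "\<forall>k. (\<integral>\<^sup>+\<xi>. indicator (annulus k) \<xi> * ennreal ((norm \<xi> powr s * norm (H \<xi>))\<^sup>2) \<partial>lborel) \<le> ennreal (B\<^sup>2)"
    have H [measurable]: "H \<in> borel_measurable borel" using Hi by auto
    let ?F = "\<lambda>x. norm (FT \<sigma> H x)"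
    let ?L = "\<lambda>\<xi>::'a. c * B * norm \<xi> powr \<theta>"
    let ?m = "\<lambda>lam. \<integral>\<^sup>+\<xi>. indicator {\<xi>. lam \<le> ?L \<xi>} \<xi> * ennreal ((norm (H \<xi>))\<^sup>2) \<partial>lborel"
    let ?k = "4 * (2 * pi) ^ DIM('a)"
    have level: "emeasure lborel {x. lam \<le> ?F x} \<le> ennreal (?k / lam\<^sup>2) * ?m lam" if "lam > 0" for lam
      using FT_level_set_le[OF s(1) s2 \<theta>_def B H dy[rule_format] Hi \<sigma> that]
      unfolding c_def M_def by simp
    have "(\<integral>\<^sup>+x. ennreal (?F x powr r) \<partial>lborel) =
        (\<integral>\<^sup>+x. (\<integral>\<^sup>+lam. ennreal r * ennreal (indicator {0..?F x} lam * lam powr (r - 1)) \<partial>lborel) \<partial>lborel)"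
    proof (intro nn_integral_cong)
      fix x
      have "(\<integral>\<^sup>+lam. ennreal r * ennreal (indicator {0..?F x} lam * lam powr (r - 1)) \<partial>lborel) =
          ennreal r * (\<integral>\<^sup>+lam. ennreal (indicator {0..?F x} lam * lam powr (r - 1)) \<partial>lborel)"
        by (rule nn_integral_cmult) measurable
      also have "\<dots> = ennreal r * ennreal (?F x powr r / r)"
        using r by (subst nn_integral_powr_Icc) auto
      also have "\<dots> = ennreal (?F x powr r)"
        using r by (simp add: ennreal_mult'[symmetric])
      finally show "ennreal (?F x powr r) =
          (\<integral>\<^sup>+lam. ennreal r * ennreal (indicator {0..?F x} lam * lam powr (r - 1)) \<partial>lborel)" ..
    qed
    also have "\<dots> = (\<integral>\<^sup>+lam. (\<integral>\<^sup>+x. ennreal r * ennreal (indicator {0..?F x} lam * lam powr (r - 1)) \<partial>lborel) \<partial>lborel)"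
      by (rule lborel_pair.Fubini') measurable
    also have "\<dots> \<le> (\<integral>\<^sup>+lam. (\<integral>\<^sup>+\<xi>. ennreal (r * ?k) * ennreal ((norm (H \<xi>))\<^sup>2) * ennreal (indicator {0..?L \<xi>} lam * lam powr (r - 2 - 1)) \<partial>lborel) \<partial>lborel)"
    proof (rule nn_integral_mono)
      fix lam :: real
      show "(\<integral>\<^sup>+x. ennreal r * ennreal (indicator {0..?F x} lam * lam powr (r - 1)) \<partial>lborel) \<le>
          (\<integral>\<^sup>+\<xi>. ennreal (r * ?k) * ennreal ((norm (H \<xi>))\<^sup>2) * ennreal (indicator {0..?L \<xi>} lam * lam powr (r - 2 - 1)) \<partial>lborel)"
      proof (cases "lam > 0")
        case True
        have "(\<integral>\<^sup>+x. ennreal r * ennreal (indicator {0..?F x} lam * lam powr (r - 1)) \<partial>lborel) =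
            (\<integral>\<^sup>+x. ennreal (r * lam powr (r - 1)) * indicator {x. lam \<le> ?F x} x \<partial>lborel)"
          using True r by (intro nn_integral_cong) (auto simp: indicator_def ennreal_mult'[symmetric])
        also have "\<dots> = ennreal (r * lam powr (r - 1)) * emeasure lborel {x. lam \<le> ?F x}"
          by (subst nn_integral_cmult_indicator) auto
        also have "\<dots> \<le> ennreal (r * lam powr (r - 1)) * (ennreal (?k / lam\<^sup>2) * ?m lam)"
          by (intro mult_left_mono level True) simp
        also have "\<dots> = ennreal (r * ?k * lam powr (r - 2 - 1)) * ?m lam"
        proof -
          have "lam powr (r - 2 - 1) = lam powr (r - 1) / lam powr 2"
            by (subst powr_diff[symmetric]) (simp add: algebra_simps)
          then have "lam powr (r - 2 - 1) = lam powr (r - 1) / lam\<^sup>2"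
            using True by simp
          then have "r * lam powr (r - 1) * (?k / lam\<^sup>2) = r * ?k * lam powr (r - 2 - 1)"
            by simp
          then show ?thesis
            using r by (simp add: mult.assoc[symmetric] ennreal_mult'[symmetric])
        qed
        also have "\<dots> = (\<integral>\<^sup>+\<xi>. ennreal (r * ?k * lam powr (r - 2 - 1)) * (indicator {\<xi>. lam \<le> ?L \<xi>} \<xi> * ennreal ((norm (H \<xi>))\<^sup>2)) \<partial>lborel)"
          by (rule nn_integral_cmult[symmetric]) measurable
        also have "\<dots> = (\<integral>\<^sup>+\<xi>. ennreal (r * ?k) * ennreal ((norm (H \<xi>))\<^sup>2) * ennreal (indicator {0..?L \<xi>} lam * lam powr (r - 2 - 1)) \<partial>lborel)"
          using True r by (intro nn_integral_cong) (auto simp: indicator_def ennreal_mult'[symmetric] mult_ac)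
        finally show ?thesis .
      next
        case False
        \<comment> \<open>For negative levels the indicator is 0; at level 0 the convention
          \<open>0 powr a = 0\<close> makes the integrand vanish.\<close>
        then have "indicator {0..?F x} lam * lam powr (r - 1) = 0" for x
          by (cases "lam = 0") (auto simp: indicator_def)
        then show ?thesis by (simp only: ennreal_0 mult_zero_right nn_integral_const mult_zero_left zero_le)
      qed
    qed
    also have "\<dots> = (\<integral>\<^sup>+\<xi>. (\<integral>\<^sup>+lam. ennreal (r * ?k) * ennreal ((norm (H \<xi>))\<^sup>2) * ennreal (indicator {0..?L \<xi>} lam * lam powr (r - 2 - 1)) \<partial>lborel) \<partial>lborel)"
      by (rule lborel_pair.Fubini') measurable
    also have "\<dots> = (\<integral>\<^sup>+\<xi>. ennreal (C * B powr (r - 2)) * ennreal ((norm \<xi> powr s * norm (H \<xi>))\<^sup>2) \<partial>lborel)"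
    proof (intro nn_integral_cong)
      fix \<xi> :: 'a
      have L: "0 \<le> ?L \<xi>" using c B by simp
      have "(\<integral>\<^sup>+lam. ennreal (r * ?k) * ennreal ((norm (H \<xi>))\<^sup>2) * ennreal (indicator {0..?L \<xi>} lam * lam powr (r - 2 - 1)) \<partial>lborel) =
          ennreal (r * ?k) * ennreal ((norm (H \<xi>))\<^sup>2) * ennreal (?L \<xi> powr (r - 2) / (r - 2))"
        using r by (subst nn_integral_cmult, measurable, subst nn_integral_powr_Icc[OF _ L]) auto
      also have "\<dots> = ennreal (r * ?k * (norm (H \<xi>))\<^sup>2 * (?L \<xi> powr (r - 2) / (r - 2)))"
        using r by (simp add: ennreal_mult'[symmetric])
      also have "r * ?k * (norm (H \<xi>))\<^sup>2 * (?L \<xi> powr (r - 2) / (r - 2)) =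
          C * B powr (r - 2) * (norm \<xi> powr s * norm (H \<xi>))\<^sup>2"
      proof -
        have "?L \<xi> powr (r - 2) = c powr (r - 2) * B powr (r - 2) * norm \<xi> powr (2 * s)"
          using c B by (simp add: powr_mult powr_powr \<theta>2)
        also have "norm \<xi> powr (2 * s) = (norm \<xi> powr s)\<^sup>2" by (simp add: powr_square)
        finally show ?thesis by (simp add: C_def power_mult_distrib mult_ac)
      qed
      also have "ennreal \<dots> = ennreal (C * B powr (r - 2)) * ennreal ((norm \<xi> powr s * norm (H \<xi>))\<^sup>2)"
        using C by (subst ennreal_mult) auto
      finally show "(\<integral>\<^sup>+lam. ennreal (r * ?k) * ennreal ((norm (H \<xi>))\<^sup>2) * ennreal (indicator {0..?L \<xi>} lam * lam powr (r - 2 - 1)) \<partial>lborel) =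
          ennreal (C * B powr (r - 2)) * ennreal ((norm \<xi> powr s * norm (H \<xi>))\<^sup>2)" .
    qed
    also have "\<dots> = ennreal (C * B powr (r - 2)) * (\<integral>\<^sup>+\<xi>. ennreal ((norm \<xi> powr s * norm (H \<xi>))\<^sup>2) \<partial>lborel)"
      by (rule nn_integral_cmult) measurable
    finally show "(\<integral>\<^sup>+x. ennreal (norm (FT \<sigma> H x) powr r) \<partial>lborel) \<le>
      ennreal (C * B powr (r - 2)) * (\<integral>\<^sup>+\<xi>. ennreal ((norm \<xi> powr s * norm (H \<xi>))\<^sup>2) \<partial>lborel)" .
  qed
qed

section \<open>The refined Sobolev inequality\<close>

lemma ennreal_pow_mono: "0 \<le> a \<Longrightarrow> x \<le> y \<Longrightarrow> ennreal_pow x a \<le> ennreal_pow y a"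
  unfolding ennreal_pow_def
  by (auto simp: top_unique less_top[symmetric] intro!: ennreal_leI powr_mono2 enn2real_mono)

lemma ennreal_pow_ennreal: "0 < a \<Longrightarrow> 0 \<le> x \<Longrightarrow> ennreal_pow (ennreal x) a = ennreal (x powr a)"
  by (simp add: ennreal_pow_def)

lemma ennreal_pow_cmult:
  assumes "0 < c"
  shows "ennreal_pow (ennreal c * x) a = ennreal (c powr a) * ennreal_pow x a"
proof (cases x)
  case (real y)
  then show ?thesis
    using assms by (auto simp: ennreal_pow_def ennreal_mult[symmetric] powr_mult)
next
  case top
  then show ?thesis
    using assms by (auto simp: ennreal_pow_def ennreal_mult_top)
qed

section \<open>Passage between distributions and their frequency side\<close>

lemma inv_fourier_schwartz: "\<phi> \<in> schwartz \<Longrightarrow> inv_fourier \<phi> \<in> schwartz"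
  unfolding inv_fourier_eq_FT by (intro schwartz_cmult FT_schwartz) simp_all

lemma fourier_inv_fourier:
  fixes \<phi> :: "'a::euclidean_space \<Rightarrow> complex"
  assumes "\<phi> \<in> schwartz"
  shows "fourier (inv_fourier \<phi>) = \<phi>"
proof
  fix x :: 'a
  have "fourier (inv_fourier \<phi>) x = complex_of_real (1 / (2 * pi) ^ DIM('a)) * FT (- 1) (FT 1 \<phi>) x"
    unfolding fourier_eq_FT inv_fourier_eq_FT by (rule FT_cmult)
  then show "fourier (inv_fourier \<phi>) x = \<phi> x"
    by (simp add: FT_inversion[OF assms])
qed

lemma inv_fourier_fourier:
  fixes \<phi> :: "'a::euclidean_space \<Rightarrow> complex"
  assumes "\<phi> \<in> schwartz"
  shows "inv_fourier (fourier \<phi>) = \<phi>"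
proof
  fix x :: 'a
  show "inv_fourier (fourier \<phi>) x = \<phi> x"
    using FT_inversion[OF assms, of "- 1" x] by (simp add: fourier_eq_FT inv_fourier_eq_FT)
qed

lemma represents_fourier_fun: "represents h (fourier_dist u) \<Longrightarrow> represents (fourier_fun u) (fourier_dist u)"
  unfolding fourier_fun_def by (rule someI[of "\<lambda>h. represents h (fourier_dist u)"])

lemma represents_dist_of_fun:
  assumes "G \<in> borel_measurable borel" "\<And>\<phi>. \<phi> \<in> schwartz \<Longrightarrow> integrable lborel (\<lambda>x. G x * \<phi> x)"
  shows "represents G (dist_of_fun G)"
  using assms by (simp add: represents_def)

text \<open>Guarantees that the Fourier transform of \<open>D s f\<close> is again a function, so
  that a second multiplier can act on it.\<close>

lemma represents_fourier_dist_inv_fourier_dist: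
  assumes "represents G (dist_of_fun G)"
  shows "represents G (fourier_dist (inv_fourier_dist (dist_of_fun G)))"
  using assms by (simp add: represents_def fourier_dist_def inv_fourier_dist_def inv_fourier_fourier)

text \<open>The part of Plancherel's theorem that bounds the multiplier by the \<open>L\<^sup>2\<close> norm of the
  distribution: every representative has a Fourier transform in \<open>L\<^sup>2\<close>, which must be \<open>G\<close>.\<close>

lemma Lp_norm_dist_2_inv_fourier_dist_ge:
  fixes G :: "'a::euclidean_space \<Rightarrow> complex"
  assumes G: "represents G (dist_of_fun G)"
  shows "ennreal ((2 * pi) powr (- real DIM('a) / 2)) * ennreal_pow (\<integral>\<^sup>+\<xi>. ennreal ((norm (G \<xi>))\<^sup>2) \<partial>lborel) (1 / 2) \<le>
    Lp_norm_dist 2 (inv_fourier_dist (dist_of_fun G))"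
  unfolding Lp_norm_dist_def
\<comment> \<open>It is enough to bound each representative; if there is none, the infimum is
  infinite and the bound is trivial.\<close>
proof (rule INF_greatest)
  fix g assume "g \<in> {h. represents h (inv_fourier_dist (dist_of_fun G))}"
  then have g: "g \<in> borel_measurable borel"
    and gi: "\<And>\<phi>. \<phi> \<in> schwartz \<Longrightarrow> integrable lborel (\<lambda>x. g x * \<phi> x)"
    and geq: "\<And>\<phi>. \<phi> \<in> schwartz \<Longrightarrow> (\<integral>\<xi>. G \<xi> * inv_fourier \<phi> \<xi> \<partial>lborel) = (\<integral>x. g x * \<phi> x \<partial>lborel)"
    by (auto simp: represents_def inv_fourier_dist_def dist_of_fun_def)
  note g [measurable]
  let ?n = "(2 * pi) ^ DIM('a)"
  let ?Ig = "\<integral>\<^sup>+x. ennreal ((norm (g x))\<^sup>2) \<partial>lborel"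
  let ?IG = "\<integral>\<^sup>+x. ennreal ((norm (G x))\<^sup>2) \<partial>lborel"
  have np: "norm z powr 2 = (norm z)\<^sup>2" for z :: complex
    by (cases "z = 0") (simp_all add: powr_numeral)
  have Lg: "Lp_norm 2 g = ennreal_pow ?Ig (1 / 2)"
    unfolding Lp_norm_def np ..
  have key: "?IG \<le> ennreal ?n * ?Ig"
  proof (cases "?Ig < \<infinity>")
    case False
    then show ?thesis by (simp add: ennreal_mult_top less_top[symmetric])
  next
    case True
    \<comment> \<open>\<open>F\<close> is the transform of \<open>g\<close>, obtained from
      truncations with exponent 2 and the Plancherel bound as majorant. It will turn out to
      represent the same functional as \<open>G\<close>.\<close>
    obtain F where F: "F \<in> borel_measurable borel"
      and F2: "(\<integral>\<^sup>+x. ennreal (norm (F x) powr 2) \<partial>lborel) \<le> (\<integral>\<^sup>+x. ennreal ?n * ennreal ((norm (g x))\<^sup>2) \<partial>lborel)"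
      and Fi: "\<And>\<phi>. \<phi> \<in> schwartz \<Longrightarrow> integrable lborel (\<lambda>x. F x * \<phi> x)"
      and Feq: "\<And>\<phi>. \<phi> \<in> schwartz \<Longrightarrow> (\<integral>x. F x * \<phi> x \<partial>lborel) = (\<integral>\<xi>. g \<xi> * FT (- 1) \<phi> \<xi> \<partial>lborel)"
    proof (rule FT_dist_Lp[OF g _ gi, of "\<lambda>x. ennreal ?n * ennreal ((norm (g x))\<^sup>2)" "- 1" 2])
      show "(\<integral>\<^sup>+x. ennreal ?n * ennreal ((norm (g x))\<^sup>2) \<partial>lborel) < \<infinity>"
        using True by (simp add: nn_integral_cmult ennreal_mult_less_top)
      fix A :: "'a set" assume [measurable]: "A \<in> sets borel" and A: "bounded A"
      have gg: "integrable lborel (\<lambda>x. g x * complex_of_real (gauss x))"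
        using gi[OF mod_gauss_schwartz[of 0]] by (simp add: mod_gauss_0)
      have "(\<integral>\<^sup>+x. ennreal (norm (FT (- 1) (\<lambda>\<xi>. indicator A \<xi> *\<^sub>R g \<xi>) x) powr 2) \<partial>lborel) \<le>
          ennreal ?n * (\<integral>\<^sup>+\<xi>. ennreal ((norm (indicator A \<xi> *\<^sub>R g \<xi>))\<^sup>2) \<partial>lborel)"
        unfolding np
        by (intro nn_integral_FT_square_le integrable_bounded_indicator gg A) auto
      also have "\<dots> = (\<integral>\<^sup>+\<xi>. ennreal ?n * ennreal ((norm (indicator A \<xi> *\<^sub>R g \<xi>))\<^sup>2) \<partial>lborel)"
        by (rule nn_integral_cmult[symmetric]) measurable
      also have "\<dots> = (\<integral>\<^sup>+\<xi>. indicator A \<xi> * (ennreal ?n * ennreal ((norm (g \<xi>))\<^sup>2)) \<partial>lborel)"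
        by (intro nn_integral_cong) (auto simp: indicator_def)
      finally show "(\<integral>\<^sup>+x. ennreal (norm (FT (- 1) (\<lambda>\<xi>. indicator A \<xi> *\<^sub>R g \<xi>) x) powr 2) \<partial>lborel) \<le> \<dots>" .
    qed auto
    have "represents F (dist_of_fun G)"
      unfolding represents_def
    proof (intro conjI ballI F Fi)
      fix \<psi> :: "'a \<Rightarrow> complex" assume \<psi>: "\<psi> \<in> schwartz"
      have f\<psi>: "FT (- 1) \<psi> \<in> schwartz" by (rule FT_schwartz[OF \<psi>]) simp
      have "dist_of_fun G \<psi> = (\<integral>\<xi>. G \<xi> * inv_fourier (FT (- 1) \<psi>) \<xi> \<partial>lborel)"
        using inv_fourier_fourier[OF \<psi>] by (simp add: dist_of_fun_def fourier_eq_FT)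
      also have "\<dots> = (\<integral>x. g x * FT (- 1) \<psi> x \<partial>lborel)" by (rule geq[OF f\<psi>])
      also have "\<dots> = dist_of_fun F \<psi>" by (simp add: Feq[OF \<psi>] dist_of_fun_def)
      finally show "dist_of_fun G \<psi> = dist_of_fun F \<psi>" .
    qed
    then have "AE x in lborel. F x = G x" by (rule represents_unique[OF _ G])
    then have "?IG = (\<integral>\<^sup>+x. ennreal (norm (F x) powr 2) \<partial>lborel)"
      unfolding np by (intro nn_integral_cong_AE) auto
    also note F2
    also have "(\<integral>\<^sup>+x. ennreal ?n * ennreal ((norm (g x))\<^sup>2) \<partial>lborel) = ennreal ?n * ?Ig"
      by (rule nn_integral_cmult) measurable
    finally show ?thesis .
  qed
  have n: "?n = (2 * pi) powr real DIM('a)" by (simp add: powr_realpow)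
  have "ennreal_pow ?IG (1 / 2) \<le> ennreal_pow (ennreal ?n * ?Ig) (1 / 2)"
    by (intro ennreal_pow_mono key) simp
  also have "\<dots> = ennreal ((2 * pi) powr (real DIM('a) / 2)) * ennreal_pow ?Ig (1 / 2)"
    unfolding n by (subst ennreal_pow_cmult) (simp_all add: powr_powr)
  finally have "ennreal ((2 * pi) powr (- real DIM('a) / 2)) * ennreal_pow ?IG (1 / 2) \<le>
      ennreal ((2 * pi) powr (- real DIM('a) / 2)) * (ennreal ((2 * pi) powr (real DIM('a) / 2)) * ennreal_pow ?Ig (1 / 2))"
    by (intro mult_left_mono) simp_all
  also have "\<dots> = ennreal ((2 * pi) powr (- real DIM('a) / 2) * (2 * pi) powr (real DIM('a) / 2)) * ennreal_pow ?Ig (1 / 2)"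
    by (simp add: ennreal_mult mult.assoc)
  also have "(2 * pi) powr (- real DIM('a) / 2) * (2 * pi) powr (real DIM('a) / 2) = 1"
    by (simp flip: powr_add)
  finally show "ennreal ((2 * pi) powr (- real DIM('a) / 2)) * ennreal_pow ?IG (1 / 2) \<le> Lp_norm 2 g"
    unfolding Lg by simp
qed

text \<open>The polynomial bound on the multiplier is moved onto the test function, which remains
  Schwartz.\<close>

lemma represents_multiplier:
  fixes h :: "'a::euclidean_space \<Rightarrow> complex"
  assumes h: "represents h (dist_of_fun h)" and m [measurable]: "m \<in> borel_measurable borel"
    and le: "\<And>\<xi>. \<bar>m \<xi>\<bar> \<le> (1 + (norm \<xi>)\<^sup>2) ^ N"
  shows "represents (\<lambda>\<xi>. complex_of_real (m \<xi>) * h \<xi>) (dist_of_fun (\<lambda>\<xi>. complex_of_real (m \<xi>) * h \<xi>))"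
proof (rule represents_dist_of_fun)
  have [measurable]: "h \<in> borel_measurable borel" using h by (simp add: represents_def)
  show "(\<lambda>\<xi>. complex_of_real (m \<xi>) * h \<xi>) \<in> borel_measurable borel" by measurable
  fix \<phi> :: "'a \<Rightarrow> complex" assume \<phi>: "\<phi> \<in> schwartz"
  note [measurable] = schwartz_measurable[OF \<phi>]
  show "integrable lborel (\<lambda>\<xi>. complex_of_real (m \<xi>) * h \<xi> * \<phi> \<xi>)"
  proof (rule Bochner_Integration.integrable_bound)
    show "integrable lborel (\<lambda>\<xi>. h \<xi> * (complex_of_real ((1 + (norm \<xi>)\<^sup>2) ^ N) * \<phi> \<xi>))"
      using h schwartz_one_plus_norm_sq_mult[OF \<phi>] by (auto simp: represents_def)
    show "AE \<xi> in lborel. norm (complex_of_real (m \<xi>) * h \<xi> * \<phi> \<xi>) \<le>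
        norm (h \<xi> * (complex_of_real ((1 + (norm \<xi>)\<^sup>2) ^ N) * \<phi> \<xi>))"
    proof (intro AE_I2)
      fix \<xi> :: 'a
      have "\<bar>m \<xi>\<bar> * (norm (h \<xi>) * norm (\<phi> \<xi>)) \<le> \<bar>(1 + (norm \<xi>)\<^sup>2) ^ N\<bar> * (norm (h \<xi>) * norm (\<phi> \<xi>))"
        by (intro mult_right_mono order_trans[OF le abs_ge_self]) auto
      then show "norm (complex_of_real (m \<xi>) * h \<xi> * \<phi> \<xi>) \<le>
          norm (h \<xi> * (complex_of_real ((1 + (norm \<xi>)\<^sup>2) ^ N) * \<phi> \<xi>))"
        by (simp only: norm_mult norm_of_real mult_ac)
    qed
  qed measurable
qed

lemma norm_powr_le: "0 \<le> s \<Longrightarrow> norm \<xi> powr s \<le> (1 + (norm \<xi>)\<^sup>2) ^ nat \<lceil>s\<rceil>"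
proof -
  assume s: "0 \<le> s"
  have 1: "norm \<xi> \<le> 1 + (norm \<xi>)\<^sup>2"
  proof -
    have "2 * norm \<xi> \<le> 1 + (norm \<xi>)\<^sup>2" using sum_squares_bound[of 1 "norm \<xi>"] by simp
    with norm_ge_zero[of \<xi>] show ?thesis by linarith
  qed
  have "norm \<xi> powr s \<le> (1 + (norm \<xi>)\<^sup>2) powr s" using 1 s by (intro powr_mono2) auto
  also have "\<dots> \<le> (1 + (norm \<xi>)\<^sup>2) powr real (nat \<lceil>s\<rceil>)"
    using s by (intro powr_mono) (auto simp: le_nat_iff real_nat_ceiling_ge)
  also have "\<dots> = (1 + (norm \<xi>)\<^sup>2) ^ nat \<lceil>s\<rceil>"
    by (intro powr_realpow) (simp add: add_pos_nonneg)
  finally show "norm \<xi> powr s \<le> (1 + (norm \<xi>)\<^sup>2) ^ nat \<lceil>s\<rceil>" .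
qed

lemma represents_fourier_dist_imp:
  assumes "represents h (fourier_dist u)"
  shows "represents h (dist_of_fun h)" and "\<phi> \<in> schwartz \<Longrightarrow> u \<phi> = (\<integral>\<xi>. h \<xi> * inv_fourier \<phi> \<xi> \<partial>lborel)"
proof -
  show "represents h (dist_of_fun h)" using assms by (auto simp: represents_def)
  assume \<phi>: "\<phi> \<in> schwartz"
  then show "u \<phi> = (\<integral>\<xi>. h \<xi> * inv_fourier \<phi> \<xi> \<partial>lborel)"
    using assms inv_fourier_schwartz[OF \<phi>]
    by (auto simp: represents_def fourier_dist_def dist_of_fun_def fourier_inv_fourier)
qed

text \<open>The two norms on the right enter only through lower bounds by the frequency-side
  integrals \<open>a\<close> and \<open>b k\<close>. On the left, the norm is an infimum, so it
  suffices to estimate the one representative of \<open>f\<close> that the extension principle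
  produces.\<close>

lemma refined_Sobolev:
  fixes r s :: real
  assumes "1 < r" and s: "0 < s" and rs: "1 / r + s / real DIM('a::euclidean_space) = 1 / 2"
  shows "\<exists>C::real. C > 0 \<and>
    (\<forall>f \<in> (homogeneous_sobolev s :: 'a dist set).
       Lp_norm_dist r f \<le>
         ennreal C
         * ennreal_pow (Lp_norm_dist 2 (D s f)) (1 - 2 * s / real DIM('a))
         * ennreal_pow (besov_norm (D s f)) (2 * s / real DIM('a)))"
proof -
  let ?d = "real DIM('a)"
  obtain C where C: "C > 0" and core: "\<And>B \<sigma> (H :: 'a \<Rightarrow> complex). B > 0 \<Longrightarrow> \<bar>\<sigma>\<bar> = 1 \<Longrightarrow> integrable lborel H \<Longrightarrow>
    (\<And>k. (\<integral>\<^sup>+\<xi>. indicator (annulus k) \<xi> * ennreal ((norm \<xi> powr s * norm (H \<xi>))\<^sup>2) \<partial>lborel) \<le> ennreal (B\<^sup>2)) \<Longrightarrow>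
    (\<integral>\<^sup>+x. ennreal (norm (FT \<sigma> H x) powr r) \<partial>lborel) \<le>
      ennreal (C * B powr (r - 2)) * (\<integral>\<^sup>+\<xi>. ennreal ((norm \<xi> powr s * norm (H \<xi>))\<^sup>2) \<partial>lborel)"
    using nn_integral_FT_powr_le[OF s assms(1) rs] by blast
  have e2: "2 / r = 1 - 2 * s / ?d" using rs by (simp add: field_simps)
  have sd: "2 * s / ?d > 0" using s by simp
  have r2: "r > 2"
  proof -
    have "s / ?d > 0" using s by simp
    then have "1 / r < 1 / 2" using rs by linarith
    then show ?thesis using assms(1) by (simp add: field_simps)
  qed
  \<comment> \<open>The Plancherel constant of this normalisation. The exponents on the right add up
    to 1, so exactly one factor 1/\<kappa> enters \<open>C'\<close>.\<close>
  define \<kappa> where "\<kappa> = (2 * pi) powr (- ?d / 2)"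
  have \<kappa>: "\<kappa> > 0" by (simp add: \<kappa>_def)
  define C' where "C' = C powr (1 / r) * (1 / \<kappa>)"
  show ?thesis
  proof (rule exI[of _ C'], intro conjI ballI)
    show "C' > 0" using C \<kappa> by (simp add: C'_def)
    fix u :: "'a dist" assume u: "u \<in> homogeneous_sobolev s"
    define h where "h = fourier_fun u"
    have h: "represents h (fourier_dist u)"
      using u represents_fourier_fun unfolding homogeneous_sobolev_def h_def by blast
    have hm [measurable]: "h \<in> borel_measurable borel"
      and hi: "\<And>\<phi>. \<phi> \<in> schwartz \<Longrightarrow> integrable lborel (\<lambda>x. h x * \<phi> x)"
      using h by (auto simp: represents_def)
    note hh = represents_fourier_dist_imp(1)[OF h]
    define G where "G = (\<lambda>\<xi>. complex_of_real (norm \<xi> powr s) * h \<xi>)"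
    have Gm [measurable]: "G \<in> borel_measurable borel" unfolding G_def by measurable
    have G: "represents G (dist_of_fun G)"
      unfolding G_def using norm_powr_le[of s] s
      by (intro represents_multiplier[OF hh, where N = "nat \<lceil>s\<rceil>"]) auto
    have Du: "D s u = inv_fourier_dist (dist_of_fun G)"
      by (simp add: D_def fourier_multiplier_def G_def h_def)
    have normG: "(norm (G \<xi>))\<^sup>2 = (norm \<xi> powr s * norm (h \<xi>))\<^sup>2" for \<xi>
      by (simp add: G_def norm_mult)
    define a where "a = (\<integral>\<^sup>+\<xi>. ennreal ((norm (G \<xi>))\<^sup>2) \<partial>lborel)"
    define b where "b k = (\<integral>\<^sup>+\<xi>. indicator (annulus k) \<xi> * ennreal ((norm (G \<xi>))\<^sup>2) \<partial>lborel)" for k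
    have a_le: "ennreal \<kappa> * ennreal_pow a (1 / 2) \<le> Lp_norm_dist 2 (D s u)"
      unfolding Du a_def \<kappa>_def by (rule Lp_norm_dist_2_inv_fourier_dist_ge[OF G])
    have a_fin: "a < \<infinity>"
    proof (rule ccontr)
      assume "\<not> a < \<infinity>"
      then have "a = \<infinity>" by (simp add: less_top[symmetric])
      then have "ennreal \<kappa> * ennreal_pow a (1 / 2) = \<infinity>"
        using \<kappa> by (simp add: ennreal_pow_def ennreal_mult_top)
      then show False using a_le u by (simp add: homogeneous_sobolev_def top_unique)
    qed
    have b_le_a: "b k \<le> a" for k
      unfolding a_def b_def by (intro nn_integral_mono) (auto simp: indicator_def)
    have b_le: "ennreal \<kappa> * ennreal_pow (b k) (1 / 2) \<le> besov_norm (D s u)" for k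
    proof -
      \<comment> \<open>The pieces of \<open>D s u\<close> are formed from the Fourier transform
        chosen for \<open>D s u\<close>, which agrees with \<open>G\<close> only almost
        everywhere.\<close>
      define G' where "G' = fourier_fun (D s u)"
      have rG: "represents G (fourier_dist (D s u))"
        unfolding Du by (rule represents_fourier_dist_inv_fourier_dist[OF G])
      have rG': "represents G' (fourier_dist (D s u))"
        unfolding G'_def by (rule represents_fourier_fun[OF rG])
      have ae: "AE \<xi> in lborel. G' \<xi> = G \<xi>" by (rule represents_unique[OF rG' rG])
      have [measurable]: "G' \<in> borel_measurable borel" using rG' by (simp add: represents_def)
      let ?A = "annulus k :: 'a set"
      have "represents (\<lambda>\<xi>. complex_of_real (indicator ?A \<xi>) * G' \<xi>) (dist_of_fun (\<lambda>\<xi>. complex_of_real (indicator ?A \<xi>) * G' \<xi>))"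
        by (rule represents_multiplier[OF represents_fourier_dist_imp(1)[OF rG'], where N = 0])
           (auto simp: indicator_def)
      from Lp_norm_dist_2_inv_fourier_dist_ge[OF this]
      have "ennreal \<kappa> * ennreal_pow (\<integral>\<^sup>+\<xi>. ennreal ((norm (complex_of_real (indicator ?A \<xi>) * G' \<xi>))\<^sup>2) \<partial>lborel) (1 / 2)
          \<le> Lp_norm_dist 2 (LP_piece k (D s u))"
        unfolding \<kappa>_def LP_piece_def fourier_multiplier_def G'_def annulus_def .
      also have "(\<integral>\<^sup>+\<xi>. ennreal ((norm (complex_of_real (indicator ?A \<xi>) * G' \<xi>))\<^sup>2) \<partial>lborel) = b k"
        unfolding b_def using ae by (intro nn_integral_cong_AE) (auto simp: indicator_def)
      also have "Lp_norm_dist 2 (LP_piece k (D s u)) \<le> besov_norm (D s u)"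
        unfolding besov_norm_def by (rule SUP_upper) simp
      finally show ?thesis .
    qed
    define \<alpha> where "\<alpha> = sqrt (enn2real a)"
    define \<beta> where "\<beta> = sqrt (enn2real (SUP k. b k))"
    have \<alpha>: "\<alpha> \<ge> 0" "a = ennreal (\<alpha>\<^sup>2)"
      using a_fin by (auto simp: \<alpha>_def)
    have sup_fin: "(SUP k. b k) < \<infinity>"
      using a_fin b_le_a by (meson SUP_least order.strict_trans1)
    have \<beta>: "\<beta> \<ge> 0" "(SUP k. b k) = ennreal (\<beta>\<^sup>2)"
      using sup_fin by (auto simp: \<beta>_def)
    have b\<beta>: "b k \<le> ennreal (\<beta>\<^sup>2)" for k
      unfolding \<beta>(2)[symmetric] by (rule SUP_upper) simp
    have pow_half: "ennreal_pow (ennreal (y\<^sup>2)) (1 / 2) = ennreal y" if "y \<ge> 0" for y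
      using that by (simp add: ennreal_pow_ennreal powr_half_sqrt)
    have \<alpha>_le: "ennreal \<alpha> \<le> ennreal (1 / \<kappa>) * Lp_norm_dist 2 (D s u)"
    proof -
      have "ennreal \<alpha> = ennreal (1 / \<kappa>) * (ennreal \<kappa> * ennreal_pow a (1 / 2))"
        using \<alpha> \<kappa> by (simp add: pow_half mult.assoc[symmetric] ennreal_mult'[symmetric])
      also have "\<dots> \<le> ennreal (1 / \<kappa>) * Lp_norm_dist 2 (D s u)"
        by (intro mult_left_mono a_le) simp
      finally show ?thesis .
    qed
    \<comment> \<open>The comparison is made for each piece before the supremum is taken. If the
      Besov norm is infinite the claim is trivial.\<close>
    have \<beta>_le: "ennreal \<beta> \<le> ennreal (1 / \<kappa>) * besov_norm (D s u)"
    proof -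
      have bk: "b k \<le> ennreal ((enn2real (ennreal (1 / \<kappa>) * besov_norm (D s u)))\<^sup>2)"
        if fin: "besov_norm (D s u) < \<infinity>" for k
      proof -
        let ?z = "enn2real (ennreal (1 / \<kappa>) * besov_norm (D s u))"
        have z: "ennreal ?z = ennreal (1 / \<kappa>) * besov_norm (D s u)"
          using fin by (simp add: ennreal_mult_less_top)
        have "b k < \<infinity>" using b_le_a a_fin by (rule order.strict_trans1)
        then obtain y where y: "y \<ge> 0" "b k = ennreal (y\<^sup>2)"
          by (metis (no_types, lifting) enn2real_nonneg ennreal_enn2real infinity_ennreal_def real_sqrt_ge_zero real_sqrt_pow2)
        have "ennreal y = ennreal (1 / \<kappa>) * (ennreal \<kappa> * ennreal_pow (b k) (1 / 2))"
          using y \<kappa> by (simp add: pow_half mult.assoc[symmetric] ennreal_mult'[symmetric])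
        also have "\<dots> \<le> ennreal (1 / \<kappa>) * besov_norm (D s u)"
          by (intro mult_left_mono b_le) simp
        finally have "ennreal y \<le> ennreal ?z" unfolding z .
        then have "y \<le> ?z" by simp
        then have "y\<^sup>2 \<le> ?z\<^sup>2" using y(1) by (intro power_mono)
        then show ?thesis unfolding y(2) by (rule ennreal_leI)
      qed
      show ?thesis
      proof (cases "besov_norm (D s u) < \<infinity>")
        case True
        let ?z = "enn2real (ennreal (1 / \<kappa>) * besov_norm (D s u))"
        have "ennreal (\<beta>\<^sup>2) \<le> ennreal (?z\<^sup>2)"
          unfolding \<beta>(2)[symmetric] by (intro SUP_least bk True)
        then have "\<beta>\<^sup>2 \<le> ?z\<^sup>2" by simp
        then have "\<beta> \<le> ?z" by (rule power2_le_imp_le) simp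
        then have "ennreal \<beta> \<le> ennreal ?z" by (rule ennreal_leI)
        also have "ennreal ?z = ennreal (1 / \<kappa>) * besov_norm (D s u)"
          using True by (simp add: ennreal_mult_less_top)
        finally show ?thesis .
      next
        case False
        then show ?thesis using \<kappa> by (simp add: less_top[symmetric] ennreal_mult_top)
      qed
    qed
    \<comment> \<open>\<open>B\<close> is taken larger than \<beta> since the core estimate needs B
      > 0, while \<beta> may be 0. The left side does not depend on \<open>B\<close>, so
      \<open>B\<close> may afterwards tend to \<beta>.\<close>
    have main: "Lp_norm_dist r u \<le> ennreal ((C * B powr (r - 2) * \<alpha>\<^sup>2) powr (1 / r))" if B: "B > \<beta>" for B
    proof -
      have B0: "B > 0" using \<beta>(1) B by simp
      let ?W = "\<lambda>\<xi>. ennreal (C * B powr (r - 2)) * ennreal ((norm (G \<xi>))\<^sup>2)"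
      have W: "(\<integral>\<^sup>+\<xi>. ?W \<xi> \<partial>lborel) = ennreal (C * B powr (r - 2) * \<alpha>\<^sup>2)"
      proof -
        have "(\<integral>\<^sup>+\<xi>. ?W \<xi> \<partial>lborel) = ennreal (C * B powr (r - 2)) * a"
          unfolding a_def by (rule nn_integral_cmult) measurable
        also have "\<dots> = ennreal (C * B powr (r - 2) * \<alpha>\<^sup>2)"
          unfolding \<alpha>(2) using C by (intro ennreal_mult[symmetric]) auto
        finally show ?thesis .
      qed
      have hg: "integrable lborel (\<lambda>x. h x * complex_of_real (gauss x))"
        using hi[OF mod_gauss_schwartz[of 0]] by (simp add: mod_gauss_0)
      obtain F where F: "F \<in> borel_measurable borel"
        and Fr: "(\<integral>\<^sup>+x. ennreal (norm (F x) powr r) \<partial>lborel) \<le> (\<integral>\<^sup>+\<xi>. ?W \<xi> \<partial>lborel)"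
        and Fi: "\<And>\<phi>. \<phi> \<in> schwartz \<Longrightarrow> integrable lborel (\<lambda>x. F x * \<phi> x)"
        and Feq: "\<And>\<phi>. \<phi> \<in> schwartz \<Longrightarrow> (\<integral>x. F x * \<phi> x \<partial>lborel) = (\<integral>\<xi>. h \<xi> * FT 1 \<phi> \<xi> \<partial>lborel)"
      proof (rule FT_dist_Lp[OF hm _ hi, of ?W 1 r])
        show "(\<integral>\<^sup>+\<xi>. ?W \<xi> \<partial>lborel) < \<infinity>" unfolding W by simp
        fix A :: "'a set" assume A [measurable]: "A \<in> sets borel" and Ab: "bounded A"
        let ?h = "\<lambda>\<xi>. indicator A \<xi> *\<^sub>R h \<xi>"
        have "(\<integral>\<^sup>+x. ennreal (norm (FT 1 ?h x) powr r) \<partial>lborel) \<le>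
          ennreal (C * B powr (r - 2)) * (\<integral>\<^sup>+\<xi>. ennreal ((norm \<xi> powr s * norm (?h \<xi>))\<^sup>2) \<partial>lborel)"
        proof (rule core[OF B0])
          show "integrable lborel ?h" by (rule integrable_bounded_indicator[OF hm A hg Ab])
          fix k
          have "(\<integral>\<^sup>+\<xi>. indicator (annulus k) \<xi> * ennreal ((norm \<xi> powr s * norm (?h \<xi>))\<^sup>2) \<partial>lborel) \<le> b k"
            unfolding b_def normG by (intro nn_integral_mono) (auto simp: indicator_def)
          also have "\<dots> \<le> ennreal (\<beta>\<^sup>2)" by (rule b\<beta>)
          also have "\<dots> \<le> ennreal (B\<^sup>2)" using B \<beta>(1) by (intro ennreal_leI power_mono) auto
          finally show "(\<integral>\<^sup>+\<xi>. indicator (annulus k) \<xi> * ennreal ((norm \<xi> powr s * norm (?h \<xi>))\<^sup>2) \<partial>lborel) \<le> ennreal (B\<^sup>2)" .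
        qed simp
        also have "\<dots> = (\<integral>\<^sup>+\<xi>. ennreal (C * B powr (r - 2)) * ennreal ((norm \<xi> powr s * norm (?h \<xi>))\<^sup>2) \<partial>lborel)"
          by (rule nn_integral_cmult[symmetric]) measurable
        also have "\<dots> = (\<integral>\<^sup>+\<xi>. indicator A \<xi> * ?W \<xi> \<partial>lborel)"
          unfolding normG by (intro nn_integral_cong) (auto simp: indicator_def)
        finally show "(\<integral>\<^sup>+x. ennreal (norm (FT 1 ?h x) powr r) \<partial>lborel) \<le> (\<integral>\<^sup>+\<xi>. indicator A \<xi> * ?W \<xi> \<partial>lborel)" .
      qed (use assms(1) in auto)
      \<comment> \<open>Passing from \<open>FT 1\<close> to the inverse transform brings the
        normalising factor back. It is at most 1 and is dropped in the norm bound.\<close>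
      let ?c = "1 / (2 * pi) ^ DIM('a)"
      let ?F = "\<lambda>x. complex_of_real ?c * F x"
      have rF: "represents ?F u"
        unfolding represents_def dist_of_fun_def
      proof (intro conjI ballI)
        show "?F \<in> borel_measurable borel" by (intro borel_measurable_times borel_measurable_const F)
        fix \<phi> :: "'a \<Rightarrow> complex" assume \<phi>: "\<phi> \<in> schwartz"
        show "integrable lborel (\<lambda>x. ?F x * \<phi> x)"
          unfolding mult.assoc by (intro integrable_mult_right Fi \<phi>)
        have "u \<phi> = (\<integral>\<xi>. h \<xi> * inv_fourier \<phi> \<xi> \<partial>lborel)"
          by (rule represents_fourier_dist_imp(2)[OF h \<phi>])
        also have "\<dots> = complex_of_real ?c * (\<integral>\<xi>. h \<xi> * FT 1 \<phi> \<xi> \<partial>lborel)"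
          unfolding inv_fourier_eq_FT integral_mult_right_zero[symmetric] by (simp only: mult_ac)
        also have "\<dots> = complex_of_real ?c * (\<integral>x. F x * \<phi> x \<partial>lborel)" by (simp only: Feq[OF \<phi>])
        also have "\<dots> = (\<integral>x. ?F x * \<phi> x \<partial>lborel)"
          unfolding integral_mult_right_zero[symmetric] mult.assoc ..
        finally show "u \<phi> = (\<integral>x. ?F x * \<phi> x \<partial>lborel)" .
      qed
      have "Lp_norm_dist r u \<le> Lp_norm r ?F"
        unfolding Lp_norm_dist_def using rF by (intro INF_lower) simp
      also have "\<dots> \<le> ennreal_pow (ennreal (C * B powr (r - 2) * \<alpha>\<^sup>2)) (1 / r)"
        unfolding Lp_norm_def
      proof (rule ennreal_pow_mono)
        have "1 \<le> (2 * pi) ^ DIM('a)" using pi_ge_two by (intro one_le_power) simp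
        moreover have "1 / x \<le> 1" if "1 \<le> x" for x :: real using that by simp
        ultimately have c: "0 \<le> ?c" "?c \<le> 1" by (simp, blast)
        have nF: "norm (?F x) \<le> norm (F x)" for x
          unfolding norm_mult norm_of_real using c by (intro mult_left_le_one_le) auto
        have "(\<integral>\<^sup>+x. ennreal (norm (?F x) powr r) \<partial>lborel) \<le> (\<integral>\<^sup>+x. ennreal (norm (F x) powr r) \<partial>lborel)"
          using assms(1) nF by (intro nn_integral_mono ennreal_leI powr_mono2) auto
        with Fr show "(\<integral>\<^sup>+x. ennreal (norm (?F x) powr r) \<partial>lborel) \<le> ennreal (C * B powr (r - 2) * \<alpha>\<^sup>2)"
          unfolding W by (rule order_trans[rotated])
      qed (use assms(1) in simp)
      also have "\<dots> = ennreal ((C * B powr (r - 2) * \<alpha>\<^sup>2) powr (1 / r))"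
        using C assms(1) by (intro ennreal_pow_ennreal) auto
      finally show ?thesis .
    qed
    have "Lp_norm_dist r u \<le> ennreal ((C * \<beta> powr (r - 2) * \<alpha>\<^sup>2) powr (1 / r))"
    proof (rule LIMSEQ_le_const)
      let ?B = "\<lambda>n. \<beta> + inverse (real (Suc n))"
      have "?B \<longlonglongrightarrow> \<beta> + 0" by (intro tendsto_add tendsto_const LIMSEQ_inverse_real_of_nat)
      then have B: "?B \<longlonglongrightarrow> \<beta>" by simp
      have B0: "0 \<le> ?B n" for n using \<beta>(1) by simp
      \<comment> \<open>Continuity of the power also at \<beta> = 0 uses r > 2.\<close>
      have p: "(\<lambda>n. ?B n powr (r - 2)) \<longlonglongrightarrow> \<beta> powr (r - 2)"
        using r2 B0 by (intro tendsto_powr'[OF B tendsto_const]) auto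
      have 1: "(\<lambda>n. C * ?B n powr (r - 2) * \<alpha>\<^sup>2) \<longlonglongrightarrow> C * \<beta> powr (r - 2) * \<alpha>\<^sup>2"
        by (intro tendsto_mult tendsto_const p)
      show "(\<lambda>n. ennreal ((C * ?B n powr (r - 2) * \<alpha>\<^sup>2) powr (1 / r))) \<longlonglongrightarrow>
          ennreal ((C * \<beta> powr (r - 2) * \<alpha>\<^sup>2) powr (1 / r))"
        using C assms(1) by (intro tendsto_ennrealI tendsto_powr'[OF 1 tendsto_const]) auto
      show "\<exists>N. \<forall>n\<ge>N. Lp_norm_dist r u \<le> ennreal ((C * ?B n powr (r - 2) * \<alpha>\<^sup>2) powr (1 / r))"
        by (intro exI allI impI main) simp
    qed
    \<comment> \<open>By the scaling relation 2/r = 1 - 2s/d, so 2/r and (r-2)/r are the exponents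
      of the statement.\<close>
    also have "(C * \<beta> powr (r - 2) * \<alpha>\<^sup>2) powr (1 / r) =
        C powr (1 / r) * \<alpha> powr (1 - 2 * s / ?d) * \<beta> powr (2 * s / ?d)"
    proof -
      have "(\<alpha>\<^sup>2) powr (1 / r) = \<alpha> powr (2 / r)"
        using \<alpha>(1) by (cases "\<alpha> = 0") (simp_all add: powr_powr flip: powr_numeral)
      moreover have "(\<beta> powr (r - 2)) powr (1 / r) = \<beta> powr (1 - 2 / r)"
        using assms(1) by (simp add: powr_powr diff_divide_distrib)
      ultimately show ?thesis
        using C \<alpha>(1) e2 by (simp add: powr_mult mult_ac)
    qed
    also have "ennreal \<dots> = ennreal (C powr (1 / r)) * ennreal_pow (ennreal \<alpha>) (1 - 2 * s / ?d) * ennreal_pow (ennreal \<beta>) (2 * s / ?d)"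
    proof -
      have "1 - 2 * s / ?d > 0" unfolding e2[symmetric] using assms(1) by simp
      then show ?thesis
        using \<alpha>(1) \<beta>(1) sd by (simp add: ennreal_pow_ennreal ennreal_mult)
    qed
    also have "\<dots> \<le> ennreal (C powr (1 / r)) *
        ennreal_pow (ennreal (1 / \<kappa>) * Lp_norm_dist 2 (D s u)) (1 - 2 * s / ?d) *
        ennreal_pow (ennreal (1 / \<kappa>) * besov_norm (D s u)) (2 * s / ?d)"
    proof (intro mult_mono mult_left_mono ennreal_pow_mono \<alpha>_le \<beta>_le)
      show "0 \<le> 1 - 2 * s / ?d" unfolding e2[symmetric] using assms(1) by simp
    qed (use sd in auto)
    also have "\<dots> = ennreal (C powr (1 / r)) * ennreal ((1 / \<kappa>) powr (1 - 2 * s / ?d) * (1 / \<kappa>) powr (2 * s / ?d)) *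
        ennreal_pow (Lp_norm_dist 2 (D s u)) (1 - 2 * s / ?d) * ennreal_pow (besov_norm (D s u)) (2 * s / ?d)"
    proof -
      have "0 < 1 / \<kappa>" using \<kappa> by simp
      moreover have "c * (k * x) * (l * y) = c * (k * l) * x * y" for c k l x y :: ennreal
        by (simp add: mult_ac)
      ultimately show ?thesis
        by (simp only: ennreal_pow_cmult ennreal_mult[OF powr_ge_zero powr_ge_zero])
    qed
    also have "(1 / \<kappa>) powr (1 - 2 * s / ?d) * (1 / \<kappa>) powr (2 * s / ?d) = 1 / \<kappa>"
      using \<kappa> by (simp flip: powr_add)
    also have "ennreal (C powr (1 / r)) * ennreal (1 / \<kappa>) = ennreal C'"
      using \<kappa> unfolding C'_def by (subst ennreal_mult) auto
    finally show "Lp_norm_dist r u \<le> ennreal C' * ennreal_pow (Lp_norm_dist 2 (D s u)) (1 - 2 * s / ?d)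
         * ennreal_pow (besov_norm (D s u)) (2 * s / ?d)" .
  qed
qed

text \<open>The multiplier \<open>norm \<xi> powr 0\<close> is 1 except at the origin, where it is
  0. Hence \<open>D 0 f\<close> and \<open>f\<close> agree on Schwartz functions, and every
  representative of \<open>D 0 f\<close> also represents \<open>f\<close>.\<close>

lemma Lp_norm_dist_le_D_0:
  assumes f: "f \<in> homogeneous_sobolev 0"
  shows "Lp_norm_dist p f \<le> Lp_norm_dist p (D 0 f :: 'a::euclidean_space dist)"
  unfolding Lp_norm_dist_def
proof (rule INF_superset_mono)
  show "{h. represents h (D 0 f)} \<subseteq> {h. represents h f}"
  proof (intro subsetI CollectI)
    fix g assume "g \<in> {h. represents h (D 0 f)}"
    then have g: "represents g (D 0 f)" by simp
    define h where "h = fourier_fun f"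
    have h: "represents h (fourier_dist f)"
      using f represents_fourier_fun unfolding homogeneous_sobolev_def h_def by blast
    have [measurable]: "h \<in> borel_measurable borel" using h by (simp add: represents_def)
    have "f \<phi> = D 0 f \<phi>" if \<phi>: "\<phi> \<in> schwartz" for \<phi>
    proof -
      note [measurable] = schwartz_measurable[OF inv_fourier_schwartz[OF \<phi>]]
      have "f \<phi> = (\<integral>\<xi>. h \<xi> * inv_fourier \<phi> \<xi> \<partial>lborel)"
        by (rule represents_fourier_dist_imp(2)[OF h \<phi>])
      also have "\<dots> = (\<integral>\<xi>. complex_of_real (norm \<xi> powr 0) * h \<xi> * inv_fourier \<phi> \<xi> \<partial>lborel)"
      proof (rule integral_cong_AE)
        show "AE \<xi> in lborel. h \<xi> * inv_fourier \<phi> \<xi> = complex_of_real (norm \<xi> powr 0) * h \<xi> * inv_fourier \<phi> \<xi>"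
          using AE_lborel_singleton[of 0] by eventually_elim simp
      qed measurable
      also have "\<dots> = D 0 f \<phi>"
        by (simp add: D_def fourier_multiplier_def inv_fourier_dist_def dist_of_fun_def h_def)
      finally show ?thesis .
    qed
    then show "represents g f" using g by (simp add: represents_def)
  qed
qed simp

theorem mainTheorem6:
  fixes r s :: real
  assumes "1 < r" and "0 \<le> s" and "1 / r + s / real CARD('d::finite) = 1 / 2"
  shows "\<exists>C::real. C > 0 \<and>
    (\<forall>f \<in> (homogeneous_sobolev s :: (real ^ 'd) dist set).
       Lp_norm_dist r f \<le>
         ennreal C
         * ennreal_pow (Lp_norm_dist 2 (D s f)) (1 - 2 * s / real CARD('d))
         * ennreal_pow (besov_norm (D s f)) (2 * s / real CARD('d)))"
proof (cases "s = 0")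
  case False
  then show ?thesis
    using refined_Sobolev[where 'a = "real ^ 'd", of r s] assms by simp
next
  case True
  \<comment> \<open>The scaling relation forces r = 2. The Besov factor then has exponent 0 and the
    constant 1 suffices.\<close>
  then have r: "r = 2" using assms by simp
  have pow1: "ennreal_pow x 1 = x" for x
    by (cases x) (simp_all add: ennreal_pow_def)
  have pow0: "ennreal_pow x 0 = 1" for x
    by (simp add: ennreal_pow_def)
  have e: "1 - 2 * s / real CARD('d) = 1" "2 * s / real CARD('d) = 0"
    by (simp_all add: True)
  show ?thesis
  proof (intro exI[of _ 1] conjI ballI)
    fix f :: "(real ^ 'd) dist" assume "f \<in> homogeneous_sobolev s"
    then have "Lp_norm_dist 2 f \<le> Lp_norm_dist 2 (D s f)"
      unfolding True by (rule Lp_norm_dist_le_D_0)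
    then show "Lp_norm_dist r f \<le> ennreal 1
         * ennreal_pow (Lp_norm_dist 2 (D s f)) (1 - 2 * s / real CARD('d))
         * ennreal_pow (besov_norm (D s f)) (2 * s / real CARD('d))"
      unfolding e r by (simp add: pow1 pow0)
  qed simp
qed

end
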